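(* Let $n\ge 2$ and let $\alpha_n=\sigma_1\sigma_2^{-1}\sigma_3\sigma_4^{-1}\cdots\sigma_{n-1}^{(-1)^n}\in B_n$. Then the braid $\alpha_n$ is rigid, and its Ultra Summit Set $U_A(\alpha_n)$ (with respect to the classical Garside structure) has at least $2^{[(n-2)/2]}$ elements, where $[x]$ denotes the integer part of $x$.
   Context: $B_n$ is the braid group on $n$ strands with Artin generators $\sigma_1,\dots,\sigma_{n-1}$ (relations $\sigma_i\sigma_j=\sigma_j\sigma_i$ for $|i-j|\ge2$, $\sigma_i\sigma_{i+1}\sigma_i=\sigma_{i+1}\sigma_i\sigma_{i+1}$). Braids are read from left to right. A braid is a permutation braid if it is represented by a diagram with only positive crossings (a word in the $\sigma_i$ without inverses) in which every pair of strands crosses at most once; it is uniquely determined by its permutation of strands. The Garside element $\Delta$ is the permutation braid with permutation $i\mapsto n+1-i$. Left normal form: every $b\in B_n$ has a unique expression $\Delta^k\cdot b_1\cdot b_2\cdots b_m$ ($k\in\mathbb Z$, $m\ge 0$), where each $b_i$ is a permutation braid different from $1$ and $\Delta$, and for all $i=1,\dots,m-1$ and $j=1,\dots,n-1$: if the $j$th and $(j+1)$th strands of $b_{i+1}$ (numbered by starting points) cross, then the two strands of $b_i$ which end at the $j$th and $(j+1)$th points also cross. Super Summit Set of $b$: the set of braids conjugate to $b$ in $B_n$ that have, among all conjugates of $b$, the maximal power $k$ of $\Delta$ and the minimal number $m$ of permutation braids in their left normal form. Cycling: if $b=\Delta^k b_1\cdots b_m$ is in left normal form, then ${\bf c}(b)=\Delta^k\cdot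 b_2\cdot b_3\cdots b_m\cdot(\Delta^k b_1\Delta^{-k})$, which is a conjugate of $b$; if $m=0$, put ${\bf c}(b)=b$. Ultra Summit Set $U_A(b)$: the set of elements $x$ of the Super Summit Set of $b$ such that ${\bf c}^d(x)=x$ for some integer $d\ge1$. Rigid: $b$ with left normal form $\Delta^k b_1\cdots b_m$ is rigid if the expression $\Delta^k\cdot b_2\cdots b_m\cdot(\Delta^k b_1\Delta^{-k})$ is, as written, in left normal form (this is regarded as automatically satisfied if $m=0$). *)

theory Defs
  imports "HOL-Algebra.Group" "HOL-Combinatorics.Transposition"
begin

text \<open>The letter \<open>(i, True)\<close> stands for the Artin generator with index \<open>i\<close>, and \<open>(i, False)\<close> for
  its inverse. Words are read from left to right.\<close>

type_synonym braid_word = "(nat \<times> bool) list"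

text \<open>A braid is an equivalence class of words.\<close>

type_synonym braid = "braid_word set"

definition braid_words :: "nat \<Rightarrow> braid_word set" where
  "braid_words n = lists ({1..<n} \<times> UNIV)"

text \<open>The least congruence on words containing free cancellation and the Artin relations.\<close>

inductive_set braid_cong :: "nat \<Rightarrow> (braid_word \<times> braid_word) set" for n :: nat where
  refl: "w \<in> braid_words n \<Longrightarrow> (w, w) \<in> braid_cong n"
| sym: "(u, v) \<in> braid_cong n \<Longrightarrow> (v, u) \<in> braid_cong n"
| trans: "(u, v) \<in> braid_cong n \<Longrightarrow> (v, w) \<in> braid_cong n \<Longrightarrow> (u, w) \<in> braid_cong n"
| append: "(u, u') \<in> braid_cong n \<Longrightarrow> (v, v') \<in> braid_cong n \<Longrightarrow> (u @ v, u' @ v') \<in> braid_cong n"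
| cancel: "i \<in> {1..<n} \<Longrightarrow> ([(i, e), (i, \<not> e)], []) \<in> braid_cong n"
| far: "i \<in> {1..<n} \<Longrightarrow> j \<in> {1..<n} \<Longrightarrow> i + 2 \<le> j \<Longrightarrow>
    ([(i, True), (j, True)], [(j, True), (i, True)]) \<in> braid_cong n"
| near: "i \<in> {1..<n} \<Longrightarrow> Suc i \<in> {1..<n} \<Longrightarrow>
    ([(i, True), (Suc i, True), (i, True)], [(Suc i, True), (i, True), (Suc i, True)]) \<in> braid_cong n"

definition braid_of :: "nat \<Rightarrow> braid_word \<Rightarrow> braid" where
  "braid_of n w = braid_cong n `` {w}"

definition braid_group :: "nat \<Rightarrow> braid monoid" where
  "braid_group n =
    \<lparr>carrier = braid_words n // braid_cong n,
     monoid.mult = (\<lambda>a b. \<Union>u\<in>a. \<Union>v\<in>b. braid_of n (u @ v)),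
     one = braid_of n []\<rparr>"

definition artin_gen :: "nat \<Rightarrow> nat \<Rightarrow> braid" where
  "artin_gen n i = braid_of n [(i, True)]"

definition braid_prod :: "nat \<Rightarrow> braid list \<Rightarrow> braid" where
  "braid_prod n bs = foldr (monoid.mult (braid_group n)) bs \<one>\<^bsub>braid_group n\<^esub>"

text \<open>Strands are numbered by their starting points: \<open>strand_end w s\<close> is the end point of strand \<open>s\<close>
  in the diagram of \<open>w\<close>, and \<open>crossings w s t\<close> is the number of crossings between the strands \<open>s\<close>
  and \<open>t\<close> (each of the letters \<open>(i, _)\<close> crosses the strands currently at positions \<open>i\<close> and \<open>i + 1\<close>).\<close>

fun strand_end :: "braid_word \<Rightarrow> nat \<Rightarrow> nat" where
  "strand_end [] s = s"
| "strand_end ((i, e) # w) s = strand_end w (transpose i (Suc i) s)"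

fun crossings :: "braid_word \<Rightarrow> nat \<Rightarrow> nat \<Rightarrow> nat" where
  "crossings [] s t = 0"
| "crossings ((i, e) # w) s t =
    (if {s, t} = {i, Suc i} then 1 else 0) +
    crossings w (transpose i (Suc i) s) (transpose i (Suc i) t)"

text \<open>Equivalent words induce the same permutation of end points (\<open>braid_cong_strand_end\<close> below).\<close>

definition braid_perm :: "braid \<Rightarrow> nat \<Rightarrow> nat" where
  "braid_perm b = the_elem (strand_end ` b)"

definition simple_word :: "braid_word \<Rightarrow> bool" where
  "simple_word w \<longleftrightarrow> (\<forall>(i, e)\<in>set w. e) \<and> (\<forall>s t. crossings w s t \<le> 1)"

definition permutation_braids :: "nat \<Rightarrow> braid set" where
  "permutation_braids n = {b \<in> carrier (braid_group n). \<exists>w\<in>b. simple_word w}"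

text \<open>Whether the strands \<open>s\<close> and \<open>t\<close> of a permutation braid cross, read off from a positive diagram
  in which every pair of strands crosses at most once.\<close>

definition strands_cross :: "braid \<Rightarrow> nat \<Rightarrow> nat \<Rightarrow> bool" where
  "strands_cross b s t \<longleftrightarrow> (\<exists>w\<in>b. simple_word w \<and> crossings w s t = 1)"

definition garside :: "nat \<Rightarrow> braid" where
  "garside n = (THE b. b \<in> permutation_braids n \<and> (\<forall>i\<in>{1..n}. braid_perm b i = n + 1 - i))"

definition left_weighted :: "nat \<Rightarrow> braid list \<Rightarrow> bool" where
  "left_weighted n bs \<longleftrightarrow>
    set bs \<subseteq> permutation_braids n - {\<one>\<^bsub>braid_group n\<^esub>, garside n} \<and>
    (\<forall>i j. Suc i < length bs \<longrightarrow> j \<in> {1..<n} \<longrightarrow> strands_cross (bs ! Suc i) j (Suc j) \<longrightarrow>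
      (\<exists>s t. braid_perm (bs ! i) s = j \<and> braid_perm (bs ! i) t = Suc j \<and> strands_cross (bs ! i) s t))"

definition garside_expr :: "nat \<Rightarrow> int \<Rightarrow> braid list \<Rightarrow> braid" where
  "garside_expr n k bs = (garside n [^]\<^bsub>braid_group n\<^esub> k) \<otimes>\<^bsub>braid_group n\<^esub> braid_prod n bs"

text \<open>The left normal form of \<open>b\<close>, as the pair of its power of the Garside element and its list of
  permutation braid factors.\<close>

definition left_normal_form :: "nat \<Rightarrow> braid \<Rightarrow> int \<times> braid list" where
  "left_normal_form n b = (THE (k, bs). left_weighted n bs \<and> b = garside_expr n k bs)"

definition garside_power :: "nat \<Rightarrow> braid \<Rightarrow> int" where
  "garside_power n b = fst (left_normal_form n b)"

definition factors :: "nat \<Rightarrow> braid \<Rightarrow> braid list" where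
  "factors n b = snd (left_normal_form n b)"

text \<open>The list of factors following the power of the Garside element in the expression for the cycling
  of a braid with left normal form \<open>(k, bs)\<close>, where \<open>bs\<close> is nonempty.\<close>

definition cycled_factors :: "nat \<Rightarrow> int \<Rightarrow> braid list \<Rightarrow> braid list" where
  "cycled_factors n k bs =
    tl bs @ [(garside n [^]\<^bsub>braid_group n\<^esub> k) \<otimes>\<^bsub>braid_group n\<^esub> hd bs
             \<otimes>\<^bsub>braid_group n\<^esub> (garside n [^]\<^bsub>braid_group n\<^esub> (- k))]"

definition cycling :: "nat \<Rightarrow> braid \<Rightarrow> braid" where
  "cycling n b =
    (if factors n b = [] then b
     else garside_expr n (garside_power n b) (cycled_factors n (garside_power n b) (factors n b)))"

definition rigid :: "nat \<Rightarrow> braid \<Rightarrow> bool" where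
  "rigid n b \<longleftrightarrow>
    factors n b = [] \<or> left_weighted n (cycled_factors n (garside_power n b) (factors n b))"

definition conjugates :: "nat \<Rightarrow> braid \<Rightarrow> braid set" where
  "conjugates n b =
    {g \<otimes>\<^bsub>braid_group n\<^esub> b \<otimes>\<^bsub>braid_group n\<^esub> inv\<^bsub>braid_group n\<^esub> g | g. g \<in> carrier (braid_group n)}"

definition super_summit_set :: "nat \<Rightarrow> braid \<Rightarrow> braid set" where
  "super_summit_set n b =
    {x \<in> conjugates n b. \<forall>y\<in>conjugates n b.
      garside_power n y \<le> garside_power n x \<and> length (factors n x) \<le> length (factors n y)}"

definition ultra_summit_set :: "nat \<Rightarrow> braid \<Rightarrow> braid set" where
  "ultra_summit_set n b = {x \<in> super_summit_set n b. \<exists>d\<ge>1. (cycling n ^^ d) x = x}"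

definition alpha :: "nat \<Rightarrow> braid" where
  "alpha n = braid_prod n
    (map (\<lambda>i. artin_gen n i [^]\<^bsub>braid_group n\<^esub> ((- 1) ^ (i + 1) :: int)) [1..<n])"

lemma braid_cong_words: "(u, v) \<in> braid_cong n \<Longrightarrow> u \<in> braid_words n \<and> v \<in> braid_words n"
  by (induction rule: braid_cong.induct) (simp_all add: braid_words_def)

lemma equiv_braid_cong: "equiv (braid_words n) (braid_cong n)"
proof (rule equivI)
  show "braid_cong n \<subseteq> braid_words n \<times> braid_words n"
    by (rule subrelI) (simp add: braid_cong_words)
  show "refl_on (braid_words n) (braid_cong n)"
    by (rule refl_onI) (rule braid_cong.refl)
  show "sym (braid_cong n)"
    by (rule symI) (rule braid_cong.sym)
  show "trans (braid_cong n)"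
    by (rule transI) (rule braid_cong.trans)
qed

lemma strand_end_append: "strand_end (u @ v) s = strand_end v (strand_end u s)"
  by (induction u arbitrary: s) auto

lemma braid_cong_strand_end: "(u, v) \<in> braid_cong n \<Longrightarrow> strand_end u = strand_end v"
proof (induction rule: braid_cong.induct)
  case (append u u' v v')
  then show ?case by (auto simp: strand_end_append fun_eq_iff)
qed (auto simp: fun_eq_iff transpose_def)

lemma braid_of_eq_iff:
  "u \<in> braid_words n \<Longrightarrow> v \<in> braid_words n \<Longrightarrow> braid_of n u = braid_of n v \<longleftrightarrow> (u, v) \<in> braid_cong n"
  unfolding braid_of_def by (simp add: eq_equiv_class_iff[OF equiv_braid_cong])

lemma braid_perm_braid_of:
  assumes "w \<in> braid_words n"
  shows "braid_perm (braid_of n w) = strand_end w"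
proof -
  have "strand_end ` braid_of n w = {strand_end w}"
    using braid_cong.refl[OF assms] by (auto simp: braid_of_def dest: braid_cong_strand_end)
  then show ?thesis by (simp add: braid_perm_def)
qed

lemma carrier_braid_group: "carrier (braid_group n) = braid_of n ` braid_words n"
  by (auto simp: braid_group_def braid_of_def quotient_def)

lemma mult_braid_of:
  assumes "u \<in> braid_words n" "v \<in> braid_words n"
  shows "braid_of n u \<otimes>\<^bsub>braid_group n\<^esub> braid_of n v = braid_of n (u @ v)"
proof -
  have *: "braid_of n (u' @ v') = braid_of n (u @ v)"
    if "u' \<in> braid_of n u" "v' \<in> braid_of n v" for u' v'
  proof -
    have "(u @ v, u' @ v') \<in> braid_cong n"
      using that by (simp add: braid_of_def braid_cong.append)
    then show ?thesis
      unfolding braid_of_def by (rule equiv_class_eq[OF equiv_braid_cong, symmetric])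
  qed
  have ne: "u \<in> braid_of n u" "v \<in> braid_of n v"
    using assms by (simp_all add: braid_of_def braid_cong.refl)
  have "(\<Union>u'\<in>braid_of n u. \<Union>v'\<in>braid_of n v. braid_of n (u' @ v')) =
      (\<Union>u'\<in>braid_of n u. \<Union>v'\<in>braid_of n v. braid_of n (u @ v))"
    by (simp add: * cong: SUP_cong)
  also have "\<dots> = braid_of n (u @ v)" using ne by blast
  finally show ?thesis by (simp add: braid_group_def)
qed

lemma inverse_word_cong:
  "w \<in> braid_words n \<Longrightarrow> (rev (map (\<lambda>(i, e). (i, \<not> e)) w) @ w, []) \<in> braid_cong n"
proof (induction w)
  case Nil
  then show ?case by (auto simp: braid_words_def intro: braid_cong.refl)
next
  case (Cons x w)
  obtain i e where x: "x = (i, e)" by (cases x)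
  let ?v = "rev (map (\<lambda>(i, e). (i, \<not> e)) w)"
  have w: "w \<in> braid_words n" and v: "?v \<in> braid_words n" and i: "i \<in> {1..<n}"
    using Cons.prems by (fastforce simp: braid_words_def x)+
  have "([(i, \<not> e), (i, e)], []) \<in> braid_cong n"
    using braid_cong.cancel[OF i, of "\<not> e"] by simp
  from braid_cong.append[OF braid_cong.refl[OF v] braid_cong.append[OF this braid_cong.refl[OF w]]]
  have "(rev (map (\<lambda>(i, e). (i, \<not> e)) (x # w)) @ (x # w), ?v @ w) \<in> braid_cong n"
    by (simp add: x)
  then show ?case using Cons.IH[OF w] by (rule braid_cong.trans)
qed

lemma group_braid_group: "group (braid_group n)"
proof (rule groupI)
  have nil: "[] \<in> braid_words n" by (simp add: braid_words_def)
  have app: "u @ v \<in> braid_words n" if "u \<in> braid_words n" "v \<in> braid_words n" for u v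
    using that by (simp add: braid_words_def)
  have one: "\<one>\<^bsub>braid_group n\<^esub> = braid_of n []" by (simp add: braid_group_def)
  show "\<one>\<^bsub>braid_group n\<^esub> \<in> carrier (braid_group n)"
    using nil by (simp add: one carrier_braid_group)
  fix a b c
  assume "a \<in> carrier (braid_group n)"
  then obtain u where u: "u \<in> braid_words n" "a = braid_of n u" by (auto simp: carrier_braid_group)
  show "\<one>\<^bsub>braid_group n\<^esub> \<otimes>\<^bsub>braid_group n\<^esub> a = a"
    using u nil by (simp add: one mult_braid_of)
  let ?v = "rev (map (\<lambda>(i, e). (i, \<not> e)) u)"
  have v: "?v \<in> braid_words n" using u by (fastforce simp: braid_words_def)
  then have "braid_of n ?v \<otimes>\<^bsub>braid_group n\<^esub> a = \<one>\<^bsub>braid_group n\<^esub>"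
    using u nil app[OF v u(1)] inverse_word_cong[OF u(1)] by (simp add: one mult_braid_of braid_of_eq_iff)
  then show "\<exists>y\<in>carrier (braid_group n). y \<otimes>\<^bsub>braid_group n\<^esub> a = \<one>\<^bsub>braid_group n\<^esub>"
    using v by (auto simp: carrier_braid_group)
  assume "b \<in> carrier (braid_group n)"
  then obtain v where v: "v \<in> braid_words n" "b = braid_of n v" by (auto simp: carrier_braid_group)
  show "a \<otimes>\<^bsub>braid_group n\<^esub> b \<in> carrier (braid_group n)"
    using u v app by (simp add: mult_braid_of carrier_braid_group)
  assume "c \<in> carrier (braid_group n)"
  then obtain w where w: "w \<in> braid_words n" "c = braid_of n w" by (auto simp: carrier_braid_group)
  show "a \<otimes>\<^bsub>braid_group n\<^esub> b \<otimes>\<^bsub>braid_group n\<^esub> c = a \<otimes>\<^bsub>braid_group n\<^esub> (b \<otimes>\<^bsub>braid_group n\<^esub> c)"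
    using u v w app by (simp add: mult_braid_of)
qed

end

theory Submission
  imports Defs "HOL-Combinatorics.Permutations"
begin

text \<open>The idea. A braid is \<^emph>\<open>layered\<close> when its strands can be given heights such that at every crossing the
  higher strand runs over the lower one. Listing the strands from top to bottom before reading such a
  braid \<open>x\<close> shows that \<open>x = N\<inverse> P\<close> with permutation braids \<open>N\<close> and \<open>P\<close>
  (\<open>sorted_layered_word\<close>), and \<open>\<Delta>\<inverse> \<cdot> \<Delta> N\<inverse> \<cdot> P\<close> is its left normal form as soon as strands
  in neighbouring layers satisfy a simple condition (\<open>layered_normal_form\<close>). A product that
  uses each Artin generator once, in any order and with arbitrary signs, is layered, because the graph of
  its crossings is a tree. All orders give conjugate braids, by cyclic shifts and commutations
  (\<open>alternating_conjugate\<close>). The products used here have the generators of odd index positive, those of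
  even index negative, and generator \<open>2 i\<close> either before or after generator \<open>2 i + 1\<close>, with a free choice
  for every \<open>1 \<le> i \<le> (n - 2) div 2\<close>; the increasing order gives \<open>\<alpha>\<^sub>n\<close>. The choices can be read off from
  the permutation of the strands (\<open>flip_iff_strand_end\<close>), hence there are \<open>2 ^ ((n - 2) div 2)\<close> such
  braids. For \<open>n \<ge> 3\<close>, explicit heights show that they all are rigid of the form \<open>\<Delta>\<inverse> p q\<close>
  (\<open>alternating_normal_form\<close>); for \<open>n = 2\<close>, \<open>\<alpha>\<^sub>n = \<Delta>\<close>.

  Cycling \<open>\<Delta>\<inverse> p q\<close> twice conjugates it by \<open>\<Delta>\<close> when it is rigid, and \<open>\<Delta>\<^sup>2\<close> is central; therefore four
  cyclings bring it back (\<open>cycling_period\<close>). That these braids lie in the Super Summit Set needs no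
  theory of summit sets: the exponent sum of \<open>\<alpha>\<^sub>n\<close> is \<open>0\<close> or \<open>1\<close> and its permutation fixes no
  strand, and for \<open>n \<ge> 3\<close> these two facts alone exclude normal forms with a nonnegative power of
  \<open>\<Delta>\<close> or with fewer than two factors (\<open>summit_bounds\<close>).

  Left normal forms are given by definite descriptions, so all this depends on their existence and
  uniqueness. Permutation braids correspond to permutations (\<open>simple_words_cong\<close>, Matsumoto's theorem),
  and divisibility between them is the weak order, inclusion of inversion sets, which has meets
  (\<open>meet_exists\<close>). Left multiplication turns normal forms of permutations into normal forms (\<open>push\<close>), and
  it respects products of permutations with additive lengths (\<open>push_additive\<close>); this makes the set of
  normal forms a set on which the braid group acts. Evaluating a normal form to a braid is equivariant,
  which gives existence, and a braid maps the trivial normal form to its own, which gives uniqueness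
  (\<open>left_normal_form_eqI\<close>).\<close>

section \<open>Inversions and the weak order\<close>

(* The index sets {1..n} and {1..<n} keep this form under simplification. *)
declare One_nat_def [simp del]

abbreviation pinv :: "(nat \<Rightarrow> nat) \<Rightarrow> nat \<Rightarrow> nat" where
  "pinv \<equiv> inv_into UNIV"

text \<open>Comparing two truth values, in place of the usual order condition on \<open>i\<close> and \<open>j\<close>, makes composition an
  exclusive or (\<open>inverts_comp\<close>) and turns the algebra of inversion sets into propositional logic.\<close>

definition inverts :: "(nat \<Rightarrow> nat) \<Rightarrow> nat \<Rightarrow> nat \<Rightarrow> bool" where
  "inverts p i j \<longleftrightarrow> (i < j) \<noteq> (p i < p j)"

text \<open>The weak order. For permutation braids, read from left to right, this is divisibility: the braid of \<open>p\<close>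
  is a prefix of the braid of \<open>q\<close>.\<close>

definition weak_le :: "(nat \<Rightarrow> nat) \<Rightarrow> (nat \<Rightarrow> nat) \<Rightarrow> bool" (infix "\<preceq>" 50) where
  "p \<preceq> q \<longleftrightarrow> (\<forall>i j. inverts p i j \<longrightarrow> inverts q i j)"

text \<open>No pair of strands crosses both in \<open>p\<close> and, afterwards, in \<open>q\<close>. The product of the two permutation
  braids is then the permutation braid of \<open>q \<circ> p\<close>.\<close>

definition additive :: "(nat \<Rightarrow> nat) \<Rightarrow> (nat \<Rightarrow> nat) \<Rightarrow> bool" where
  "additive p q \<longleftrightarrow> (\<forall>i j. \<not> (inverts p i j \<and> inverts q (p i) (p j)))"

lemma inverts_comp: "inverts (q \<circ> p) i j \<longleftrightarrow> inverts p i j \<noteq> inverts q (p i) (p j)"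
  by (auto simp: inverts_def)

lemma inverts_id [simp]: "\<not> inverts id i j"
  by (simp add: inverts_def)

lemma inverts_same [simp]: "\<not> inverts p i i"
  by (simp add: inverts_def)

lemma inverts_commute: "inj p \<Longrightarrow> inverts p i j \<longleftrightarrow> inverts p j i"
  unfolding inverts_def inj_def by (metis linorder_less_linear order_less_asym)

lemma inverts_inv: "bij p \<Longrightarrow> inverts (pinv p) i j \<longleftrightarrow> inverts p (pinv p i) (pinv p j)"
  by (auto simp: inverts_def bij_is_surj surj_f_inv_f)

lemma inverts_transpose: "inverts (transpose i (Suc i)) a b \<longleftrightarrow> {a, b} = {i, Suc i}"
  by (auto simp: inverts_def transpose_def doubleton_eq_iff)

lemma weak_le_refl [simp]: "p \<preceq> p"
  by (simp add: weak_le_def)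

lemma weak_le_trans: "p \<preceq> q \<Longrightarrow> q \<preceq> r \<Longrightarrow> p \<preceq> r"
  by (simp add: weak_le_def)

lemma id_weak_le [simp]: "id \<preceq> p"
  by (simp add: weak_le_def)

lemma additive_id [simp]: "additive id q" "additive p id"
  by (simp_all add: additive_def)

lemma additive_iff_weak_le: "additive p q \<longleftrightarrow> p \<preceq> q \<circ> p"
  unfolding additive_def weak_le_def inverts_comp by blast

text \<open>Both sides say that no pair of strands crosses more than once in the course of \<open>p\<close>, \<open>q\<close> and \<open>r\<close>.\<close>

lemma additive_assoc:
  assumes "bij p"
  shows "additive p q \<and> additive (q \<circ> p) r \<longleftrightarrow> additive q r \<and> additive p (r \<circ> q)"
proof -
  have all: "(\<forall>i j. P i j) \<longleftrightarrow> (\<forall>i j. P (p i) (p j))" for P :: "nat \<Rightarrow> nat \<Rightarrow> bool"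
    using assms by (metis bij_pointE)
  have "additive q r \<longleftrightarrow> (\<forall>i j. \<not> (inverts q (p i) (p j) \<and> inverts r (q (p i)) (q (p j))))"
    unfolding additive_def by (rule all)
  then show ?thesis
    unfolding additive_def[of p] additive_def[of "q \<circ> p"] inverts_comp comp_apply by blast
qed

lemma weak_le_cancel:
  assumes "bij p" "additive p q" "additive p r"
  shows "q \<circ> p \<preceq> r \<circ> p \<longleftrightarrow> q \<preceq> r"
proof -
  have all: "(\<forall>i j. P i j) \<longleftrightarrow> (\<forall>i j. P (p i) (p j))" for P :: "nat \<Rightarrow> nat \<Rightarrow> bool"
    using assms(1) by (metis bij_pointE)
  have "q \<preceq> r \<longleftrightarrow> (\<forall>i j. inverts q (p i) (p j) \<longrightarrow> inverts r (p i) (p j))"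
    unfolding weak_le_def by (rule all)
  then show ?thesis
    using assms(2,3) unfolding weak_le_def additive_def inverts_comp by blast
qed

lemma additive_quotient:
  assumes "bij p" "p \<preceq> q"
  shows "additive p (q \<circ> pinv p)" "q \<circ> pinv p \<circ> p = q"
proof -
  show eq: "q \<circ> pinv p \<circ> p = q"
    using assms(1) by (simp add: fun_eq_iff bij_is_inj)
  show "additive p (q \<circ> pinv p)"
    using assms(2) by (simp add: additive_iff_weak_le eq)
qed

context
  fixes n :: nat
begin

abbreviation perm :: "(nat \<Rightarrow> nat) \<Rightarrow> bool" where
  "perm p \<equiv> p permutes {1..n}"

lemma perm_bij: "perm p \<Longrightarrow> bij p"
  by (rule permutes_bij)

lemma perm_comp: "perm p \<Longrightarrow> perm q \<Longrightarrow> perm (q \<circ> p)"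
  by (rule permutes_compose)

lemma perm_inv: "perm p \<Longrightarrow> perm (pinv p)"
  by (rule permutes_inv)

lemma perm_id [simp]: "perm id"
  by (rule permutes_id)

lemma perm_transpose: "i \<in> {1..<n} \<Longrightarrow> perm (transpose i (Suc i))"
  by (intro permutes_swap_id) auto

lemma perm_range:
  assumes "perm p" shows "p i \<in> {1..n} \<longleftrightarrow> i \<in> {1..n}"
  using permutes_in_image[OF assms] by simp

lemma inverts_range:
  assumes "perm p" "inverts p i j"
  shows "i \<in> {1..n}" "j \<in> {1..n}"
proof -
  have out: "p x = x" if "x \<notin> {1..n}" for x
    using assms(1) that by (simp add: permutes_def)
  have "i \<in> {1..n} \<and> j \<in> {1..n}"
  proof (rule ccontr)
    assume not: "\<not> ?thesis"
    have "p i \<in> {1..n} \<longleftrightarrow> i \<in> {1..n}" "p j \<in> {1..n} \<longleftrightarrow> j \<in> {1..n}"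
      using perm_range[OF assms(1)] by blast+
    then have "(i < j) = (p i < p j)"
      using not out[of i] out[of j] by (cases "i \<in> {1..n}"; cases "j \<in> {1..n}") auto
    then show False using assms(2) by (simp add: inverts_def)
  qed
  then show "i \<in> {1..n}" "j \<in> {1..n}" by auto
qed

lemma perm_no_descent:
  assumes p: "perm p" and asc: "\<And>j. j \<in> {1..<n} \<Longrightarrow> \<not> inverts p j (Suc j)"
  shows "p = id"
proof -
  have "i \<le> n \<longrightarrow> i \<le> p i" for i
  proof (induction i)
    case (Suc i)
    show ?case
    proof (cases "i = 0")
      case True
      then show ?thesis using perm_range[OF p, of 1] by (auto simp: One_nat_def)
    next
      case False
      show ?thesis
      proof
        assume "Suc i \<le> n"
        with False have "p i < p (Suc i)" using asc[of i] by (auto simp: inverts_def)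
        with Suc \<open>Suc i \<le> n\<close> show "Suc i \<le> p (Suc i)" by simp
      qed
    qed
  qed simp
  then show ?thesis by (intro permutes_natset_ge[OF p]) auto
qed

lemma perm_descent:
  assumes "perm p" "p \<noteq> id"
  obtains j where "j \<in> {1..<n}" "inverts p j (Suc j)"
  using perm_no_descent[OF assms(1)] assms(2) by blast

lemma weak_le_antisym:
  assumes p: "perm p" and q: "perm q" and le: "p \<preceq> q" "q \<preceq> p"
  shows "p = q"
proof -
  have "additive p (q \<circ> pinv p)" and eq: "q \<circ> pinv p \<circ> p = q"
    using additive_quotient[OF perm_bij[OF p] le(1)] by auto
  then have "additive p id \<and> q \<circ> pinv p \<circ> p \<preceq> id \<circ> p" using le by simp
  then have "q \<circ> pinv p \<preceq> id"
    using weak_le_cancel[OF perm_bij[OF p]] \<open>additive p (q \<circ> pinv p)\<close> by blast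
  then have "q \<circ> pinv p = id"
    by (intro perm_no_descent perm_comp perm_inv p q) (simp add: weak_le_def)
  with eq show ?thesis by (metis id_comp)
qed

lemma weak_le_id: "perm p \<Longrightarrow> p \<preceq> id \<Longrightarrow> p = id"
  by (rule weak_le_antisym) auto

lemma additive_eq_id:
  assumes "perm p" "perm q" "additive p q" "q \<circ> p = id"
  shows "p = id" "q = id"
proof -
  show "p = id" using assms weak_le_id by (simp add: additive_iff_weak_le)
  with assms(4) show "q = id" by simp
qed

text \<open>The number of predecessors of an element is its rank. This turns prescribed inversion sets, and later
  heights of strands, into permutations.\<close>

lemma perm_of_order:
  assumes irr: "\<And>i. \<not> R i i"
    and tr: "\<And>i j k. i \<in> {1..n} \<Longrightarrow> j \<in> {1..n} \<Longrightarrow> k \<in> {1..n} \<Longrightarrow> R i j \<Longrightarrow> R j k \<Longrightarrow> R i k"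
    and tot: "\<And>i j. i \<in> {1..n} \<Longrightarrow> j \<in> {1..n} \<Longrightarrow> i \<noteq> j \<Longrightarrow> R i j \<or> R j i"
  obtains p where "perm p" "\<And>i j. i \<in> {1..n} \<Longrightarrow> j \<in> {1..n} \<Longrightarrow> p i < p j \<longleftrightarrow> R i j"
proof -
  define p where "p i = (if i \<in> {1..n} then Suc (card {j \<in> {1..n}. R j i}) else i)" for i
  have less: "p i < p j" if "i \<in> {1..n}" "j \<in> {1..n}" "R i j" for i j
  proof -
    have "{k \<in> {1..n}. R k i} \<subset> {k \<in> {1..n}. R k j}"
    proof
      show "{k \<in> {1..n}. R k i} \<subseteq> {k \<in> {1..n}. R k j}"
        using tr[OF _ that(1,2) _ that(3)] by blast
      show "{k \<in> {1..n}. R k i} \<noteq> {k \<in> {1..n}. R k j}"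
        using that irr by blast
    qed
    then show ?thesis using that by (simp add: p_def psubset_card_mono)
  qed
  have iff: "p i < p j \<longleftrightarrow> R i j" if "i \<in> {1..n}" "j \<in> {1..n}" for i j
    using less[OF that] less[OF that(2,1)] tot[OF that] by (metis less_asym' less_irrefl)
  have "inj_on p {1..n}"
    using tot iff by (metis inj_onI less_irrefl)
  moreover have "p ` {1..n} \<subseteq> {1..n}"
  proof
    fix y assume "y \<in> p ` {1..n}"
    then obtain i where i: "i \<in> {1..n}" "y = p i" by blast
    have "{j \<in> {1..n}. R j i} \<subset> {1..n}" using i(1) irr by blast
    then have "card {j \<in> {1..n}. R j i} < card {1..n}" by (intro psubset_card_mono) auto
    then show "y \<in> {1..n}" using i by (simp add: p_def)
  qed
  ultimately have "bij_betw p {1..n} {1..n}"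
    by (simp add: bij_betw_def endo_inj_surj)
  then have "perm p" by (rule bij_imp_permutes) (auto simp: p_def)
  then show ?thesis using iff that by blast
qed

text \<open>A pair outside one of the two inversion sets cannot be inverted below both \<open>p\<close> and \<open>q\<close>, and neither can
  a pair that is joined by an increasing chain of such pairs. The remaining pairs are the inversions of a
  permutation: being related by a chain is transitive, and so is not being related by a chain, because a
  step of a chain that passes over an intermediate point can be split there.\<close>

lemma meet_exists:
  assumes p: "perm p" and q: "perm q"
  obtains m where "perm m" "m \<preceq> p" "m \<preceq> q"
    "\<And>u. perm u \<Longrightarrow> u \<preceq> p \<Longrightarrow> u \<preceq> q \<Longrightarrow> u \<preceq> m"
proof -
  define N where "N = {(i, j). i \<in> {1..n} \<and> j \<in> {1..n} \<and> i < j \<and> \<not> (inverts p i j \<and> inverts q i j)}"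
  define C where "C = N\<^sup>+"
  define R where "R i j \<longleftrightarrow> i < j \<and> (i, j) \<in> C \<or> j < i \<and> (j, i) \<notin> C" for i j
  have C_range: "i \<in> {1..n} \<and> j \<in> {1..n} \<and> i < j" if "(i, j) \<in> C" for i j
    using that unfolding C_def by (induction rule: trancl_induct) (auto simp: N_def)
  have C_trans: "(i, k) \<in> C" if "(i, j) \<in> C" "(j, k) \<in> C" for i j k
    using that unfolding C_def by (rule trancl_trans)
  have N_split: "(i, j) \<in> N \<or> (j, k) \<in> N" if "(i, k) \<in> N" "i < j" "j < k" for i j k
    using that unfolding N_def inverts_def by auto
  have C_split: "(i, j) \<in> C \<or> (j, k) \<in> C" if "(i, k) \<in> C" "i < j" "j < k" for i j k
    using that unfolding C_def
  proof (induction arbitrary: j rule: trancl_induct)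
    case (base y)
    then show ?case using N_split by blast
  next
    case (step y z)
    consider "j < y" | "j = y" | "y < j" by linarith
    then show ?case
    proof cases
      case 1
      then show ?thesis using step by (meson trancl.trancl_into_trancl)
    next
      case 2
      then show ?thesis using step by blast
    next
      case 3
      then show ?thesis using step N_split[of y z j] by (meson r_into_trancl trancl.trancl_into_trancl)
    qed
  qed
  have R_trans: "R i k" if ij: "R i j" and jk: "R j k" for i j k
  proof -
    consider "i < j \<and> j < k" | "i < k \<and> k < j" | "j < i \<and> i < k" | "j < k \<and> k < i" | "k < i \<and> i < j"
      | "k < j \<and> j < i" | "i = k"
      using ij jk unfolding R_def by force
    then show ?thesis
      using ij jk C_trans C_split unfolding R_def
      by cases (metis less_asym' less_trans)+
  qed
  have R_tot: "R i j \<or> R j i" if "i \<noteq> j" for i j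
    using that unfolding R_def by auto
  obtain m where m: "perm m" "\<And>i j. i \<in> {1..n} \<Longrightarrow> j \<in> {1..n} \<Longrightarrow> m i < m j \<longleftrightarrow> R i j"
    by (rule perm_of_order[of R]) (use R_trans R_tot in \<open>auto simp: R_def\<close>)
  have inv_m: "inverts m i j \<longleftrightarrow> (i, j) \<notin> C" if "i \<in> {1..n}" "j \<in> {1..n}" "i < j" for i j
    using that m(2)[OF that(1,2)] by (simp add: inverts_def R_def)
  have le: "x \<preceq> y" if x: "perm x" and y: "perm y"
      and "\<And>i j. i \<in> {1..n} \<Longrightarrow> j \<in> {1..n} \<Longrightarrow> i < j \<Longrightarrow> inverts x i j \<Longrightarrow> inverts y i j" for x y
    unfolding weak_le_def
  proof (intro allI impI)
    fix i j assume xij: "inverts x i j"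
    consider "i < j" | "j < i" | "i = j" by linarith
    then show "inverts y i j"
    proof cases
      case 2
      then show ?thesis
        using that(3)[of j i] inverts_range[OF x xij] xij inverts_commute permutes_inj x y by metis
    qed (use that(3) inverts_range[OF x xij] xij in auto)
  qed
  show ?thesis
  proof
    show "perm m" by fact
    show "m \<preceq> p"
      by (rule le[OF m(1) p]) (use inv_m in \<open>auto simp: C_def N_def\<close>)
    show "m \<preceq> q"
      by (rule le[OF m(1) q]) (use inv_m in \<open>auto simp: C_def N_def\<close>)
    fix u assume u: "perm u" "u \<preceq> p" "u \<preceq> q"
    have "\<not> inverts u i j \<and> i < j" if "(i, j) \<in> C" for i j
      using that unfolding C_def
    proof (induction rule: trancl_induct)
      case (base y)
      then show ?case using u by (auto simp: N_def weak_le_def)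
    next
      case (step y z)
      then have "\<not> inverts u y z" "y < z" using u by (auto simp: N_def weak_le_def)
      with step show ?case by (auto simp: inverts_def)
    qed
    then show "u \<preceq> m"
      using inv_m by (intro le[OF u(1) m(1)]) blast
  qed
qed

definition delta :: "nat \<Rightarrow> nat" where
  "delta i = (if i \<in> {1..n} then n + 1 - i else i)"

lemma delta_delta [simp]: "delta (delta i) = i"
  by (auto simp: delta_def)

lemma perm_delta: "perm delta"
  by (rule bij_imp_permutes, rule bij_betwI[where g = delta]) (auto simp: delta_def)

lemma inv_delta [simp]: "pinv delta = delta"
  by (rule inv_unique_comp) (simp_all add: fun_eq_iff)

lemma inverts_delta: "inverts delta i j \<longleftrightarrow> i \<in> {1..n} \<and> j \<in> {1..n} \<and> i \<noteq> j"
  by (auto simp: inverts_def delta_def)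

lemma weak_le_delta:
  assumes "perm p" shows "p \<preceq> delta"
  unfolding weak_le_def inverts_delta using inverts_range[OF assms] by force

lemma additive_delta:
  assumes "perm p" shows "q \<circ> p = delta \<Longrightarrow> additive p q"
  using weak_le_delta[OF assms] by (simp add: additive_iff_weak_le)

text \<open>The permutation \<open>delta \<circ> pinv p\<close> is the complement of \<open>p\<close>: following \<open>p\<close>, it crosses exactly the pairs
  that \<open>p\<close> has left uncrossed.\<close>

lemma additive_iff_complement:
  assumes p: "perm p" and u: "perm u"
  shows "additive p u \<longleftrightarrow> u \<preceq> delta \<circ> pinv p"
proof -
  have all: "(\<forall>i j. P i j) \<longleftrightarrow> (\<forall>i j. P (p i) (p j))" for P :: "nat \<Rightarrow> nat \<Rightarrow> bool"
    using perm_bij[OF p] by (metis bij_pointE)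
  have pinv_p: "pinv p (p i) = i" for i using permutes_inj[OF p] by simp
  have cond: "inverts (delta \<circ> pinv p) (p i) (p j) \<longleftrightarrow> \<not> inverts p i j"
    if "inverts u (p i) (p j)" for i j
  proof -
    have "p i \<in> {1..n}" "p j \<in> {1..n}" "i \<noteq> j"
      using inverts_range[OF u that] that by auto
    then have "i \<in> {1..n} \<and> j \<in> {1..n} \<and> i \<noteq> j" using perm_range[OF p] by blast
    then show ?thesis by (auto simp: inverts_comp inverts_delta pinv_p inverts_inv[OF perm_bij[OF p]])
  qed
  have "u \<preceq> delta \<circ> pinv p \<longleftrightarrow>
      (\<forall>i j. inverts u (p i) (p j) \<longrightarrow> inverts (delta \<circ> pinv p) (p i) (p j))"
    unfolding weak_le_def by (rule all)
  then show ?thesis unfolding additive_def using cond by blast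
qed

text \<open>Conjugation by the Garside element.\<close>

definition tau :: "(nat \<Rightarrow> nat) \<Rightarrow> nat \<Rightarrow> nat" where
  "tau p = delta \<circ> p \<circ> delta"

lemma perm_tau: "perm p \<Longrightarrow> perm (tau p)"
  unfolding tau_def by (intro perm_comp perm_delta)

lemma tau_tau [simp]: "tau (tau p) = p"
  by (simp add: tau_def fun_eq_iff)

lemma tau_comp: "tau (q \<circ> p) = tau q \<circ> tau p"
  by (simp add: tau_def fun_eq_iff)

lemma tau_id [simp]: "tau id = id"
  by (simp add: tau_def fun_eq_iff)

lemma tau_delta [simp]: "tau delta = delta"
  by (simp add: tau_def fun_eq_iff)

lemma inverts_tau:
  assumes "perm p" shows "inverts (tau p) i j \<longleftrightarrow> inverts p (delta i) (delta j)"
proof -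
  have d: "delta x \<in> {1..n} \<longleftrightarrow> x \<in> {1..n}" for x by (rule perm_range[OF perm_delta])
  show ?thesis
    unfolding tau_def inverts_comp inverts_delta comp_apply perm_range[OF assms] d
    by (metis assms d delta_delta inverts_range inverts_same permutes_inj injD)
qed

lemma additive_tau:
  assumes "perm p" "perm q" "additive p q" shows "additive (tau p) (tau q)"
  using assms(3) unfolding additive_def inverts_tau[OF assms(1)] inverts_tau[OF assms(2)]
  by (simp add: tau_def)

section \<open>Left-weighted pairs\<close>

text \<open>The largest prefix of \<open>q\<close> that can be moved into the preceding factor \<open>p\<close>, that is, the meet of \<open>q\<close> with
  the complement of \<open>p\<close>.\<close>

definition slide :: "(nat \<Rightarrow> nat) \<Rightarrow> (nat \<Rightarrow> nat) \<Rightarrow> nat \<Rightarrow> nat" where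
  "slide p q = (SOME u. perm u \<and> u \<preceq> q \<and> additive p u \<and>
     (\<forall>v. perm v \<longrightarrow> v \<preceq> q \<longrightarrow> additive p v \<longrightarrow> v \<preceq> u))"

lemma slide:
  assumes p: "perm p" and q: "perm q"
  shows perm_slide: "perm (slide p q)" and slide_le: "slide p q \<preceq> q"
    and additive_slide: "additive p (slide p q)"
    and slide_greatest: "\<And>v. perm v \<Longrightarrow> v \<preceq> q \<Longrightarrow> additive p v \<Longrightarrow> v \<preceq> slide p q"
proof -
  have c: "perm (delta \<circ> pinv p)" by (intro perm_comp perm_inv perm_delta p)
  obtain m where "perm m" "m \<preceq> q" "m \<preceq> delta \<circ> pinv p"
    "\<And>u. perm u \<Longrightarrow> u \<preceq> q \<Longrightarrow> u \<preceq> delta \<circ> pinv p \<Longrightarrow> u \<preceq> m"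
    by (rule meet_exists[OF q c]) blast
  then have "\<exists>u. perm u \<and> u \<preceq> q \<and> additive p u \<and>
     (\<forall>v. perm v \<longrightarrow> v \<preceq> q \<longrightarrow> additive p v \<longrightarrow> v \<preceq> u)"
    using additive_iff_complement[OF p] by (intro exI[of _ m]) auto
  from someI_ex[OF this] show "perm (slide p q)" "slide p q \<preceq> q" "additive p (slide p q)"
    "\<And>v. perm v \<Longrightarrow> v \<preceq> q \<Longrightarrow> additive p v \<Longrightarrow> v \<preceq> slide p q"
    unfolding slide_def by auto
qed

lemma slide_eqI:
  assumes "perm p" "perm q" "perm u" "u \<preceq> q" "additive p u"
    and "\<And>v. perm v \<Longrightarrow> v \<preceq> q \<Longrightarrow> additive p v \<Longrightarrow> v \<preceq> u"
  shows "slide p q = u"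
  using assms slide[OF assms(1,2)] by (intro weak_le_antisym) auto

lemma slide_additive:
  assumes "perm p" "perm q" "additive p q" shows "slide p q = q"
  using assms by (intro slide_eqI) auto

lemma slide_delta_right:
  assumes "perm p" shows "slide p delta = delta \<circ> pinv p"
proof (rule slide_eqI[OF assms perm_delta])
  show c: "perm (delta \<circ> pinv p)" by (intro perm_comp perm_inv perm_delta assms)
  then show "delta \<circ> pinv p \<preceq> delta" by (rule weak_le_delta)
  show "additive p (delta \<circ> pinv p)" using additive_iff_complement[OF assms c] by simp
  show "v \<preceq> delta \<circ> pinv p" if "perm v" "additive p v" for v
    using that additive_iff_complement[OF assms] by simp
qed

lemma slide_delta_left:
  assumes "perm q" shows "slide delta q = id"
proof (rule slide_eqI[OF perm_delta assms])
  show "v \<preceq> id" if "perm v" "additive delta v" for v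
    using that additive_iff_complement[OF perm_delta that(1)] by (simp add: fun_eq_iff comp_def id_def)
qed auto

definition weighted :: "(nat \<Rightarrow> nat) \<Rightarrow> (nat \<Rightarrow> nat) \<Rightarrow> bool" where
  "weighted p q \<longleftrightarrow> (\<forall>j \<in> {1..<n}. inverts q j (Suc j) \<longrightarrow> inverts (pinv p) j (Suc j))"

text \<open>If something can be moved from \<open>q\<close> to \<open>p\<close>, then so can a single crossing of neighbouring strands,
  because a permutation other than the identity has a descent.\<close>

lemma weighted_iff_slide:
  assumes p: "perm p" and q: "perm q"
  shows "weighted p q \<longleftrightarrow> slide p q = id"
proof
  note s = slide[OF p q]
  assume w: "weighted p q"
  show "slide p q = id"
  proof (rule ccontr)
    assume "slide p q \<noteq> id"
    then obtain j where j: "j \<in> {1..<n}" "inverts (slide p q) j (Suc j)"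
      using s(1) perm_descent by blast
    then have "inverts p (pinv p j) (pinv p (Suc j))"
      using w s(2) by (auto simp: weighted_def weak_le_def inverts_inv[OF perm_bij[OF p]])
    then have "\<not> inverts (slide p q) (p (pinv p j)) (p (pinv p (Suc j)))"
      using s(3) unfolding additive_def by blast
    with j(2) show False by (simp only: permutes_inverses[OF p]) simp
  qed
next
  assume id: "slide p q = id"
  show "weighted p q"
    unfolding weighted_def
  proof (intro ballI impI)
    fix j assume j: "j \<in> {1..<n}" "inverts q j (Suc j)"
    let ?s = "transpose j (Suc j)"
    show "inverts (pinv p) j (Suc j)"
    proof (rule ccontr)
      assume not: "\<not> inverts (pinv p) j (Suc j)"
      have "?s \<preceq> q"
        using j(2) inverts_commute[OF permutes_inj[OF q]]
        by (auto simp: weak_le_def inverts_transpose doubleton_eq_iff)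
      moreover have "additive p ?s"
      proof -
        have "\<not> inverts p a b" if "p a = j \<and> p b = Suc j" for a b
          using not that permutes_inverses[OF p] by (metis inverts_inv perm_bij p)
        then show ?thesis
          using inverts_commute[OF permutes_inj[OF p]]
          by (auto simp: additive_def inverts_transpose doubleton_eq_iff)
      qed
      ultimately have "?s \<preceq> id"
        using slide_greatest[OF p q perm_transpose[OF j(1)]] id by simp
      then show False by (auto simp: weak_le_def inverts_transpose)
    qed
  qed
qed

lemma weightedD:
  assumes "weighted p q" "perm p" "perm q" "perm u" "u \<preceq> q" "additive p u"
  shows "u = id"
  using slide_greatest[OF assms(2-6)] weak_le_id assms weighted_iff_slide by auto

lemma weightedI:
  assumes "perm p" "perm q" "\<And>u. perm u \<Longrightarrow> u \<preceq> q \<Longrightarrow> additive p u \<Longrightarrow> u = id"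
  shows "weighted p q"
  using assms slide by (auto simp: weighted_iff_slide)

lemma weighted_tau:
  assumes p: "perm p" and q: "perm q" and w: "weighted p q" shows "weighted (tau p) (tau q)"
proof (rule weightedI[OF perm_tau[OF p] perm_tau[OF q]])
  fix u assume u: "perm u" "u \<preceq> tau q" "additive (tau p) u"
  have "additive p (tau u)" using additive_tau[OF perm_tau[OF p] u(1) u(3)] by simp
  moreover have "tau u \<preceq> q"
    using u(2) unfolding weak_le_def inverts_tau[OF u(1)] inverts_tau[OF q] by (metis delta_delta)
  ultimately have "tau u = id" using weightedD[OF w p q perm_tau[OF u(1)]] by blast
  then show "u = id" by (metis tau_tau tau_id)
qed

lemma weighted_delta:
  assumes p: "perm p" and w: "weighted p delta" shows "p = delta"
proof -
  have "delta \<circ> pinv p = id"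
    using w weighted_iff_slide[OF p perm_delta] slide_delta_right[OF p] by simp
  then have "delta \<circ> pinv p \<circ> p = p" by simp
  then show ?thesis by (simp add: o_assoc[symmetric] permutes_inv_o[OF p])
qed

section \<open>Left multiplication of left-weighted lists\<close>

text \<open>Left multiplication of a left-weighted product by \<open>p\<close>: every factor gives its largest movable prefix
  to its left neighbour, and its remainder is multiplied to the rest of the list. A trivial
  remainder leaves the list as it is and is dropped at its end.\<close>

fun push :: "(nat \<Rightarrow> nat) \<Rightarrow> (nat \<Rightarrow> nat) list \<Rightarrow> (nat \<Rightarrow> nat) list" where
  "push p [] = (if p = id then [] else [p])"
| "push p (q # qs) = (slide p q \<circ> p) # push (q \<circ> pinv (slide p q)) qs"

lemma push_id: "\<forall>q\<in>set qs. perm q \<Longrightarrow> push id qs = qs"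
  by (induction qs) (auto simp: slide_additive permutes_inv_o)

text \<open>What \<open>p2\<close> takes from the first factor \<open>q\<close>, and \<open>p1\<close> then takes from the result, is what \<open>p2 \<circ> p1\<close> takes
  from \<open>q\<close> directly; the two remainders that are passed on multiply, with additive lengths, to the single
  remainder. Since both sides of a braid relation are factorizations of one permutation with additive
  lengths, this is why left multiplication respects the braid relations.\<close>

lemma push_additive:
  assumes "\<forall>q\<in>set qs. perm q" "perm p1" "perm p2" "additive p1 p2"
  shows "push (p2 \<circ> p1) qs = push p1 (push p2 qs)"
  using assms
proof (induction qs arbitrary: p1 p2)
  case Nil
  then show ?case
    using additive_eq_id[OF Nil(2,3,4)]
    by (cases "p2 = id"; cases "p2 \<circ> p1 = id") (simp_all add: slide_additive permutes_inv_o, simp_all add: comp_def id_def)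
next
  case (Cons q qs)
  then have q: "perm q" and p1: "perm p1" and p2: "perm p2" and add: "additive p1 p2" by auto
  have p12: "perm (p2 \<circ> p1)" by (intro perm_comp p1 p2)
  define u2 where "u2 = slide p2 q"
  define u where "u = slide (p2 \<circ> p1) q"
  define m where "m = slide p1 (u2 \<circ> p2)"
  note u2 = slide[OF p2 q, folded u2_def]
  note u = slide[OF p12 q, folded u_def]
  have h2: "perm (u2 \<circ> p2)" by (intro perm_comp p2 u2)
  note m = slide[OF p1 h2, folded m_def]
  have pu: "additive p2 u" "additive p1 (u \<circ> p2)"
    using additive_assoc[OF perm_bij[OF p1], of p2 u] add u(3) by auto
  have u_u2: "u \<preceq> u2" using u2(4)[OF u(1,2) pu(1)] .
  \<comment> \<open>The largest prefix that \<open>p1\<close> takes from \<open>u2 \<circ> p2\<close> contains \<open>p2\<close>, so it is \<open>p2\<close> followed by a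
    prefix of \<open>q\<close> that \<open>p2 \<circ> p1\<close> can take.\<close>
  have m_eq: "m = u \<circ> p2"
  proof (rule weak_le_antisym[OF m(1)])
    show "perm (u \<circ> p2)" by (intro perm_comp p2 u)
    then show "u \<circ> p2 \<preceq> m"
      using m(4) pu(2) weak_le_cancel[OF perm_bij[OF p2] pu(1) u2(3)] u_u2 by blast
    have "p2 \<preceq> m" using m(4)[OF p2 _ add] u2(3) by (simp add: additive_iff_weak_le)
    define v where "v = m \<circ> pinv p2"
    have v: "perm v" unfolding v_def by (intro perm_comp perm_inv p2 m)
    have p2v: "additive p2 v" and mv: "v \<circ> p2 = m"
      using additive_quotient[OF perm_bij[OF p2] \<open>p2 \<preceq> m\<close>] by (auto simp: v_def)
    have "v \<preceq> u2" using weak_le_cancel[OF perm_bij[OF p2] p2v u2(3)] m(2) mv by simp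
    moreover have "additive (p2 \<circ> p1) v"
      using additive_assoc[OF perm_bij[OF p1], of p2 v] p2v m(3) mv by simp
    ultimately have "v \<preceq> u" using u(4)[OF v] u2(2) weak_le_trans by blast
    then show "m \<preceq> u \<circ> p2" using weak_le_cancel[OF perm_bij[OF p2] p2v pu(1)] mv by simp
  qed
  define r1 where "r1 = u2 \<circ> pinv u"
  define r2 where "r2 = q \<circ> pinv u2"
  have r: "perm r1" "perm r2" unfolding r1_def r2_def by (intro perm_comp perm_inv u u2 q)+
  have r12: "r2 \<circ> r1 = q \<circ> pinv u"
    by (simp add: r1_def r2_def fun_eq_iff permutes_inverses[OF u2(1)])
  have "additive u r1 \<and> additive (r1 \<circ> u) r2"
    using additive_quotient[OF perm_bij[OF u(1)] u_u2] additive_quotient[OF perm_bij[OF u2(1)] u2(2)]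
    by (simp add: r1_def r2_def)
  then have "additive r1 r2" using additive_assoc[OF perm_bij[OF u(1)]] by blast
  then have IH: "push (r2 \<circ> r1) qs = push r1 (push r2 qs)"
    using Cons.prems(1) r by (intro Cons.IH) auto
  have r1_eq: "u2 \<circ> p2 \<circ> pinv (u \<circ> p2) = r1"
    by (simp add: r1_def o_inv_distrib perm_bij[OF u(1)] perm_bij[OF p2] fun_eq_iff permutes_inverses[OF p2])
  have "push (p2 \<circ> p1) (q # qs) = (u \<circ> (p2 \<circ> p1)) # push (q \<circ> pinv u) qs"
    by (simp only: push.simps u_def)
  also have "\<dots> = (m \<circ> p1) # push (u2 \<circ> p2 \<circ> pinv m) (push r2 qs)"
    by (simp only: m_eq r1_eq IH[symmetric] r12 o_assoc)
  also have "\<dots> = push p1 (push p2 (q # qs))"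
    by (simp only: push.simps u2_def r2_def m_def)
  finally show ?case .
qed

definition normal :: "(nat \<Rightarrow> nat) list \<Rightarrow> bool" where
  "normal ps \<longleftrightarrow> (\<forall>p\<in>set ps. perm p \<and> p \<noteq> id) \<and> successively weighted ps"

lemma normal_Nil [simp]: "normal []"
  by (simp add: normal_def)

lemma normal_Cons: "normal (p # ps) \<longleftrightarrow>
    perm p \<and> p \<noteq> id \<and> normal ps \<and> (ps \<noteq> [] \<longrightarrow> weighted p (hd ps))"
  by (cases ps) (auto simp: normal_def)

lemma normal_perm: "normal ps \<Longrightarrow> \<forall>p\<in>set ps. perm p"
  by (simp add: normal_def)

text \<open>Whatever could still be moved from the remainder would have been part of the largest movable prefix.\<close>

lemma weighted_slide:
  assumes p: "perm p" and q: "perm q"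
  defines "u \<equiv> slide p q"
  shows "weighted (u \<circ> p) (q \<circ> pinv u)"
proof -
  note u = slide[OF p q, folded u_def]
  note uq = additive_quotient[OF perm_bij[OF u(1)] u(2)]
  show ?thesis
  proof (rule weightedI)
    show "perm (u \<circ> p)" "perm (q \<circ> pinv u)" by (intro perm_comp perm_inv u p q)+
    fix v assume v: "perm v" "v \<preceq> q \<circ> pinv u" "additive (u \<circ> p) v"
    have uv: "additive u v" "additive p (v \<circ> u)"
      using additive_assoc[OF perm_bij[OF p], of u v] u(3) v(3) by auto
    have "v \<circ> u \<preceq> q" using weak_le_cancel[OF perm_bij[OF u(1)] uv(1) uq(1)] v(2) uq(2) by simp
    then have "v \<circ> u \<preceq> id \<circ> u" using u(4)[OF perm_comp[OF u(1) v(1)]] uv(2) by simp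
    then have "v \<preceq> id" using weak_le_cancel[OF perm_bij[OF u(1)] uv(1) additive_id(2)] by blast
    then show "v = id" using weak_le_id v(1) by simp
  qed
qed

text \<open>The next factor after the push is \<open>u' \<circ> r\<close>, with \<open>u'\<close> taken from \<open>q2\<close>. If a part of it could be moved
  to the left, then so could its join with \<open>r\<close>, say \<open>r\<close> followed by \<open>y\<close>. As \<open>u\<close> followed by \<open>r\<close> is \<open>q\<close>,
  the part \<open>y\<close> of \<open>q2\<close> could be moved into \<open>q\<close>, so \<open>y\<close> is trivial and the part was already movable from
  \<open>r\<close>.\<close>

lemma weighted_slide_slide:
  assumes p: "perm p" and q: "perm q" and q2: "perm q2" and w: "weighted q q2"
  defines "u \<equiv> slide p q"
  defines "r \<equiv> q \<circ> pinv u"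
  shows "weighted (u \<circ> p) (slide r q2 \<circ> r)"
proof -
  note u = slide[OF p q, folded u_def]
  have ur: "additive u r" "r \<circ> u = q"
    using additive_quotient[OF perm_bij[OF u(1)] u(2)] by (auto simp: r_def)
  have r: "perm r" unfolding r_def by (intro perm_comp perm_inv u q)
  define u' where "u' = slide r q2"
  note u' = slide[OF r q2, folded u'_def]
  have h': "perm (u' \<circ> r)" by (intro perm_comp u' r)
  have "weighted (u \<circ> p) (u' \<circ> r)"
  proof (rule weightedI)
    show up: "perm (u \<circ> p)" by (intro perm_comp u p)
    show "perm (u' \<circ> r)" by fact
    fix v assume v: "perm v" "v \<preceq> u' \<circ> r" "additive (u \<circ> p) v"
    have uv: "additive u v" using additive_assoc[OF perm_bij[OF p], of u v] u(3) v(3) by auto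
    define m where "m = slide u (u' \<circ> r)"
    note m = slide[OF u(1) h', folded m_def]
    have "r \<preceq> m" using m(4)[OF r _ ur(1)] u'(3) by (simp add: additive_iff_weak_le)
    define y where "y = m \<circ> pinv r"
    have y: "perm y" unfolding y_def by (intro perm_comp perm_inv m r)
    have ry: "additive r y" "y \<circ> r = m"
      using additive_quotient[OF perm_bij[OF r] \<open>r \<preceq> m\<close>] by (auto simp: y_def)
    have "y \<preceq> u'" using weak_le_cancel[OF perm_bij[OF r] ry(1) u'(3)] m(2) ry(2) by simp
    then have "y \<preceq> q2" using u'(2) weak_le_trans by blast
    moreover have "additive q y"
      using additive_assoc[OF perm_bij[OF u(1)], of r y] ry m(3) ur by simp
    ultimately have "y = id" using weightedD[OF w q q2 y] by blast
    then have "v \<preceq> r" using m(4)[OF v(1,2) uv] ry(2) by simp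
    then show "v = id"
      using weightedD[OF weighted_slide[OF p q, folded u_def r_def] up r v(1) _ v(3)] by blast
  qed
  then show ?thesis by (simp add: u'_def)
qed

lemma normal_push:
  assumes "perm p" "normal qs" shows "normal (push p qs)"
  using assms
proof (induction qs arbitrary: p)
  case Nil
  then show ?case by (simp add: normal_Cons)
next
  case (Cons q qs)
  then have q: "perm q" "q \<noteq> id" and qs: "normal qs" and p: "perm p" by (auto simp: normal_Cons)
  define u where "u = slide p q"
  define r where "r = q \<circ> pinv u"
  note u = slide[OF p q(1), folded u_def]
  have r: "perm r" unfolding r_def by (intro perm_comp perm_inv u q)
  have "u \<circ> p \<noteq> id"
  proof
    assume "u \<circ> p = id"
    from additive_eq_id[OF p u(1) u(3) this] have "p = id" "u = id" .
    then show False using u_def slide_additive[OF _ q(1), of id] q(2) by simp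
  qed
  moreover have "push r qs \<noteq> [] \<longrightarrow> weighted (u \<circ> p) (hd (push r qs))"
  proof (cases qs)
    case Nil
    then show ?thesis using weighted_slide[OF p q(1), folded u_def r_def] by simp
  next
    case (Cons q2 qs2)
    then have "perm q2" "weighted q q2" using Cons.prems(2) by (auto simp: normal_Cons)
    then show ?thesis
      using weighted_slide_slide[OF p q(1), of q2, folded u_def, folded r_def] Cons by simp
  qed
  ultimately show ?case
    using Cons.IH[OF r qs] perm_comp[OF p u(1)]
    by (simp add: normal_Cons u_def[symmetric] r_def[symmetric])
qed

lemma push_normal: "normal (q # qs) \<Longrightarrow> push q qs = q # qs"
proof (induction qs arbitrary: q)
  case Nil
  then show ?case by (simp add: normal_Cons)
next
  case (Cons q2 qs)
  then have "slide q q2 = id" using weighted_iff_slide by (auto simp: normal_Cons)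
  then show ?case using Cons by (simp add: normal_Cons)
qed

text \<open>In front of the Garside element, \<open>p\<close> takes its own complement and becomes the Garside element; what
  remains is \<open>p\<close>, conjugated.\<close>

lemma push_before_delta:
  assumes "perm p" shows "push p (delta # qs) = delta # push (tau p) qs"
proof -
  have eq: "slide p delta \<circ> p = delta"
    using slide_delta_right[OF assms] by (simp add: fun_eq_iff permutes_inverses[OF assms])
  have "pinv (delta \<circ> pinv p) = p \<circ> delta"
    by (rule inv_unique_comp) (simp_all add: fun_eq_iff permutes_inverses[OF assms])
  then have "delta \<circ> pinv (slide p delta) = tau p"
    using slide_delta_right[OF assms] by (simp add: tau_def o_assoc)
  with eq show ?thesis by simp
qed

lemma push_delta:
  assumes "normal qs" "2 \<le> n" shows "push delta qs = delta # qs"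
proof (cases qs)
  case Nil
  have "delta 1 \<noteq> id 1" using assms(2) by (simp add: delta_def)
  then have "delta \<noteq> id" by metis
  then show ?thesis by (simp add: Nil)
next
  case (Cons q qs')
  then show ?thesis using assms slide_delta_left push_normal by (simp add: normal_Cons)
qed

section \<open>Left multiplication of normal forms\<close>

text \<open>A pair \<open>(k, ps)\<close> stands for the \<open>k\<close>-th power of the Garside element followed by the factors \<open>ps\<close>; leading
  Garside elements are counted in \<open>k\<close>.\<close>

fun strip :: "int \<Rightarrow> (nat \<Rightarrow> nat) list \<Rightarrow> int \<times> (nat \<Rightarrow> nat) list" where
  "strip k [] = (k, [])"
| "strip k (p # ps) = (if p = delta then strip (k + 1) ps else (k, p # ps))"

text \<open>Moving a factor past the \<open>k\<close>-th power of the Garside element applies \<open>tau\<close>, an involution, \<open>k\<close> times.\<close>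

definition twist :: "int \<Rightarrow> (nat \<Rightarrow> nat) \<Rightarrow> nat \<Rightarrow> nat" where
  "twist k p = (if even k then p else tau p)"

lemma perm_twist: "perm p \<Longrightarrow> perm (twist k p)"
  by (simp add: twist_def perm_tau)

lemma twist_delta [simp]: "twist k delta = delta"
  by (simp add: twist_def)

lemma twist_comp: "twist k (q \<circ> p) = twist k q \<circ> twist k p"
  by (simp add: twist_def tau_comp)

lemma additive_twist: "perm p \<Longrightarrow> perm q \<Longrightarrow> additive p q \<Longrightarrow> additive (twist k p) (twist k q)"
  by (simp add: twist_def additive_tau)

definition act :: "(nat \<Rightarrow> nat) \<Rightarrow> int \<times> (nat \<Rightarrow> nat) list \<Rightarrow> int \<times> (nat \<Rightarrow> nat) list" where
  "act p x = (case x of (k, ps) \<Rightarrow> strip k (push (twist k p) ps))"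

definition states :: "(int \<times> (nat \<Rightarrow> nat) list) set" where
  "states = {(k, ps). normal ps \<and> delta \<notin> set ps}"

text \<open>In a left-weighted list all Garside elements come first, since nothing else can precede one
  (\<open>weighted_delta\<close>).\<close>

lemma strip_state: "normal ps \<Longrightarrow> strip k ps \<in> states"
proof (induction ps arbitrary: k)
  case (Cons p ps)
  have "p = delta" if "delta \<in> set (p # ps)"
    using Cons.prems that
  proof (induction ps arbitrary: p)
    case (Cons q ps)
    then show ?case using weighted_delta by (auto simp: normal_Cons)
  qed simp
  then show ?case using Cons by (auto simp: states_def normal_Cons)
qed (simp add: states_def)

lemma state_normal: "(k, ps) \<in> states \<Longrightarrow> normal ps"
  by (simp add: states_def)

lemma act_state: "perm p \<Longrightarrow> x \<in> states \<Longrightarrow> act p x \<in> states"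
  by (cases x) (simp add: act_def strip_state normal_push perm_twist state_normal)

lemma strip_push:
  assumes "perm p" shows "strip k (push (twist k p) ps) = act p (strip k ps)"
proof (induction ps arbitrary: k)
  case (Cons q qs)
  have "tau (twist k p) = twist (k + 1) p" by (simp add: twist_def)
  then show ?case
    using Cons push_before_delta[OF perm_twist[OF assms], of k qs] by (auto simp: act_def simp del: push.simps(2))
qed (simp add: act_def)

lemma act_additive:
  assumes p: "perm p" and q: "perm q" and add: "additive p q" and x: "x \<in> states"
  shows "act (q \<circ> p) x = act p (act q x)"
proof -
  obtain k ps where x_eq: "x = (k, ps)" and "normal ps" using x by (auto simp: states_def)
  then have "push (twist k (q \<circ> p)) ps = push (twist k p) (push (twist k q) ps)"
    using push_additive[OF normal_perm perm_twist[OF p] perm_twist[OF q] additive_twist[OF p q add]]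
    by (simp add: twist_comp)
  then show ?thesis using strip_push[OF p] by (simp add: x_eq act_def[of "q \<circ> p"] act_def[of q])
qed

lemma strip_shift: "strip (k + d) ps = apfst (\<lambda>k. k + d) (strip k ps)"
proof (induction ps arbitrary: k)
  case (Cons p ps)
  then show ?case using Cons[of "k + 1"] by (simp add: algebra_simps)
qed simp

lemma strip_no_delta: "delta \<notin> set ps \<Longrightarrow> strip k ps = (k, ps)"
  by (cases ps) auto

lemma act_delta: "(k, ps) \<in> states \<Longrightarrow> 2 \<le> n \<Longrightarrow> act delta (k, ps) = (k + 1, ps)"
  by (simp add: act_def states_def push_delta strip_no_delta)

lemma act_id: "(k, ps) \<in> states \<Longrightarrow> act id (k, ps) = (k, ps)"
  using push_id[OF normal_perm] by (simp add: act_def states_def twist_def strip_no_delta)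

lemma act_normal_Cons: "(0, p # ps) \<in> states \<Longrightarrow> act p (0, ps) = (0, p # ps)"
  by (auto simp: act_def states_def twist_def push_normal)

lemma act_shift: "act p (k - 1, ps) = apfst (\<lambda>k. k - 1) (act (tau p) (k, ps))"
proof -
  have "twist (k - 1) p = twist k (tau p)" by (simp add: twist_def)
  then show ?thesis using strip_shift[of k "-1"] by (simp add: act_def)
qed

end

section \<open>Simple words and permutations\<close>

lemma strand_end_Nil: "strand_end [] = id"
  by (simp add: fun_eq_iff)

lemma strand_end_Cons: "strand_end ((i, e) # w) = strand_end w \<circ> transpose i (Suc i)"
  by (simp add: fun_eq_iff)

lemma strand_end_append_comp: "strand_end (u @ v) = strand_end v \<circ> strand_end u"
  by (simp add: fun_eq_iff strand_end_append)

lemma bij_strand_end: "bij (strand_end w)"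
proof (induction w)
  case (Cons x w)
  then show ?case by (cases x) (metis strand_end_Cons bij_comp bij_transpose)
qed (simp only: strand_end_Nil bij_id)

lemma crossings_append:
  "crossings (u @ v) s t = crossings u s t + crossings v (strand_end u s) (strand_end u t)"
  by (induction u arbitrary: s t) auto

text \<open>Each crossing of two strands exchanges their order.\<close>

lemma odd_crossings_iff: "odd (crossings w s t) \<longleftrightarrow> inverts (strand_end w) s t"
proof (induction w arbitrary: s t)
  case (Cons x w)
  obtain i e where x: "x = (i, e)" by (cases x)
  show ?case
    by (simp only: x strand_end_Cons inverts_comp inverts_transpose) (use Cons in auto)
qed (simp add: strand_end_Nil)

lemma crossings_simple_word:
  assumes "simple_word w"
  shows "crossings w s t = (if inverts (strand_end w) s t then 1 else 0)"
proof -
  have "crossings w s t \<le> 1" using assms by (auto simp: simple_word_def)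
  then show ?thesis using odd_crossings_iff[of w s t] by (cases "crossings w s t") auto
qed

lemma simple_word_append:
  "simple_word (u @ v) \<longleftrightarrow> simple_word u \<and> simple_word v \<and> additive (strand_end u) (strand_end v)"
proof
  assume uv: "simple_word (u @ v)"
  then have le: "crossings u s t + crossings v (strand_end u s) (strand_end u t) \<le> 1" for s t
    by (simp add: simple_word_def flip: crossings_append)
  have "crossings u s t \<le> 1" for s t using le[of s t] by simp
  moreover have "crossings v s t \<le> 1" for s t
  proof -
    obtain s' t' where "s = strand_end u s'" "t = strand_end u t'"
      using bij_strand_end by (metis bij_pointE)
    then show ?thesis using le[of s' t'] by simp
  qed
  moreover have "additive (strand_end u) (strand_end v)"
    unfolding additive_def odd_crossings_iff[symmetric]
  proof (intro allI notI)
    fix i j assume "odd (crossings u i j) \<and> odd (crossings v (strand_end u i) (strand_end u j))"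
    then show False using le[of i j] by (auto elim!: oddE)
  qed
  ultimately show "simple_word u \<and> simple_word v \<and> additive (strand_end u) (strand_end v)"
    using uv by (auto simp: simple_word_def)
next
  assume uv: "simple_word u \<and> simple_word v \<and> additive (strand_end u) (strand_end v)"
  then have "crossings (u @ v) s t \<le> 1" for s t
    by (auto simp: crossings_append crossings_simple_word additive_def)
  with uv show "simple_word (u @ v)" by (auto simp: simple_word_def)
qed

lemma simple_word_letter [simp]: "simple_word [(i, True)]"
  by (auto simp: simple_word_def)

lemma simple_word_Nil [simp]: "simple_word []"
  by (simp add: simple_word_def)

lemma strand_end_letter: "strand_end [(i, e)] = transpose i (Suc i)"
  by (simp add: fun_eq_iff)

lemma simple_word_Cons:
  "simple_word ((i, e) # w) \<longleftrightarrow> e \<and> simple_word w \<and> additive (transpose i (Suc i)) (strand_end w)"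
proof (cases e)
  case True
  then show ?thesis using simple_word_append[of "[(i, True)]" w] by (simp add: strand_end_letter)
qed (simp add: simple_word_def)

context
  fixes n :: nat
begin

lemma braid_words_simps [simp]:
  "[] \<in> braid_words n"
  "(i, e) # w \<in> braid_words n \<longleftrightarrow> i \<in> {1..<n} \<and> w \<in> braid_words n"
  "u @ v \<in> braid_words n \<longleftrightarrow> u \<in> braid_words n \<and> v \<in> braid_words n"
  by (auto simp: braid_words_def)

lemma perm_strand_end: "w \<in> braid_words n \<Longrightarrow> perm n (strand_end w)"
proof (induction w)
  case (Cons x w)
  then show ?case
    by (cases x) (simp only: strand_end_Cons braid_words_simps perm_comp perm_transpose)
qed (simp add: strand_end_Nil)

definition inversions :: "(nat \<Rightarrow> nat) \<Rightarrow> nat" where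
  "inversions p = card {(i, j). inverts p i j}"

lemma inversions_comp:
  assumes p: "perm n p" and q: "perm n q" and add: "additive p q"
  shows "inversions (q \<circ> p) = inversions p + inversions q"
proof -
  have fin: "finite {(i, j). inverts r i j}" if "perm n r" for r
    by (rule finite_subset[of _ "{1..n} \<times> {1..n}"]) (use inverts_range[OF that] in auto)
  have inj: "inj (map_prod p p)" using permutes_inj[OF p] by (rule prod.inj_map) (rule permutes_inj[OF p])
  have surj: "surj (map_prod p p)" using permutes_surj[OF p] by (rule map_prod_surj) (rule permutes_surj[OF p])
  have "{(i, j). inverts (q \<circ> p) i j} = {(i, j). inverts p i j} \<union> map_prod p p -` {(i, j). inverts q i j}"
    "{(i, j). inverts p i j} \<inter> map_prod p p -` {(i, j). inverts q i j} = {}"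
    using add by (auto simp: inverts_comp additive_def)
  then have "inversions (q \<circ> p) = inversions p + card (map_prod p p -` {(i, j). inverts q i j})"
    unfolding inversions_def using fin[OF p] finite_vimageI[OF fin[OF q] inj] by (simp add: card_Un_disjoint)
  also have "card (map_prod p p -` {(i, j). inverts q i j}) = inversions q"
    unfolding inversions_def by (rule card_vimage_inj[OF inj]) (simp add: surj)
  finally show ?thesis .
qed

lemma inversions_transpose_pos: "i \<in> {1..<n} \<Longrightarrow> 0 < inversions (transpose i (Suc i))"
proof -
  have "{(a, b). {a, b} = {i, Suc i}} = {(i, Suc i), (Suc i, i)}" by (auto simp: doubleton_eq_iff)
  then show ?thesis by (simp add: inversions_def inverts_transpose)
qed

lemma transpose_weak_le:
  assumes "perm n p" "inverts p j (Suc j)" shows "transpose j (Suc j) \<preceq> p"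
  using assms(2) inverts_commute[OF permutes_inj[OF assms(1)]]
  by (auto simp: weak_le_def inverts_transpose doubleton_eq_iff)

lemma simple_word_exists:
  assumes "perm n p" shows "\<exists>w \<in> braid_words n. simple_word w \<and> strand_end w = p"
  using assms
proof (induction "inversions p" arbitrary: p rule: less_induct)
  case less
  show ?case
  proof (cases "p = id")
    case True
    then show ?thesis by (intro bexI[of _ "[]"]) (auto simp: strand_end_Nil)
  next
    case False
    then obtain j where j: "j \<in> {1..<n}" "inverts p j (Suc j)"
      using perm_descent less.prems by blast
    let ?s = "transpose j (Suc j)"
    have s: "perm n ?s" using perm_transpose j by blast
    define q where "q = p \<circ> pinv ?s"
    have q: "perm n q" unfolding q_def by (intro perm_comp perm_inv s less.prems)
    have sq: "additive ?s q" "q \<circ> ?s = p"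
      using additive_quotient[OF perm_bij[OF s] transpose_weak_le[OF less.prems j(2)]] by (simp_all add: q_def)
    then have "inversions q < inversions p"
      using inversions_comp[OF s q] inversions_transpose_pos[OF j(1)] by simp
    then obtain w where "w \<in> braid_words n" "simple_word w" "strand_end w = q"
      using less.hyps q by blast
    then show ?thesis
      using j sq by (intro bexI[of _ "(j, True) # w"]) (auto simp: simple_word_Cons strand_end_Cons simp del: strand_end.simps)
  qed
qed

text \<open>The two sides of the braid relation between the generators \<open>i\<close> and \<open>j\<close> are simple words for the
  permutation with just the inversions that are forced by those at \<open>i\<close> and at \<open>j\<close>, the join of the two
  transpositions.\<close>

lemma common_simple_prefix:
  assumes i: "i \<in> {1..<n}" and j: "j \<in> {1..<n}" and "i < j" and p: "perm n p"
    and pi: "inverts p i (Suc i)" and pj: "inverts p j (Suc j)"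
  obtains u v where "((i, True) # u, (j, True) # v) \<in> braid_cong n"
    "simple_word ((i, True) # u)" "simple_word ((j, True) # v)" "strand_end ((i, True) # u) \<preceq> p"
proof (cases "j = Suc i")
  case False
  then have ij: "i + 2 \<le> j" using \<open>i < j\<close> by simp
  show ?thesis
  proof (rule that[of "[(j, True)]" "[(i, True)]"])
    show "([(i, True), (j, True)], [(j, True), (i, True)]) \<in> braid_cong n"
      using i j ij by (rule braid_cong.far)
    show "simple_word [(i, True), (j, True)]" "simple_word [(j, True), (i, True)]"
      using ij by (auto simp: simple_word_def doubleton_eq_iff transpose_def)
    have "a = i \<and> b = Suc i \<or> b = i \<and> a = Suc i \<or> a = j \<and> b = Suc j \<or> b = j \<and> a = Suc j"
      if "inverts (strand_end [(i, True), (j, True)]) a b" for a b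
      using that ij by (auto simp: inverts_def transpose_def split: if_splits)
    then show "strand_end [(i, True), (j, True)] \<preceq> p"
      using pi pj inverts_commute[OF permutes_inj[OF p]] unfolding weak_le_def by metis
  qed
next
  case True
  show ?thesis
  proof (rule that[of "[(j, True), (i, True)]" "[(i, True), (j, True)]"])
    show "([(i, True), (j, True), (i, True)], [(j, True), (i, True), (j, True)]) \<in> braid_cong n"
      using i j braid_cong.near unfolding True by blast
    show "simple_word [(i, True), (j, True), (i, True)]" "simple_word [(j, True), (i, True), (j, True)]"
      by (auto simp: True simple_word_def doubleton_eq_iff transpose_def)
    have "inverts p i (Suc j)" using pi pj by (auto simp: True inverts_def)
    moreover have "a \<in> {i, j, Suc j} \<and> b \<in> {i, j, Suc j} \<and> a \<noteq> b"
      if "inverts (strand_end [(i, True), (j, True), (i, True)]) a b" for a b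
      using that by (auto simp: True inverts_def transpose_def split: if_splits)
    ultimately show "strand_end [(i, True), (j, True), (i, True)] \<preceq> p"
      using pi pj inverts_commute[OF permutes_inj[OF p]] unfolding weak_le_def True
      by (metis insertE singletonD)
  qed
qed

text \<open>Matsumoto's theorem for the symmetric group. If the words start with different letters \<open>i\<close> and \<open>j\<close>, the
  permutation has a simple word that starts with the braid relation between \<open>i\<close> and \<open>j\<close>. Read with one of
  its sides this word shares its first letter with one of the given words, and read with the other side it
  shares it with the other, so that induction applies after removing the first letter.\<close>

lemma simple_words_cong:
  assumes "w \<in> braid_words n" "v \<in> braid_words n" "simple_word w" "simple_word v"
    and "strand_end w = strand_end v"
  shows "(w, v) \<in> braid_cong n"
  using assms
proof (induction "inversions (strand_end w)" arbitrary: w v rule: less_induct)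
  case less
  define p where "p = strand_end w"
  have p: "perm n p" unfolding p_def by (rule perm_strand_end) fact
  have head: "inverts (strand_end ((i, e) # x)) i (Suc i)" if "simple_word ((i, e) # x)" for i e x
    using crossings_simple_word[OF that, of i "Suc i"] by (auto split: if_splits)
  have empty: "x = []" if "simple_word x" "strand_end x = id" for x
    using that head by (cases x) force+
  have IH: "((i, True) # x, (i, True) # y) \<in> braid_cong n"
    if "(i, True) # x \<in> braid_words n" "(i, True) # y \<in> braid_words n"
      "simple_word ((i, True) # x)" "simple_word ((i, True) # y)"
      "strand_end ((i, True) # x) = p" "strand_end ((i, True) # y) = p" for i x y
  proof -
    let ?s = "transpose i (Suc i)"
    have i: "i \<in> {1..<n}" and xy: "x \<in> braid_words n" "y \<in> braid_words n" using that(1,2) by auto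
    have add: "simple_word x" "simple_word y" "additive ?s (strand_end x)"
      using that(3,4) by (auto simp: simple_word_Cons)
    have px: "strand_end x \<circ> ?s = p" and py: "strand_end y \<circ> ?s = p"
      using that(5,6) by (simp_all only: strand_end_Cons)
    have "strand_end x = strand_end x \<circ> ?s \<circ> ?s" by (simp add: fun_eq_iff)
    also have "\<dots> = strand_end y \<circ> ?s \<circ> ?s" by (simp only: px py)
    also have "\<dots> = strand_end y" by (simp add: fun_eq_iff)
    finally have "strand_end x = strand_end y" .
    moreover have "inversions (strand_end x) < inversions (strand_end w)"
      using inversions_comp[OF perm_transpose[OF i] perm_strand_end[OF xy(1)] add(3)]
        inversions_transpose_pos[OF i] px unfolding p_def[symmetric] by simp
    ultimately have "(x, y) \<in> braid_cong n" using less.hyps xy add by blast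
    then show ?thesis
      using braid_cong.append[OF braid_cong.refl[of "[(i, True)]"]] i by fastforce
  qed
  have mixed: "((i, True) # x, (j, True) # y) \<in> braid_cong n"
    if "i < j" and bw: "(i, True) # x \<in> braid_words n" "(j, True) # y \<in> braid_words n"
      and sw: "simple_word ((i, True) # x)" "simple_word ((j, True) # y)"
      and px: "strand_end ((i, True) # x) = p" and py: "strand_end ((j, True) # y) = p" for i j x y
  proof -
    have ij: "inverts p i (Suc i)" "inverts p j (Suc j)"
      using head[OF sw(1)] head[OF sw(2)] px py by simp_all
    then obtain u v where uv: "((i, True) # u, (j, True) # v) \<in> braid_cong n"
      "simple_word ((i, True) # u)" "simple_word ((j, True) # v)" "strand_end ((i, True) # u) \<preceq> p"
      using bw by (auto intro: common_simple_prefix[OF _ _ \<open>i < j\<close> p ij])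
    have uvw: "(i, True) # u \<in> braid_words n" "(j, True) # v \<in> braid_words n"
      using braid_cong_words[OF uv(1)] by auto
    let ?m = "strand_end ((i, True) # u)"
    have m: "perm n ?m" using uvw by (intro perm_strand_end)
    obtain z where z: "z \<in> braid_words n" "simple_word z" "strand_end z = p \<circ> pinv ?m"
      using simple_word_exists[OF perm_comp[OF perm_inv[OF m] p]] by blast
    have mz: "additive ?m (strand_end z)" "strand_end z \<circ> ?m = p"
      using additive_quotient[OF perm_bij[OF m] uv(4)] unfolding z(3) by auto
    have m': "strand_end ((j, True) # v) = ?m" using braid_cong_strand_end[OF uv(1)] by simp
    have 1: "((i, True) # x, (i, True) # u @ z) \<in> braid_cong n"
      using bw sw uvw px z mz simple_word_append[of "(i, True) # u" z] strand_end_append_comp[of "(i, True) # u" z] uv(2)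
      by (intro IH) (auto simp del: strand_end.simps)
    have 2: "((i, True) # u @ z, (j, True) # v @ z) \<in> braid_cong n"
      using braid_cong.append[OF uv(1) braid_cong.refl[OF z(1)]] by simp
    have 3: "((j, True) # v @ z, (j, True) # y) \<in> braid_cong n"
      using bw sw uvw py z mz m' simple_word_append[of "(j, True) # v" z] strand_end_append_comp[of "(j, True) # v" z] uv(3)
      by (intro IH) (auto simp del: strand_end.simps)
    show ?thesis by (rule braid_cong.trans[OF 1 braid_cong.trans[OF 2 3]])
  qed
  show ?case
  proof (cases "w = [] \<or> v = []")
    case True
    then have "w = [] \<and> v = []"
      using empty less.prems by (auto simp: strand_end_Nil)
    then show ?thesis by (simp add: braid_cong.refl)
  next
    case False
    then obtain i e x j f y where wv: "w = (i, e) # x" "v = (j, f) # y"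
      by (metis neq_Nil_conv surj_pair)
    have ef: "e" "f" using less.prems(3,4) by (simp_all add: wv simple_word_Cons)
    have wv: "w = (i, True) # x" "v = (j, True) # y" using wv ef by auto
    have pp: "strand_end w = p" "strand_end v = p" using less.prems(5) by (simp_all add: p_def)
    consider "i < j" | "i = j" | "j < i" by linarith
    then show ?thesis
    proof cases
      case 1
      then show ?thesis using mixed less.prems pp unfolding wv by blast
    next
      case 2
      then show ?thesis using IH less.prems pp unfolding wv by blast
    next
      case 3
      then show ?thesis using mixed less.prems pp braid_cong.sym unfolding wv by blast
    qed
  qed
qed

interpretation group "braid_group n"
  by (rule group_braid_group)

abbreviation G where
  "G \<equiv> braid_group n"

definition simple_braid :: "(nat \<Rightarrow> nat) \<Rightarrow> braid" where
  "simple_braid p = braid_of n (SOME w. w \<in> braid_words n \<and> simple_word w \<and> strand_end w = p)"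

lemma braid_of_simple_word:
  assumes "w \<in> braid_words n" "simple_word w"
  shows "braid_of n w = simple_braid (strand_end w)"
proof -
  let ?P = "\<lambda>v. v \<in> braid_words n \<and> simple_word v \<and> strand_end v = strand_end w"
  have "?P (SOME v. ?P v)" by (rule someI[of ?P w]) (simp add: assms)
  then show ?thesis
    unfolding simple_braid_def using assms by (subst braid_of_eq_iff) (auto intro!: simple_words_cong)
qed

lemma simple_braidE:
  assumes "perm n p"
  obtains w where "w \<in> braid_words n" "simple_word w" "strand_end w = p" "simple_braid p = braid_of n w"
  using simple_word_exists[OF assms] braid_of_simple_word by metis

section \<open>Permutation braids\<close>

lemma braid_of_closed [simp]: "w \<in> braid_words n \<Longrightarrow> braid_of n w \<in> carrier G"
  by (simp add: carrier_braid_group)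

lemma one_braid: "\<one>\<^bsub>G\<^esub> = braid_of n []"
  by (simp add: braid_group_def)

lemma simple_braid_closed [simp]: "perm n p \<Longrightarrow> simple_braid p \<in> carrier G"
  by (erule simple_braidE) simp

lemma simple_braid_id: "simple_braid id = \<one>\<^bsub>G\<^esub>"
  using braid_of_simple_word[of "[]"] by (simp add: one_braid strand_end_Nil)

lemma simple_braid_mult:
  assumes "perm n p" "perm n q" "additive p q"
  shows "simple_braid p \<otimes>\<^bsub>G\<^esub> simple_braid q = simple_braid (q \<circ> p)"
proof -
  obtain u where u: "u \<in> braid_words n" "simple_word u" "strand_end u = p" "simple_braid p = braid_of n u"
    by (rule simple_braidE[OF assms(1)])
  obtain v where v: "v \<in> braid_words n" "simple_word v" "strand_end v = q" "simple_braid q = braid_of n v"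
    by (rule simple_braidE[OF assms(2)])
  have "simple_word (u @ v)" using u v assms(3) by (simp add: simple_word_append)
  then show ?thesis
    using u v braid_of_simple_word[of "u @ v"] by (simp add: mult_braid_of strand_end_append_comp)
qed

lemma braid_perm_simple_braid: "perm n p \<Longrightarrow> braid_perm (simple_braid p) = p"
  by (erule simple_braidE) (simp add: braid_perm_braid_of)

lemma simple_braid_eq_iff: "perm n p \<Longrightarrow> perm n q \<Longrightarrow> simple_braid p = simple_braid q \<longleftrightarrow> p = q"
  using braid_perm_simple_braid by metis

lemma permutation_braids_eq: "permutation_braids n = simple_braid ` {p. perm n p}"
proof (intro equalityI subsetI)
  fix b assume "b \<in> permutation_braids n"
  then obtain u w where u: "u \<in> braid_words n" "b = braid_of n u" "w \<in> b" "simple_word w"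
    by (auto simp: permutation_braids_def carrier_braid_group)
  then have "(u, w) \<in> braid_cong n" by (simp add: braid_of_def)
  then have "w \<in> braid_words n" "b = braid_of n w"
    using u braid_cong_words by (auto simp: braid_of_eq_iff)
  then show "b \<in> simple_braid ` {p. perm n p}"
    using braid_of_simple_word[OF _ u(4)] perm_strand_end by blast
next
  fix b assume "b \<in> simple_braid ` {p. perm n p}"
  then obtain w where w: "b = braid_of n w" "w \<in> braid_words n" "simple_word w"
    using simple_braidE by blast
  then have "w \<in> b" by (simp add: braid_of_def braid_cong.refl)
  with w show "b \<in> permutation_braids n" by (auto simp: permutation_braids_def)
qed

lemma strands_cross_simple_braid:
  assumes "perm n p" shows "strands_cross (simple_braid p) s t \<longleftrightarrow> inverts p s t"
proof -
  obtain w where w: "w \<in> braid_words n" "simple_word w" "strand_end w = p" "simple_braid p = braid_of n w"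
    by (rule simple_braidE[OF assms])
  have "strand_end v = p" if "v \<in> simple_braid p" for v
    using that braid_cong_strand_end w by (metis ImageE braid_of_def singletonD)
  moreover have "w \<in> simple_braid p" unfolding w(4) using w(1) by (simp add: braid_of_def braid_cong.refl)
  ultimately show ?thesis
    unfolding strands_cross_def using w(2) crossings_simple_word by (metis zero_neq_one)
qed

lemma garside_eq: "garside n = simple_braid (delta n)"
  unfolding garside_def
proof (rule the_equality)
  show "simple_braid (delta n) \<in> permutation_braids n \<and>
      (\<forall>i\<in>{1..n}. braid_perm (simple_braid (delta n)) i = n + 1 - i)"
    using perm_delta[of n] by (auto simp: permutation_braids_eq braid_perm_simple_braid delta_def)
  fix b assume b: "b \<in> permutation_braids n \<and> (\<forall>i\<in>{1..n}. braid_perm b i = n + 1 - i)"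
  then obtain p where p: "perm n p" "b = simple_braid p" by (auto simp: permutation_braids_eq)
  have "p = delta n"
  proof
    fix i
    show "p i = delta n i"
      using b p braid_perm_simple_braid[OF p(1)] permutes_not_in[OF p(1)] by (auto simp: delta_def)
  qed
  then show "b = simple_braid (delta n)" using p by simp
qed

lemma weighted_iff_crossing:
  assumes "perm n p" "perm n q"
  shows "weighted n p q \<longleftrightarrow> (\<forall>j\<in>{1..<n}. inverts q j (Suc j) \<longrightarrow>
    (\<exists>s t. p s = j \<and> p t = Suc j \<and> inverts p s t))"
proof -
  have "inverts (pinv p) j (Suc j) \<longleftrightarrow> (\<exists>s t. p s = j \<and> p t = Suc j \<and> inverts p s t)" for j
    using permutes_inverses[OF assms(1)] by (metis inverts_inv perm_bij[OF assms(1)])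
  then show ?thesis by (simp add: weighted_def)
qed

lemma left_weighted_map:
  assumes ps: "\<forall>p\<in>set ps. perm n p"
  shows "left_weighted n (map simple_braid ps) \<longleftrightarrow> normal n ps \<and> delta n \<notin> set ps"
proof -
  have "set (map simple_braid ps) \<subseteq> permutation_braids n - {\<one>\<^bsub>G\<^esub>, garside n} \<longleftrightarrow>
      (\<forall>p\<in>set ps. p \<noteq> id) \<and> delta n \<notin> set ps"
    using ps perm_delta[of n]
    by (auto simp: permutation_braids_eq garside_eq simple_braid_eq_iff simple_braid_id[symmetric])
  moreover have "(\<forall>i j. Suc i < length (map simple_braid ps) \<longrightarrow> j \<in> {1..<n} \<longrightarrow>
      strands_cross (map simple_braid ps ! Suc i) j (Suc j) \<longrightarrow>
      (\<exists>s t. braid_perm (map simple_braid ps ! i) s = j \<and> braid_perm (map simple_braid ps ! i) t = Suc j \<and>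
        strands_cross (map simple_braid ps ! i) s t)) \<longleftrightarrow>
      (\<forall>i. Suc i < length ps \<longrightarrow> weighted n (ps ! i) (ps ! Suc i))"
  proof -
    have "perm n (ps ! i) \<and> perm n (ps ! Suc i)" if "Suc i < length ps" for i
      using that ps by simp
    then show ?thesis
      by (auto simp: weighted_iff_crossing strands_cross_simple_braid braid_perm_simple_braid)
  qed
  ultimately show ?thesis
    unfolding left_weighted_def normal_def using ps by (auto simp: successively_conv_nth)
qed

lemma left_weightedE:
  assumes "left_weighted n bs"
  obtains ps where "bs = map simple_braid ps" "normal n ps" "delta n \<notin> set ps"
proof -
  have "set bs \<subseteq> simple_braid ` {p. perm n p}"
    using assms by (auto simp: left_weighted_def permutation_braids_eq)
  then have "\<exists>ps. bs = map simple_braid ps \<and> (\<forall>p\<in>set ps. perm n p)"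
  proof (induction bs)
    case (Cons b bs)
    then obtain p ps where "b = simple_braid p" "perm n p" "bs = map simple_braid ps" "\<forall>p\<in>set ps. perm n p"
      by auto
    then show ?case by (intro exI[of _ "p # ps"]) auto
  qed simp
  then show ?thesis using assms left_weighted_map that by blast
qed

lemma braid_prod_simps:
  "braid_prod n [] = \<one>\<^bsub>G\<^esub>"
  "braid_prod n (b # bs) = b \<otimes>\<^bsub>G\<^esub> braid_prod n bs"
  by (simp_all add: braid_prod_def)

lemma braid_prod_closed: "set bs \<subseteq> carrier G \<Longrightarrow> braid_prod n bs \<in> carrier G"
  by (induction bs) (auto simp: braid_prod_simps)

lemma prod_closed: "\<forall>p\<in>set ps. perm n p \<Longrightarrow> braid_prod n (map simple_braid ps) \<in> carrier G"
  by (rule braid_prod_closed) auto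

lemma garside_closed [simp]: "garside n \<in> carrier G"
  by (simp add: garside_eq perm_delta)

text \<open>With the complement \<open>q\<close> of \<open>p\<close>, both \<open>p q\<close> and \<open>q tau(p)\<close> are the Garside element.\<close>

lemma simple_braid_garside:
  assumes p: "perm n p"
  shows "simple_braid p \<otimes>\<^bsub>G\<^esub> garside n = garside n \<otimes>\<^bsub>G\<^esub> simple_braid (tau n p)"
proof -
  define q where "q = delta n \<circ> pinv p"
  have q: "perm n q" unfolding q_def by (intro perm_comp perm_inv perm_delta p)
  have pq: "q \<circ> p = delta n" by (simp add: q_def fun_eq_iff permutes_inverses[OF p])
  have qp: "tau n p \<circ> q = delta n" by (simp add: q_def tau_def fun_eq_iff permutes_inverses[OF p])
  have 1: "simple_braid p \<otimes>\<^bsub>G\<^esub> simple_braid q = garside n"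
    using simple_braid_mult[OF p q] additive_delta[OF p] pq by (simp add: garside_eq)
  have 2: "simple_braid q \<otimes>\<^bsub>G\<^esub> simple_braid (tau n p) = garside n"
    using simple_braid_mult[OF q perm_tau[OF p]] additive_delta[OF q] qp by (simp add: garside_eq)
  have "simple_braid p \<otimes>\<^bsub>G\<^esub> garside n =
      (simple_braid p \<otimes>\<^bsub>G\<^esub> simple_braid q) \<otimes>\<^bsub>G\<^esub> simple_braid (tau n p)"
    using p q perm_tau[OF p] by (simp add: m_assoc 2)
  then show ?thesis by (simp only: 1)
qed

lemma simple_braid_garside_pow:
  assumes p: "perm n p"
  shows "simple_braid p \<otimes>\<^bsub>G\<^esub> (garside n [^]\<^bsub>G\<^esub> (k :: int)) =
    (garside n [^]\<^bsub>G\<^esub> k) \<otimes>\<^bsub>G\<^esub> simple_braid (twist n k p)"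
proof (induction k rule: int_induct[of _ 0])
  case base
  then show ?case using p by (simp add: twist_def)
next
  case (step1 k)
  have t: "tau n (twist n k p) = twist n (k + 1) p" by (simp add: twist_def)
  note c = p perm_twist[OF p] perm_tau[OF perm_twist[OF p]]
  have "simple_braid p \<otimes>\<^bsub>G\<^esub> (garside n [^]\<^bsub>G\<^esub> (k + 1)) =
      (simple_braid p \<otimes>\<^bsub>G\<^esub> (garside n [^]\<^bsub>G\<^esub> k)) \<otimes>\<^bsub>G\<^esub> garside n"
    using c by (simp add: int_pow_mult m_assoc)
  also have "\<dots> = (garside n [^]\<^bsub>G\<^esub> k) \<otimes>\<^bsub>G\<^esub> (simple_braid (twist n k p) \<otimes>\<^bsub>G\<^esub> garside n)"
    using c step1 by (simp add: m_assoc)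
  also have "\<dots> = (garside n [^]\<^bsub>G\<^esub> k) \<otimes>\<^bsub>G\<^esub> (garside n \<otimes>\<^bsub>G\<^esub> simple_braid (twist n (k + 1) p))"
    using simple_braid_garside[OF perm_twist[OF p]] t by simp
  also have "\<dots> = (garside n [^]\<^bsub>G\<^esub> (k + 1)) \<otimes>\<^bsub>G\<^esub> simple_braid (twist n (k + 1) p)"
    using c perm_twist[OF p, of "k + 1"] by (simp add: int_pow_mult m_assoc)
  finally show ?case .
next
  case (step2 k)
  have t: "tau n (twist n (k - 1) p) = twist n k p" by (simp add: twist_def)
  note c = p perm_twist[OF p]
  let ?d = "garside n [^]\<^bsub>G\<^esub> (k - 1)"
  have k: "garside n [^]\<^bsub>G\<^esub> k = ?d \<otimes>\<^bsub>G\<^esub> garside n"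
    using int_pow_mult[of "garside n" "k - 1" 1] by simp
  have "(simple_braid p \<otimes>\<^bsub>G\<^esub> ?d) \<otimes>\<^bsub>G\<^esub> garside n = ?d \<otimes>\<^bsub>G\<^esub> (garside n \<otimes>\<^bsub>G\<^esub> simple_braid (twist n k p))"
    using step2 c by (simp add: k m_assoc)
  also have "\<dots> = (?d \<otimes>\<^bsub>G\<^esub> simple_braid (twist n (k - 1) p)) \<otimes>\<^bsub>G\<^esub> garside n"
    using simple_braid_garside[OF perm_twist[OF p], of "k - 1"] c t by (simp add: m_assoc)
  finally show ?case using c by simp
qed

definition state_braid :: "int \<times> (nat \<Rightarrow> nat) list \<Rightarrow> braid" where
  "state_braid x = (case x of (k, ps) \<Rightarrow> garside_expr n k (map simple_braid ps))"

lemma garside_expr_closed: "\<forall>p\<in>set ps. perm n p \<Longrightarrow> garside_expr n k (map simple_braid ps) \<in> carrier G"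
  using prod_closed by (simp add: garside_expr_def)

lemma prod_push:
  assumes "perm n p" "\<forall>q\<in>set ps. perm n q"
  shows "(\<forall>q\<in>set (push n p ps). perm n q) \<and>
    braid_prod n (map simple_braid (push n p ps)) = simple_braid p \<otimes>\<^bsub>G\<^esub> braid_prod n (map simple_braid ps)"
  using assms
proof (induction ps arbitrary: p)
  case Nil
  then show ?case by (simp add: braid_prod_simps simple_braid_id)
next
  case (Cons q qs)
  then have p: "perm n p" and q: "perm n q" by auto
  define u where "u = slide n p q"
  note u = slide[OF p q, folded u_def]
  define r where "r = q \<circ> pinv u"
  have r: "perm n r" unfolding r_def by (intro perm_comp perm_inv u q)
  have ur: "additive u r" "r \<circ> u = q"
    using additive_quotient[OF perm_bij[OF u(1)] u(2)] by (auto simp: r_def)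
  have push: "push n p (q # qs) = (u \<circ> p) # push n r qs" by (simp add: u_def r_def)
  have cl: "braid_prod n (map simple_braid qs) \<in> carrier G" using prod_closed Cons.prems by simp
  have "braid_prod n (map simple_braid (push n p (q # qs))) =
      (simple_braid p \<otimes>\<^bsub>G\<^esub> simple_braid u) \<otimes>\<^bsub>G\<^esub> (simple_braid r \<otimes>\<^bsub>G\<^esub> braid_prod n (map simple_braid qs))"
    using Cons.IH[OF r] Cons.prems simple_braid_mult[OF p u(1,3)] by (simp only: push) (simp add: braid_prod_simps)
  also have "\<dots> = simple_braid p \<otimes>\<^bsub>G\<^esub> ((simple_braid u \<otimes>\<^bsub>G\<^esub> simple_braid r) \<otimes>\<^bsub>G\<^esub> braid_prod n (map simple_braid qs))"
    using p u(1) r cl by (simp add: m_assoc)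
  finally show ?case
    using Cons.IH[OF r] Cons.prems simple_braid_mult[OF u(1) r ur(1)] ur(2) perm_comp[OF p u(1)]
    by (simp only: push) (simp add: braid_prod_simps)
qed

lemma state_braid_strip:
  "\<forall>p\<in>set ps. perm n p \<Longrightarrow> state_braid (strip n k ps) = garside_expr n k (map simple_braid ps)"
proof (induction ps arbitrary: k)
  case (Cons p ps)
  show ?case
  proof (cases "p = delta n")
    case True
    have "garside_expr n (k + 1) (map simple_braid ps) = garside_expr n k (map simple_braid (p # ps))"
      using Cons.prems prod_closed[of ps]
      by (simp add: True garside_expr_def braid_prod_simps int_pow_mult m_assoc flip: garside_eq)
    then show ?thesis using Cons True by simp
  qed (simp add: state_braid_def)
qed (simp add: state_braid_def)

lemma state_braid_act:
  assumes p: "perm n p" and x: "x \<in> states n"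
  shows "state_braid (act n p x) = simple_braid p \<otimes>\<^bsub>G\<^esub> state_braid x"
proof -
  obtain k ps where xk: "x = (k, ps)" and "normal n ps" using x by (auto simp: states_def)
  then have ps: "\<forall>q\<in>set ps. perm n q" using normal_perm by blast
  note c = p perm_twist[OF p] prod_closed[OF ps]
  have "state_braid (act n p x) = garside_expr n k (map simple_braid (push n (twist n k p) ps))"
    using prod_push[OF perm_twist[OF p] ps] state_braid_strip by (simp add: xk act_def)
  also have "\<dots> = ((garside n [^]\<^bsub>G\<^esub> k) \<otimes>\<^bsub>G\<^esub> simple_braid (twist n k p)) \<otimes>\<^bsub>G\<^esub> braid_prod n (map simple_braid ps)"
    using prod_push[OF perm_twist[OF p] ps] c by (simp add: garside_expr_def m_assoc)
  also have "\<dots> = simple_braid p \<otimes>\<^bsub>G\<^esub> state_braid x"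
    using c by (simp add: xk state_braid_def garside_expr_def m_assoc flip: simple_braid_garside_pow)
  finally show ?thesis .
qed

section \<open>The action of the braid group on normal forms\<close>

definition shift_state :: "int \<times> (nat \<Rightarrow> nat) list \<Rightarrow> int \<times> (nat \<Rightarrow> nat) list" where
  "shift_state x = apfst (\<lambda>k. k - 1) x"

text \<open>The inverse of a generator is the inverse of the Garside element times a permutation braid, which keeps
  the action of inverse letters within left multiplications by permutations.\<close>

definition letter_act :: "nat \<times> bool \<Rightarrow> int \<times> (nat \<Rightarrow> nat) list \<Rightarrow> int \<times> (nat \<Rightarrow> nat) list" where
  "letter_act l x = (case l of (i, e) \<Rightarrow>
     if e then act n (transpose i (Suc i)) x
     else shift_state (act n (transpose i (Suc i) \<circ> delta n) x))"

definition word_act :: "braid_word \<Rightarrow> int \<times> (nat \<Rightarrow> nat) list \<Rightarrow> int \<times> (nat \<Rightarrow> nat) list" where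
  "word_act w x = foldr letter_act w x"

lemma word_act_simps [simp]:
  "word_act [] x = x" "word_act (l # w) x = letter_act l (word_act w x)"
  "word_act (u @ v) x = word_act u (word_act v x)"
  by (simp_all add: word_act_def)

lemma shift_state_closed: "x \<in> states n \<Longrightarrow> shift_state x \<in> states n"
  by (auto simp: shift_state_def states_def)

lemma letter_act_closed: "i \<in> {1..<n} \<Longrightarrow> x \<in> states n \<Longrightarrow> letter_act (i, e) x \<in> states n"
  using perm_transpose[of i n] perm_delta[of n] by (auto simp: letter_act_def intro!: act_state shift_state_closed perm_comp)

lemma word_act_closed: "w \<in> braid_words n \<Longrightarrow> x \<in> states n \<Longrightarrow> word_act w x \<in> states n"
proof (induction w)
  case (Cons l w)
  then show ?case by (cases l) (auto intro!: letter_act_closed)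
qed simp

lemma word_act_simple_word:
  assumes "simple_word w" "w \<in> braid_words n" "x \<in> states n"
  shows "word_act w x = act n (strand_end w) x"
  using assms
proof (induction w)
  case Nil
  then have "act n id x = x" by (cases x) (simp only: act_id)
  then show ?case by (simp only: strand_end_Nil word_act_simps)
next
  case (Cons l w)
  obtain i e where l: "l = (i, e)" by (cases l)
  have e: "e" and w: "simple_word w" "additive (transpose i (Suc i)) (strand_end w)"
    using Cons.prems(1) by (simp_all add: l simple_word_Cons)
  then have "word_act (l # w) x = act n (transpose i (Suc i)) (act n (strand_end w) x)"
    using Cons by (simp add: l letter_act_def)
  also have "\<dots> = act n (strand_end w \<circ> transpose i (Suc i)) x"
    using act_additive[OF perm_transpose perm_strand_end w(2) Cons.prems(3)] Cons.prems(2) by (simp add: l)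
  finally show ?case by (simp only: l strand_end_Cons)
qed

lemma letter_act_cancel:
  assumes n: "2 \<le> n" and i: "i \<in> {1..<n}" and x: "x \<in> states n"
  shows "letter_act (i, e) (letter_act (i, \<not> e) x) = x"
proof -
  let ?s = "transpose i (Suc i)"
  obtain k ps where xk: "x = (k, ps)" by (cases x)
  have s: "perm n ?s" using perm_transpose i .
  have t: "perm n (?s \<circ> delta n)" using s perm_delta[of n] by (rule perm_comp[rotated])
  have d: "shift_state (act n (delta n) x) = x"
    using act_delta[of k ps n] x n by (simp add: xk shift_state_def)
  have comp: "act n a (act n b x) = act n (delta n) x" if "perm n a" "perm n b" "b \<circ> a = delta n" for a b
    using act_additive[OF that(1,2) additive_delta[OF that(1,3)] x] that(3) by simp
  show ?thesis
  proof (cases e)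
    case False
    have "act n (?s \<circ> delta n) (act n ?s x) = act n (delta n) x"
      by (rule comp[OF t s]) (simp add: fun_eq_iff)
    then show ?thesis using False d by (simp add: letter_act_def)
  next
    case True
    have "act n ?s (shift_state y) = shift_state (act n (tau n ?s) y)" for y
      using act_shift[of n ?s "fst y" "snd y"] by (cases y) (simp add: shift_state_def)
    moreover have "act n (tau n ?s) (act n (?s \<circ> delta n) x) = act n (delta n) x"
      by (rule comp[OF perm_tau[OF s] t]) (simp add: fun_eq_iff tau_def)
    ultimately show ?thesis using True d by (simp add: letter_act_def)
  qed
qed

text \<open>The two sides of an Artin relation are simple words for the same permutation, and simple words act
  through their permutations.\<close>

lemma word_act_cong:
  assumes "2 \<le> n" "(u, v) \<in> braid_cong n" "x \<in> states n"
  shows "word_act u x = word_act v x"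
  using assms(2,3)
proof (induction arbitrary: x rule: braid_cong.induct)
  case (append u u' v v')
  then show ?case using word_act_closed braid_cong_words by simp
next
  case (cancel i e)
  then show ?case using letter_act_cancel assms(1) by simp
next
  case (far i j)
  then have c: "([(i, True), (j, True)], [(j, True), (i, True)]) \<in> braid_cong n" by (intro braid_cong.far)
  have "simple_word [(i, True), (j, True)]" "simple_word [(j, True), (i, True)]"
    using far by (auto simp: simple_word_def doubleton_eq_iff transpose_def)
  then show ?case
    using word_act_simple_word far braid_cong_strand_end[OF c] braid_cong_words[OF c] by metis
next
  case (near i)
  then have c: "([(i, True), (Suc i, True), (i, True)], [(Suc i, True), (i, True), (Suc i, True)]) \<in> braid_cong n"
    by (intro braid_cong.near)
  have "simple_word [(i, True), (Suc i, True), (i, True)]" "simple_word [(Suc i, True), (i, True), (Suc i, True)]"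
    by (auto simp: simple_word_def doubleton_eq_iff transpose_def)
  then show ?case
    using word_act_simple_word near braid_cong_strand_end[OF c] braid_cong_words[OF c] by metis
qed auto

lemma braid_of_letter:
  assumes "i \<in> {1..<n}"
  shows "braid_of n [(i, True)] = simple_braid (transpose i (Suc i))"
    and "braid_of n [(i, False)] = inv\<^bsub>G\<^esub> (braid_of n [(i, True)])"
proof -
  show "braid_of n [(i, True)] = simple_braid (transpose i (Suc i))"
    using braid_of_simple_word[of "[(i, True)]"] assms by (simp add: strand_end_letter del: strand_end.simps)
  have "braid_of n [(i, False)] \<otimes>\<^bsub>G\<^esub> braid_of n [(i, True)] = \<one>\<^bsub>G\<^esub>"
    using assms braid_cong.cancel[OF assms, of False] by (simp add: mult_braid_of one_braid braid_of_eq_iff)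
  then show "braid_of n [(i, False)] = inv\<^bsub>G\<^esub> (braid_of n [(i, True)])"
    using assms by (intro inv_equality[symmetric]) auto
qed

lemma state_braid_closed: "x \<in> states n \<Longrightarrow> state_braid x \<in> carrier G"
  using normal_perm by (auto simp: state_braid_def states_def intro!: garside_expr_closed)

lemma state_braid_shift:
  assumes "x \<in> states n" shows "state_braid (shift_state x) = inv\<^bsub>G\<^esub> (garside n) \<otimes>\<^bsub>G\<^esub> state_braid x"
proof -
  obtain k ps where xk: "x = (k, ps)" and "normal n ps" using assms by (auto simp: states_def)
  then have c: "braid_prod n (map simple_braid ps) \<in> carrier G" using prod_closed normal_perm by blast
  have "garside n [^]\<^bsub>G\<^esub> (-1 + k) = inv\<^bsub>G\<^esub> (garside n) \<otimes>\<^bsub>G\<^esub> (garside n [^]\<^bsub>G\<^esub> k)"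
    by (subst int_pow_mult) (simp_all add: int_pow_neg)
  then show ?thesis using c by (simp add: xk shift_state_def state_braid_def garside_expr_def m_assoc)
qed

text \<open>Applied to the trivial state, this equation exhibits a normal form of every braid.\<close>

lemma state_braid_word_act:
  assumes "w \<in> braid_words n" "x \<in> states n"
  shows "state_braid (word_act w x) = braid_of n w \<otimes>\<^bsub>G\<^esub> state_braid x"
  using assms
proof (induction w)
  case Nil
  then show ?case using state_braid_closed by (simp flip: one_braid)
next
  case (Cons l w)
  obtain i e where l: "l = (i, e)" by (cases l)
  have i: "i \<in> {1..<n}" and w: "w \<in> braid_words n" using Cons.prems by (simp_all add: l)
  let ?s = "transpose i (Suc i)"
  have s: "perm n ?s" using perm_transpose i .
  have t: "perm n (?s \<circ> delta n)" using s perm_delta[of n] by (rule perm_comp[rotated])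
  have y: "word_act w x \<in> states n" using word_act_closed w Cons.prems by blast
  have Y: "state_braid (word_act w x) \<in> carrier G" using state_braid_closed y .
  have letter: "state_braid (letter_act (i, e) (word_act w x)) =
      braid_of n [(i, e)] \<otimes>\<^bsub>G\<^esub> state_braid (word_act w x)"
  proof (cases e)
    case True
    then show ?thesis using state_braid_act[OF s y] braid_of_letter[OF i] by (simp add: letter_act_def)
  next
    case False
    have g: "simple_braid (?s \<circ> delta n) \<otimes>\<^bsub>G\<^esub> simple_braid ?s = garside n"
    proof -
      have "?s \<circ> (?s \<circ> delta n) = delta n" by (simp add: fun_eq_iff)
      then show ?thesis using simple_braid_mult[OF t s] additive_delta[OF t] by (simp add: garside_eq)
    qed
    have "inv\<^bsub>G\<^esub> (garside n) \<otimes>\<^bsub>G\<^esub> simple_braid (?s \<circ> delta n) = inv\<^bsub>G\<^esub> (simple_braid ?s)"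
      unfolding g[symmetric] using s t by (simp add: inv_mult_group m_assoc)
    then have "inv\<^bsub>G\<^esub> (garside n) \<otimes>\<^bsub>G\<^esub> (simple_braid (?s \<circ> delta n) \<otimes>\<^bsub>G\<^esub> state_braid (word_act w x)) =
        braid_of n [(i, False)] \<otimes>\<^bsub>G\<^esub> state_braid (word_act w x)"
      using braid_of_letter[OF i] s t Y by (simp flip: m_assoc)
    then show ?thesis
      using False state_braid_shift[OF act_state[OF t y]] state_braid_act[OF t y] by (simp add: letter_act_def)
  qed
  have "braid_of n (l # w) = braid_of n [(i, e)] \<otimes>\<^bsub>G\<^esub> braid_of n w"
    using i w by (simp add: l mult_braid_of)
  then show ?case
    using letter Cons i w state_braid_closed[OF Cons.prems(2)] by (simp add: l m_assoc)
qed

lemma normal_form_exists: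
  assumes "b \<in> carrier G"
  obtains k ps where "(k, ps) \<in> states n" "b = garside_expr n k (map simple_braid ps)"
proof -
  obtain w where w: "w \<in> braid_words n" "b = braid_of n w" using assms by (auto simp: carrier_braid_group)
  have e: "(0, []) \<in> states n" by (simp add: states_def)
  have "state_braid (0, []) = \<one>\<^bsub>G\<^esub>" by (simp add: state_braid_def garside_expr_def braid_prod_simps)
  then have "state_braid (word_act w (0, [])) = b"
    using state_braid_word_act[OF w(1) e] w by simp
  moreover have "word_act w (0, []) \<in> states n" using word_act_closed[OF w(1) e] .
  ultimately show ?thesis using that by (cases "word_act w (0, [])") (auto simp: state_braid_def)
qed

lemma garside_pow_word:
  assumes "2 \<le> n"
  shows "\<exists>w \<in> braid_words n. braid_of n w = garside n [^]\<^bsub>G\<^esub> (k :: int) \<and>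
    (\<forall>j ps. (j, ps) \<in> states n \<longrightarrow> word_act w (j, ps) = (j + k, ps))"
proof -
  obtain d where d: "d \<in> braid_words n" "simple_word d" "strand_end d = delta n" "garside n = braid_of n d"
    using simple_braidE[OF perm_delta[of n]] garside_eq by metis
  have ad: "word_act d (j, ps) = (j + 1, ps)" if "(j, ps) \<in> states n" for j ps
    using word_act_simple_word[OF d(2,1) that] act_delta[OF that assms] d(3) by simp
  obtain d' where d': "d' \<in> braid_words n" "inv\<^bsub>G\<^esub> (garside n) = braid_of n d'"
    using inv_closed[OF garside_closed] by (auto simp: carrier_braid_group)
  have st: "(j', ps) \<in> states n" if "(j, ps) \<in> states n" for j j' ps using that by (simp add: states_def)
  have "braid_of n d' \<otimes>\<^bsub>G\<^esub> braid_of n d = \<one>\<^bsub>G\<^esub>"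
    using l_inv[OF garside_closed] by (simp only: d'(2) flip: d(4))
  then have "braid_of n (d' @ d) = braid_of n []"
    using d(1) d'(1) by (simp add: mult_braid_of one_braid)
  then have dd: "(d' @ d, []) \<in> braid_cong n" using d d' by (simp add: braid_of_eq_iff)
  have ad': "word_act d' (j, ps) = (j - 1, ps)" if "(j, ps) \<in> states n" for j ps
    using word_act_cong[OF assms dd st[OF that, of "j - 1"]] ad[OF st[OF that, of "j - 1"]] by simp
  show ?thesis
  proof (induction k rule: int_induct[of _ 0])
    case base
    show ?case by (intro bexI[of _ "[]"]) (auto simp: one_braid)
  next
    case (step1 k)
    then obtain w where w: "w \<in> braid_words n" "braid_of n w = garside n [^]\<^bsub>G\<^esub> k"
      "\<forall>j ps. (j, ps) \<in> states n \<longrightarrow> word_act w (j, ps) = (j + k, ps)" by blast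
    have "braid_of n (w @ d) = garside n [^]\<^bsub>G\<^esub> (k + 1)"
      using w d by (simp add: int_pow_mult flip: mult_braid_of)
    then show ?case using w d ad st by (intro bexI[of _ "w @ d"]) auto
  next
    case (step2 k)
    then obtain w where w: "w \<in> braid_words n" "braid_of n w = garside n [^]\<^bsub>G\<^esub> k"
      "\<forall>j ps. (j, ps) \<in> states n \<longrightarrow> word_act w (j, ps) = (j + k, ps)" by blast
    have "garside n [^]\<^bsub>G\<^esub> (k + - 1) = braid_of n w \<otimes>\<^bsub>G\<^esub> inv\<^bsub>G\<^esub> (garside n)"
      unfolding w(2) by (subst int_pow_mult) (simp_all add: int_pow_neg)
    then have "braid_of n (w @ d') = garside n [^]\<^bsub>G\<^esub> (k - 1)"
      using w d' by (simp flip: mult_braid_of)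
    then show ?case using w d' ad' st by (intro bexI[of _ "w @ d'"]) auto
  qed
qed

lemma prod_word:
  assumes "(0, ps) \<in> states n"
  shows "\<exists>w \<in> braid_words n. braid_of n w = braid_prod n (map simple_braid ps) \<and> word_act w (0, []) = (0, ps)"
  using assms
proof (induction ps)
  case Nil
  show ?case by (intro bexI[of _ "[]"]) (auto simp: one_braid braid_prod_simps)
next
  case (Cons p ps)
  then have p: "perm n p" and st: "(0, ps) \<in> states n" by (auto simp: states_def normal_Cons)
  obtain w where w: "w \<in> braid_words n" "braid_of n w = braid_prod n (map simple_braid ps)"
    "word_act w (0, []) = (0, ps)" using Cons.IH[OF st] by blast
  obtain u where u: "u \<in> braid_words n" "simple_word u" "strand_end u = p" "simple_braid p = braid_of n u"
    by (rule simple_braidE[OF p])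
  have "word_act u (0, ps) = (0, p # ps)"
    using word_act_simple_word[OF u(2,1) st] act_normal_Cons[OF Cons.prems] u(3) by simp
  then show ?case using u w
    by (intro bexI[of _ "u @ w"]) (auto simp: braid_prod_simps simp flip: mult_braid_of)
qed

text \<open>Uniqueness of the normal form: whatever word represents the braid, its action on the trivial state
  produces the given power and factors.\<close>

lemma word_act_garside_expr:
  assumes "2 \<le> n" "w \<in> braid_words n" "(k, ps) \<in> states n"
    and "braid_of n w = garside_expr n k (map simple_braid ps)"
  shows "word_act w (0, []) = (k, ps)"
proof -
  have st: "(0, ps) \<in> states n" "(0, []) \<in> states n" using assms(3) by (auto simp: states_def)
  obtain u where u: "u \<in> braid_words n" "braid_of n u = garside n [^]\<^bsub>G\<^esub> k"
    "\<forall>j ps. (j, ps) \<in> states n \<longrightarrow> word_act u (j, ps) = (j + k, ps)"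
    using garside_pow_word[OF assms(1)] by blast
  obtain v where v: "v \<in> braid_words n" "braid_of n v = braid_prod n (map simple_braid ps)"
    "word_act v (0, []) = (0, ps)" using prod_word[OF st(1)] by blast
  have "braid_of n w = braid_of n (u @ v)"
    using u v assms(4) by (simp add: garside_expr_def flip: mult_braid_of)
  then have "(w, u @ v) \<in> braid_cong n" using u v assms(2) by (simp add: braid_of_eq_iff)
  then show ?thesis using word_act_cong[OF assms(1) _ st(2)] u v st by simp
qed

lemma left_normal_form_eqI:
  assumes n: "2 \<le> n" and st: "(k, ps) \<in> states n" and b: "b = garside_expr n k (map simple_braid ps)"
  shows "left_normal_form n b = (k, map simple_braid ps)"
  unfolding left_normal_form_def
proof (rule the_equality)
  have ps: "\<forall>p\<in>set ps. perm n p" using st normal_perm by (auto simp: states_def)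
  show "case (k, map simple_braid ps) of (k, bs) \<Rightarrow> left_weighted n bs \<and> b = garside_expr n k bs"
    using st b left_weighted_map[OF ps] by (simp add: states_def)
  fix x assume x: "case x of (k, bs) \<Rightarrow> left_weighted n bs \<and> b = garside_expr n k bs"
  obtain k' bs' where xk: "x = (k', bs')" by (cases x)
  obtain ps' where ps': "bs' = map simple_braid ps'" "normal n ps'" "delta n \<notin> set ps'"
    using x left_weightedE by (auto simp: xk)
  have "b \<in> carrier G" using garside_expr_closed[OF ps] b by simp
  then obtain w where w: "w \<in> braid_words n" "b = braid_of n w" by (auto simp: carrier_braid_group)
  have "word_act w (0, []) = (k', ps')"
    using x ps' w by (intro word_act_garside_expr n) (auto simp: xk states_def)
  moreover have "word_act w (0, []) = (k, ps)"
    using st b w by (intro word_act_garside_expr n) auto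
  ultimately show "x = (k, map simple_braid ps)" using ps' by (simp add: xk)
qed

end

section \<open>Exponent sums\<close>

definition word_exponent :: "braid_word \<Rightarrow> int" where
  "word_exponent w = (\<Sum>(i, e)\<leftarrow>w. if e then 1 else - 1)"

lemma word_exponent_append [simp]: "word_exponent (u @ v) = word_exponent u + word_exponent v"
  by (simp add: word_exponent_def)

lemma word_exponent_cong: "(u, v) \<in> braid_cong n \<Longrightarrow> word_exponent u = word_exponent v"
  by (induction rule: braid_cong.induct) (auto simp: word_exponent_def)

lemma word_exponent_simple_word: "simple_word w \<Longrightarrow> word_exponent w = int (length w)"
  by (induction w) (auto simp: word_exponent_def simple_word_Cons)

definition exponent :: "braid \<Rightarrow> int" where
  "exponent b = the_elem (word_exponent ` b)"

context
  fixes n :: nat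
begin

interpretation group "braid_group n"
  by (rule group_braid_group)

lemma exponent_braid_of:
  assumes "w \<in> braid_words n" shows "exponent (braid_of n w) = word_exponent w"
proof -
  have "word_exponent ` braid_of n w = {word_exponent w}"
    using braid_cong.refl[OF assms] by (auto simp: braid_of_def dest: word_exponent_cong)
  then show ?thesis by (simp add: exponent_def)
qed

lemma carrierE:
  assumes "b \<in> carrier (G n)" obtains w where "w \<in> braid_words n" "b = braid_of n w"
  using assms by (auto simp: carrier_braid_group)

lemma exponent_mult:
  assumes "a \<in> carrier (G n)" "b \<in> carrier (G n)"
  shows "exponent (a \<otimes>\<^bsub>G n\<^esub> b) = exponent a + exponent b"
  using assms by (auto elim!: carrierE simp: mult_braid_of exponent_braid_of)

lemma exponent_one: "exponent \<one>\<^bsub>G n\<^esub> = 0"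
  using exponent_braid_of[of "[]"] by (simp add: one_braid word_exponent_def)

lemma exponent_inv: "a \<in> carrier (G n) \<Longrightarrow> exponent (inv\<^bsub>G n\<^esub> a) = - exponent a"
  using exponent_mult[of "inv\<^bsub>G n\<^esub> a" a] by (simp add: exponent_one)

lemma exponent_pow:
  assumes "a \<in> carrier (G n)" shows "exponent (a [^]\<^bsub>G n\<^esub> (k :: int)) = k * exponent a"
proof (induction k rule: int_induct[of _ 0])
  case base
  show ?case by (simp add: exponent_one)
next
  case (step1 k)
  then show ?case using assms by (simp add: int_pow_mult exponent_mult algebra_simps)
next
  case (step2 k)
  then show ?case
    using exponent_mult[of "a [^]\<^bsub>G n\<^esub> (k - 1)" a] int_pow_mult[OF assms, of "k - 1" 1] assms
    by (simp add: algebra_simps)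
qed

lemma exponent_simple_braid_pos:
  assumes "perm n p" "p \<noteq> id" shows "0 < exponent (simple_braid n p)"
proof -
  obtain w where w: "w \<in> braid_words n" "simple_word w" "strand_end w = p" "simple_braid n p = braid_of n w"
    by (rule simple_braidE[OF assms(1)])
  then have "w \<noteq> []" using assms(2) strand_end_Nil by metis
  then show ?thesis using w by (simp add: exponent_braid_of word_exponent_simple_word)
qed

text \<open>The braid and its complement multiply to the Garside element, and the complement is not trivial.\<close>

lemma exponent_simple_braid_less:
  assumes p: "perm n p" "p \<noteq> delta n" shows "exponent (simple_braid n p) < exponent (garside n)"
proof -
  define q where "q = delta n \<circ> pinv p"
  have q: "perm n q" unfolding q_def by (intro perm_comp perm_inv perm_delta p)
  have qp: "q \<circ> p = delta n" by (simp add: q_def fun_eq_iff permutes_inverses[OF p(1)])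
  then have "q \<noteq> id" using p(2) by (metis id_comp)
  moreover have "simple_braid n p \<otimes>\<^bsub>G n\<^esub> simple_braid n q = garside n"
    using simple_braid_mult[OF p(1) q] additive_delta[OF p(1)] qp by (simp add: garside_eq)
  ultimately show ?thesis
    using exponent_mult[of "simple_braid n p" "simple_braid n q"] exponent_simple_braid_pos[OF q]
      simple_braid_closed p q by simp
qed

lemma exponent_garside_expr:
  assumes "\<forall>p\<in>set ps. perm n p"
  shows "exponent (garside_expr n k (map (simple_braid n) ps)) =
    k * exponent (garside n) + (\<Sum>p\<leftarrow>ps. exponent (simple_braid n p))"
proof -
  have "exponent (braid_prod n (map (simple_braid n) ps)) = (\<Sum>p\<leftarrow>ps. exponent (simple_braid n p))"
    using assms
  proof (induction ps)
    case (Cons p ps)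
    then show ?case
      using exponent_mult[OF simple_braid_closed prod_closed] by (simp add: braid_prod_simps)
  qed (simp add: braid_prod_simps exponent_one)
  then show ?thesis
    using exponent_mult[OF int_pow_closed[OF garside_closed] prod_closed[OF assms]]
    by (simp add: garside_expr_def exponent_pow)
qed

lemma braid_perm_mult:
  assumes "a \<in> carrier (G n)" "b \<in> carrier (G n)"
  shows "braid_perm (a \<otimes>\<^bsub>G n\<^esub> b) = braid_perm b \<circ> braid_perm a"
  using assms by (auto elim!: carrierE simp: mult_braid_of braid_perm_braid_of strand_end_append)

lemma braid_perm_one: "braid_perm \<one>\<^bsub>G n\<^esub> = id"
  using braid_perm_braid_of[of "[]" n] by (simp add: one_braid strand_end_Nil del: strand_end.simps)

lemma perm_braid_perm: "a \<in> carrier (G n) \<Longrightarrow> perm n (braid_perm a)"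
  by (erule carrierE) (simp add: braid_perm_braid_of perm_strand_end)

section \<open>Bounds for the Super Summit Set\<close>

lemma conjugates_closed: "b \<in> carrier (G n) \<Longrightarrow> y \<in> conjugates n b \<Longrightarrow> y \<in> carrier (G n)"
  by (auto simp: conjugates_def)

lemma conjugates_refl: "b \<in> carrier (G n) \<Longrightarrow> b \<in> conjugates n b"
  unfolding conjugates_def by (rule CollectI, rule exI[of _ "\<one>\<^bsub>G n\<^esub>"]) simp

lemma conjugates_trans:
  assumes "a \<in> carrier (G n)" "b \<in> conjugates n a" "c \<in> conjugates n b" shows "c \<in> conjugates n a"
proof -
  obtain g where g: "g \<in> carrier (G n)" "b = g \<otimes>\<^bsub>G n\<^esub> a \<otimes>\<^bsub>G n\<^esub> inv\<^bsub>G n\<^esub> g"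
    using assms by (auto simp: conjugates_def)
  obtain h where h: "h \<in> carrier (G n)" "c = h \<otimes>\<^bsub>G n\<^esub> b \<otimes>\<^bsub>G n\<^esub> inv\<^bsub>G n\<^esub> h"
    using assms by (auto simp: conjugates_def)
  have "c = (h \<otimes>\<^bsub>G n\<^esub> g) \<otimes>\<^bsub>G n\<^esub> a \<otimes>\<^bsub>G n\<^esub> inv\<^bsub>G n\<^esub> (h \<otimes>\<^bsub>G n\<^esub> g)"
    using g h assms(1) by (simp add: inv_mult_group m_assoc)
  then show ?thesis using g(1) h(1) by (auto simp: conjugates_def)
qed

lemma conjugates_swap:
  assumes "a \<in> carrier (G n)" "b \<in> carrier (G n)" shows "b \<otimes>\<^bsub>G n\<^esub> a \<in> conjugates n (a \<otimes>\<^bsub>G n\<^esub> b)"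
proof -
  have "b \<otimes>\<^bsub>G n\<^esub> a = b \<otimes>\<^bsub>G n\<^esub> (a \<otimes>\<^bsub>G n\<^esub> b) \<otimes>\<^bsub>G n\<^esub> inv\<^bsub>G n\<^esub> b"
    using assms by (simp add: m_assoc)
  then show ?thesis using assms(2) unfolding conjugates_def by blast
qed

lemma exponent_conjugate:
  "b \<in> carrier (G n) \<Longrightarrow> y \<in> conjugates n b \<Longrightarrow> exponent y = exponent b"
  by (auto simp: conjugates_def exponent_mult exponent_inv)

lemma fixed_point_conjugate:
  assumes b: "b \<in> carrier (G n)" and y: "y \<in> conjugates n b" and s: "s \<in> {1..n}" "braid_perm y s = s"
  shows "\<exists>t \<in> {1..n}. braid_perm b t = t"
proof -
  obtain g where g: "g \<in> carrier (G n)" "y = g \<otimes>\<^bsub>G n\<^esub> b \<otimes>\<^bsub>G n\<^esub> inv\<^bsub>G n\<^esub> g"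
    using y by (auto simp: conjugates_def)
  have "braid_perm g \<circ> braid_perm (inv\<^bsub>G n\<^esub> g) = id"
    using g(1) braid_perm_one by (simp flip: braid_perm_mult)
  moreover have "braid_perm (inv\<^bsub>G n\<^esub> g) (braid_perm b (braid_perm g s)) = s"
    using s(2) g b by (simp add: braid_perm_mult)
  ultimately have "braid_perm b (braid_perm g s) = braid_perm g s"
    by (metis comp_apply id_apply)
  moreover have "braid_perm g s \<in> {1..n}" using perm_range[OF perm_braid_perm[OF g(1)]] s(1) by simp
  ultimately show ?thesis by blast
qed

lemma exponent_garside_ge_2:
  assumes "3 \<le> n" shows "2 \<le> exponent (garside n)"
proof -
  let ?s = "transpose 1 (Suc 1)"
  have s: "perm n ?s" using assms by (intro perm_transpose) auto
  have "?s 1 \<noteq> id 1" "?s 1 \<noteq> delta n 1" using assms by (auto simp: delta_def)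
  then have "?s \<noteq> id" "?s \<noteq> delta n" by metis+
  then show ?thesis using exponent_simple_braid_pos[OF s] exponent_simple_braid_less[OF s] by simp
qed

text \<open>Let \<open>L \<ge> 2\<close> be the exponent sum of the Garside element. Each factor contributes between \<open>1\<close> and
  \<open>L - 1\<close>. A positive power of the Garside element makes the sum at least \<open>L\<close>. If the power is
  \<open>0\<close>, the braid is trivial or a generator, and both fix one of at least three strands. With a negative power, at most one
  factor leaves the sum negative.\<close>

lemma summit_bounds:
  assumes n: "3 \<le> n" and st: "(k, ps) \<in> states n"
    and y: "y = garside_expr n k (map (simple_braid n) ps)"
    and e: "exponent y \<in> {0, 1}" and no_fix: "\<And>s. s \<in> {1..n} \<Longrightarrow> braid_perm y s \<noteq> s"
  shows "k \<le> - 1" "2 \<le> length ps"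
proof -
  let ?L = "exponent (garside n)" and ?e = "\<lambda>p. exponent (simple_braid n p)"
  have ps: "\<forall>p\<in>set ps. perm n p \<and> p \<noteq> id \<and> p \<noteq> delta n"
    using st by (auto simp: states_def normal_def)
  have y_eq: "exponent y = k * ?L + (\<Sum>p\<leftarrow>ps. ?e p)"
    unfolding y using ps by (intro exponent_garside_expr) auto
  have lower: "int (length ps) \<le> (\<Sum>p\<leftarrow>ps. ?e p)"
    using ps
  proof (induction ps)
    case (Cons p ps)
    then have "perm n p" "p \<noteq> id" by auto
    from exponent_simple_braid_pos[OF this] show ?case using Cons by simp
  qed simp
  note L = exponent_garside_ge_2[OF n]
  have "k \<noteq> 0"
  proof
    assume k: "k = 0"
    consider "ps = []" | p where "ps = [p]" | "2 \<le> length ps"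
      by (cases ps rule: remdups_adj.cases) auto
    then show False
    proof cases
      case 1
      then have "braid_perm y 1 = 1"
        using braid_perm_one by (simp add: y k garside_expr_def braid_prod_simps)
      then show False using no_fix[of 1] n by simp
    next
      case 2
      then have p: "perm n p" "p \<noteq> id" using ps by auto
      then have y_p: "y = simple_braid n p"
        using 2 by (simp add: y k garside_expr_def braid_prod_simps)
      obtain w where w: "w \<in> braid_words n" "simple_word w" "strand_end w = p" "simple_braid n p = braid_of n w"
        by (rule simple_braidE[OF p(1)])
      have "length w \<le> 1" using e w by (auto simp: y_p exponent_braid_of word_exponent_simple_word)
      then obtain i f where wi: "w = [(i, f)]"
        using w(3) p(2) strand_end_Nil by (cases w) auto
      \<comment> \<open>A transposition of neighbours fixes one of any three strands.\<close>
      have "\<exists>s \<in> {1..3}. s \<noteq> i \<and> s \<noteq> Suc i"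
        by (cases "i = 1"; cases "i = 2") (auto intro: bexI[of _ 3] bexI[of _ 1])
      then obtain s where s: "s \<in> {1..3}" "s \<noteq> i" "s \<noteq> Suc i" by blast
      have "braid_perm y s = s" using braid_perm_simple_braid[OF p(1)] w(3) s by (auto simp: y_p wi)
      then show False using no_fix[of s] s(1) n by simp
    next
      case 3
      then show False using y_eq lower e k by auto
    qed
  qed
  moreover have "\<not> 1 \<le> k"
  proof
    assume "1 \<le> k"
    then have "?L \<le> k * ?L" using L by (simp add: mult_le_cancel_right1)
    moreover have "exponent y \<le> 1" using e by auto
    ultimately show False using y_eq lower L by linarith
  qed
  ultimately show k: "k \<le> - 1" by simp
  show "2 \<le> length ps"
  proof (rule ccontr)
    assume "\<not> 2 \<le> length ps"
    then consider "ps = []" | p where "ps = [p]"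
      by (cases ps rule: remdups_adj.cases) auto
    then have "(\<Sum>p\<leftarrow>ps. ?e p) < ?L"
      by cases (use ps exponent_simple_braid_less L in auto)
    moreover have "k * ?L \<le> - ?L" using k L mult_right_mono[of k "-1" ?L] by simp
    ultimately show False using y_eq e by auto
  qed
qed

section \<open>Rigid braids with two factors\<close>

text \<open>Cycling the normal form with power \<open>-1\<close> and factors \<open>[p, q]\<close> gives the factors \<open>[q, tau p]\<close>, then
  \<open>[tau p, tau q]\<close> and so on. As \<open>tau\<close> preserves left-weightedness, the first two steps decide about all.\<close>

definition rigid_pair :: "(nat \<Rightarrow> nat) \<Rightarrow> (nat \<Rightarrow> nat) \<Rightarrow> bool" where
  "rigid_pair p q \<longleftrightarrow> {p, q} \<subseteq> {r. perm n r} - {id, delta n} \<and> weighted n p q \<and> weighted n q (tau n p)"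

definition pair_braid :: "(nat \<Rightarrow> nat) \<Rightarrow> (nat \<Rightarrow> nat) \<Rightarrow> braid" where
  "pair_braid p q = garside_expr n (- 1) (map (simple_braid n) [p, q])"

lemma rigid_pair_state: "rigid_pair p q \<Longrightarrow> (- 1, [p, q]) \<in> states n"
  by (auto simp: rigid_pair_def states_def normal_def)

lemma rigid_pair_step:
  assumes "rigid_pair p q" shows "rigid_pair q (tau n p)"
proof -
  have p: "perm n p" "p \<noteq> id" "p \<noteq> delta n" and q: "perm n q" and w: "weighted n p q"
    using assms by (auto simp: rigid_pair_def)
  have "tau n p \<noteq> id" "tau n p \<noteq> delta n" using p(2,3) tau_tau tau_id tau_delta by metis+
  then show ?thesis
    using assms perm_tau[OF p(1)] weighted_tau[OF p(1) q w] by (auto simp: rigid_pair_def)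
qed

lemma pair_braid_normal_form:
  assumes "2 \<le> n" "rigid_pair p q"
  shows "garside_power n (pair_braid p q) = - 1"
    and "factors n (pair_braid p q) = [simple_braid n p, simple_braid n q]"
  using left_normal_form_eqI[OF assms(1) rigid_pair_state[OF assms(2)]]
  by (simp_all add: garside_power_def factors_def pair_braid_def)

lemma cycled_factors_pair:
  assumes "rigid_pair p q"
  shows "cycled_factors n (- 1) [simple_braid n p, simple_braid n q] = map (simple_braid n) [q, tau n p]"
proof -
  have p: "perm n p" using assms by (auto simp: rigid_pair_def)
  have "garside n [^]\<^bsub>G n\<^esub> (- 1 :: int) = inv\<^bsub>G n\<^esub> (garside n)"
    using int_pow_neg[of "garside n" 1] by simp
  then have "(garside n [^]\<^bsub>G n\<^esub> (- 1 :: int)) \<otimes>\<^bsub>G n\<^esub> simple_braid n p \<otimes>\<^bsub>G n\<^esub> (garside n [^]\<^bsub>G n\<^esub> (1 :: int)) =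
      inv\<^bsub>G n\<^esub> (garside n) \<otimes>\<^bsub>G n\<^esub> (simple_braid n p \<otimes>\<^bsub>G n\<^esub> garside n)"
    using p by (simp add: m_assoc)
  also have "\<dots> = simple_braid n (tau n p)"
    unfolding simple_braid_garside[OF p] using perm_tau[OF p] by (simp flip: m_assoc)
  finally show ?thesis by (simp add: cycled_factors_def)
qed

lemma pair_braid_rigid:
  assumes "2 \<le> n" "rigid_pair p q" shows "rigid n (pair_braid p q)"
proof -
  have "left_weighted n (map (simple_braid n) [q, tau n p])"
    using rigid_pair_state[OF rigid_pair_step[OF assms(2)]] normal_perm
    by (subst left_weighted_map) (auto simp: states_def)
  then show ?thesis
    using pair_braid_normal_form[OF assms] cycled_factors_pair[OF assms(2)] by (simp add: rigid_def)
qed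

lemma cycling_pair_braid:
  assumes "2 \<le> n" "rigid_pair p q" shows "cycling n (pair_braid p q) = pair_braid q (tau n p)"
  using pair_braid_normal_form[OF assms] cycled_factors_pair[OF assms(2)]
  by (simp add: cycling_def pair_braid_def)

text \<open>The factors run through \<open>[p, q]\<close>, \<open>[q, tau p]\<close>, \<open>[tau p, tau q]\<close>, \<open>[tau q, p]\<close>.\<close>

lemma cycling_period:
  assumes "2 \<le> n" "rigid_pair p q" shows "(cycling n ^^ 4) (pair_braid p q) = pair_braid p q"
proof -
  note r = assms(2) rigid_pair_step[OF assms(2)]
  note r' = r rigid_pair_step[OF r(2)]
  note r'' = r' rigid_pair_step[OF r'(3)]
  show ?thesis
    using cycling_pair_braid[OF assms(1)] r'' by (simp add: numeral_eq_Suc)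
qed

lemma pair_braid_in_ultra_summit_set:
  assumes n: "3 \<le> n" and pq: "rigid_pair p q" and b: "b \<in> carrier (G n)"
    and x: "pair_braid p q \<in> conjugates n b"
    and e: "exponent b \<in> {0, 1}" and no_fix: "\<And>s. s \<in> {1..n} \<Longrightarrow> braid_perm b s \<noteq> s"
  shows "pair_braid p q \<in> ultra_summit_set n b"
proof -
  have n2: "2 \<le> n" using n by simp
  have "garside_power n y \<le> - 1 \<and> 2 \<le> length (factors n y)" if y: "y \<in> conjugates n b" for y
  proof -
    obtain k ps where st: "(k, ps) \<in> states n" and yk: "y = garside_expr n k (map (simple_braid n) ps)"
      using normal_form_exists[OF conjugates_closed[OF b y]] .
    have "k \<le> - 1" "2 \<le> length ps"
      using summit_bounds[OF n st yk] exponent_conjugate[OF b y] e no_fix fixed_point_conjugate[OF b y] by metis+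
    then show ?thesis
      using left_normal_form_eqI[OF n2 st yk] by (simp add: garside_power_def factors_def)
  qed
  then have "pair_braid p q \<in> super_summit_set n b"
    using x pair_braid_normal_form[OF n2 pq] by (simp add: super_summit_set_def numeral_2_eq_2)
  then show ?thesis
    unfolding ultra_summit_set_def using cycling_period[OF n2 pq] by (intro CollectI conjI exI[of _ 4]) auto
qed

text \<open>With two strands the only permutation braids are the trivial one and the Garside element, whose powers
  are told apart by the exponent sum.\<close>

lemma ultra_summit_set_two_strands:
  assumes n: "n = 2" and b: "b \<in> carrier (G n)" and e: "exponent b = 1"
  shows "factors n b = []" "b \<in> ultra_summit_set n b"
proof -
  have form: "garside_power n y = 1 \<and> factors n y = []" if y: "y \<in> conjugates n b" for y
  proof -
    obtain k ps where st: "(k, ps) \<in> states n" and yk: "y = garside_expr n k (map (simple_braid n) ps)"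
      using normal_form_exists[OF conjugates_closed[OF b y]] .
    have ps: "\<forall>p\<in>set ps. perm n p \<and> p \<noteq> id \<and> p \<noteq> delta n"
      using st by (auto simp: states_def normal_def)
    have L: "exponent (garside n) = 1"
    proof -
      let ?s = "transpose 1 (Suc 1)"
      have "?s = delta n" by (auto simp: fun_eq_iff delta_def transpose_def n)
      then have "garside n = braid_of n [(1, True)]"
        using braid_of_letter(1)[of 1 n] by (simp add: garside_eq n)
      then show ?thesis using exponent_braid_of[of "[(1, True)]"] by (simp add: n word_exponent_def)
    qed
    have "ps = []"
    proof (cases ps)
      case (Cons p ps')
      then have "0 < exponent (simple_braid n p)" "exponent (simple_braid n p) < exponent (garside n)"
        using ps exponent_simple_braid_pos exponent_simple_braid_less by auto
      then show ?thesis using L by simp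
    qed
    then have "k = 1"
      using exponent_conjugate[OF b y] e L exponent_garside_expr[of ps k] yk by simp
    then show ?thesis
      using \<open>ps = []\<close> left_normal_form_eqI[OF _ st yk] n by (simp add: garside_power_def factors_def)
  qed
  note c = conjugates_refl[OF b]
  show f: "factors n b = []" using form[OF c] by simp
  have "b \<in> super_summit_set n b" using form c by (simp add: super_summit_set_def)
  then show "b \<in> ultra_summit_set n b"
    unfolding ultra_summit_set_def using f by (intro CollectI conjI exI[of _ 1]) (simp_all add: cycling_def One_nat_def)
qed

end

section \<open>Layered braids\<close>

text \<open>Carries labels of the positions along the strands of the braid.\<close>

fun arrange :: "(nat \<Rightarrow> 'a) \<Rightarrow> braid_word \<Rightarrow> nat \<Rightarrow> 'a" where
  "arrange g [] = g"
| "arrange g ((i, e) # w) = arrange (g \<circ> transpose i (Suc i)) w"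

lemma arrange_append: "arrange g (u @ v) = arrange (arrange g u) v"
  by (induction g u rule: arrange.induct) (auto simp: comp_def)

lemma arrange_strand_end: "arrange g w (strand_end w s) = g s"
  by (induction g w arbitrary: s rule: arrange.induct) auto

text \<open>The function \<open>h\<close> gives the height of the strand at each position. The strand that moves to the right has
  to be the upper one in positive crossings and the lower one in negative crossings.\<close>

fun layered :: "(nat \<Rightarrow> int) \<Rightarrow> braid_word \<Rightarrow> bool" where
  "layered h [] \<longleftrightarrow> True"
| "layered h ((i, e) # w) \<longleftrightarrow>
    (if e then h (Suc i) < h i else h i < h (Suc i)) \<and> layered (h \<circ> transpose i (Suc i)) w"

lemma layered_append: "layered h (u @ v) \<longleftrightarrow> layered h u \<and> layered (arrange h u) v"
  by (induction h u rule: layered.induct) (auto simp: comp_def)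

context
  fixes n :: nat
begin

interpretation group "braid_group n"
  by (rule group_braid_group)

text \<open>The permutation \<open>r\<close> ranks the strands from top to bottom, so \<open>pinv r\<close> takes the sorted strands to their
  starting points. Reading \<open>w\<close> after it, a positive letter crosses two strands that are still in sorted
  order, and a negative letter undoes a crossing of two strands that are not; at every stage the product
  is a permutation braid.\<close>

lemma sorted_layered_word:
  assumes "w \<in> braid_words n" "layered h w" "perm n r"
    and "\<And>i j. i \<in> {1..n} \<Longrightarrow> j \<in> {1..n} \<Longrightarrow> r i < r j \<longleftrightarrow> h j < h i"
  shows "simple_braid n (pinv r) \<otimes>\<^bsub>G n\<^esub> braid_of n w = simple_braid n (strand_end w \<circ> pinv r)"
  using assms
proof (induction w arbitrary: h r)
  case Nil
  have "simple_braid n (pinv r) \<in> carrier (G n)" using Nil by (intro simple_braid_closed perm_inv)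
  then show ?case by (simp only: strand_end_Nil id_comp r_one flip: one_braid)
next
  case (Cons l w)
  obtain i e where l: "l = (i, e)" by (cases l)
  let ?s = "transpose i (Suc i)"
  have i: "i \<in> {1..<n}" and w: "w \<in> braid_words n" and r: "perm n r" using Cons.prems by (auto simp: l)
  have s: "perm n ?s" using perm_transpose i .
  define r' where "r' = r \<circ> ?s"
  have r': "perm n r'" unfolding r'_def by (intro perm_comp s r)
  have inv_r': "pinv r' = ?s \<circ> pinv r"
    by (rule inv_unique_comp) (simp_all add: r'_def fun_eq_iff permutes_inverses[OF r])
  have order': "r' a < r' b \<longleftrightarrow> (h \<circ> ?s) b < (h \<circ> ?s) a" if "a \<in> {1..n}" "b \<in> {1..n}" for a b
    using Cons.prems(4)[of "?s a" "?s b"] perm_range[OF s, of a] perm_range[OF s, of b] that by (simp add: r'_def)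
  have lay': "layered (h \<circ> ?s) w" using Cons.prems(2) by (simp add: l comp_def)
  have IH: "simple_braid n (pinv r') \<otimes>\<^bsub>G n\<^esub> braid_of n w = simple_braid n (strand_end w \<circ> pinv r')"
    by (rule Cons.IH[OF w lay' r' order'])
  have c: "simple_braid n (pinv r) \<in> carrier (G n)" "simple_braid n (pinv r') \<in> carrier (G n)"
    "simple_braid n ?s \<in> carrier (G n)" using r r' s by (auto intro!: simple_braid_closed perm_inv)
  have add: "additive (pinv q) ?s" if q: "perm n q" and lt: "q i < q (Suc i)" for q
  proof -
    have "\<not> inverts (pinv q) a b" if "{pinv q a, pinv q b} = {i, Suc i}" for a b
    proof -
      have "a = q (pinv q a)" "b = q (pinv q b)" by (simp_all add: permutes_inverses[OF q])
      then show ?thesis using that lt by (auto simp: inverts_def doubleton_eq_iff)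
    qed
    then show ?thesis by (auto simp: additive_def inverts_transpose)
  qed
  have "simple_braid n (pinv r) \<otimes>\<^bsub>G n\<^esub> braid_of n [(i, e)] = simple_braid n (pinv r')"
  proof (cases e)
    case True
    then have "r i < r (Suc i)" using Cons.prems(2) Cons.prems(4)[of i "Suc i"] i by (simp add: l)
    then show ?thesis
      using True simple_braid_mult[OF perm_inv[OF r] s add[OF r]] braid_of_letter(1)[OF i] inv_r' by simp
  next
    case False
    then have "r (Suc i) < r i" using Cons.prems(2) Cons.prems(4)[of "Suc i" i] i by (simp add: l)
    then have lt: "r' i < r' (Suc i)" by (simp add: r'_def)
    have "?s \<circ> pinv r' = pinv r" by (simp add: inv_r' fun_eq_iff)
    then have "simple_braid n (pinv r) = simple_braid n (pinv r') \<otimes>\<^bsub>G n\<^esub> simple_braid n ?s"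
      using simple_braid_mult[OF perm_inv[OF r'] s add[OF r' lt]] by simp
    then show ?thesis using False c braid_of_letter[OF i] by (simp add: m_assoc)
  qed
  then have "simple_braid n (pinv r) \<otimes>\<^bsub>G n\<^esub> braid_of n (l # w) = simple_braid n (pinv r') \<otimes>\<^bsub>G n\<^esub> braid_of n w"
    using mult_braid_of[of "[(i, e)]" n w] i w c m_assoc[of "simple_braid n (pinv r)" "braid_of n [(i, e)]" "braid_of n w"]
    by (simp add: l)
  also have "\<dots> = simple_braid n (strand_end (l # w) \<circ> pinv r)"
    by (simp only: IH) (simp only: inv_r' l strand_end_Cons o_assoc)
  finally show ?case .
qed

text \<open>Let \<open>N\<close> be the permutation braid that takes the strands from their order by height to their starting
  points, and \<open>P\<close> the one that takes them to their end points. Then the braid is \<open>N\<inverse> P\<close> with factors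
  \<open>p = \<Delta> N\<inverse>\<close> and \<open>q = P\<close>. These are left-weighted if no two strands in neighbouring layers cross at
  the start of both \<open>N\<close> and \<open>P\<close>, which is \<open>adjacent\<close>. After a cycling, left-weightedness says that
  neighbouring positions are crossed at the end of \<open>N\<close> or of \<open>P\<close>, which is \<open>final\<close>. A rise and a fall of
  the heights keep \<open>N\<close>, and with it all factors, from being trivial or the Garside element.\<close>

lemma layered_normal_form:
  assumes w: "w \<in> braid_words n" and lay: "layered h w"
    and inj: "inj_on h {1..n}"
    and up: "a \<in> {1..n}" "b \<in> {1..n}" "a < b" "h a < h b"
    and down: "c \<in> {1..n}" "d \<in> {1..n}" "c < d" "h d < h c"
    and adjacent: "\<And>a b. a \<in> {1..n} \<Longrightarrow> b \<in> {1..n} \<Longrightarrow> b < a \<Longrightarrow> h b < h a \<Longrightarrow>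
      (\<And>c. c \<in> {1..n} \<Longrightarrow> h b < h c \<Longrightarrow> \<not> h c < h a) \<Longrightarrow> strand_end w a < strand_end w b"
    and final: "\<And>j. j \<in> {1..<n} \<Longrightarrow> h (Suc j) < h j \<Longrightarrow> arrange h w j < arrange h w (Suc j)"
  obtains p q where "rigid_pair n p q" "braid_of n w = pair_braid n p q"
proof -
  have total: "h j < h i \<or> h i < h j" if "i \<in> {1..n}" "j \<in> {1..n}" "i \<noteq> j" for i j
    using inj that by (metis inj_onD linorder_less_linear)
  obtain r where r: "perm n r" and r_less: "\<And>i j. i \<in> {1..n} \<Longrightarrow> j \<in> {1..n} \<Longrightarrow> r i < r j \<longleftrightarrow> h j < h i"
    by (rule perm_of_order[of "\<lambda>i j. h j < h i" n]) (use total in auto)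
  define f where "f = strand_end w"
  have f: "perm n f" unfolding f_def using perm_strand_end w .
  define p where "p = r \<circ> delta n"
  define q where "q = f \<circ> pinv r"
  have p: "perm n p" unfolding p_def by (intro perm_comp perm_delta r)
  have q: "perm n q" unfolding q_def by (intro perm_comp perm_inv r f)
  have delta_comp: "inverts (delta n \<circ> s) i j \<longleftrightarrow> \<not> inverts s i j"
    if "perm n s" "i \<in> {1..n}" "j \<in> {1..n}" "i \<noteq> j" for s i j
  proof -
    have "s i \<in> {1..n}" "s j \<in> {1..n}" using perm_range[OF that(1)] that by blast+
    moreover have "s i \<noteq> s j" using that(4) permutes_inj[OF that(1)] by (auto dest: injD)
    ultimately show ?thesis by (simp add: inverts_comp inverts_delta)
  qed
  have inv_p: "pinv p = delta n \<circ> pinv r"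
    by (rule inv_unique_comp) (simp_all add: p_def fun_eq_iff permutes_inverses[OF r])
  have inv_q: "pinv q = r \<circ> pinv f"
    by (rule inv_unique_comp) (simp_all add: q_def fun_eq_iff permutes_inverses[OF r] permutes_inverses[OF f])
  have tau_p: "tau n p = delta n \<circ> r" by (simp add: p_def tau_def fun_eq_iff)
  have r_inv: "r (pinv r x) = x" "pinv r (r x) = x" for x by (simp_all add: permutes_inverses[OF r])
  have rank: "pinv r j \<in> {1..n}" if "j \<in> {1..n}" for j using perm_range[OF perm_inv[OF r]] that by blast
  have pq: "weighted n p q"
    unfolding weighted_def
  proof (intro ballI impI)
    fix j assume j: "j \<in> {1..<n}" and "inverts q j (Suc j)"
    then have fj: "\<not> f (pinv r j) < f (pinv r (Suc j))" by (simp add: inverts_def q_def)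
    have jn: "j \<in> {1..n}" "Suc j \<in> {1..n}" using j by auto
    have "\<not> inverts (pinv r) j (Suc j)"
    proof
      assume "inverts (pinv r) j (Suc j)"
      then have lt: "pinv r (Suc j) < pinv r j"
        using permutes_inj[OF perm_inv[OF r]] n_not_Suc_n by (metis inverts_def injD lessI linorder_neqE_nat)
      have "h (pinv r (Suc j)) < h (pinv r j)"
        using r_less[OF rank[OF jn(1)] rank[OF jn(2)]] r_inv by simp
      moreover have "\<not> (h (pinv r (Suc j)) < h c \<and> h c < h (pinv r j))" if c: "c \<in> {1..n}" for c
        using r_less[OF rank[OF jn(1)] c] r_less[OF c rank[OF jn(2)]] r_inv by auto
      ultimately show False
        using adjacent[OF rank[OF jn(1)] rank[OF jn(2)] lt] fj unfolding f_def by blast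
    qed
    then show "inverts (pinv p) j (Suc j)"
      unfolding inv_p using delta_comp[OF perm_inv[OF r] jn] by simp
  qed
  have qp: "weighted n q (tau n p)"
    unfolding weighted_def
  proof (intro ballI impI)
    fix j assume j: "j \<in> {1..<n}" and inv: "inverts (tau n p) j (Suc j)"
    have jn: "j \<in> {1..n}" "Suc j \<in> {1..n}" using j by auto
    have "\<not> inverts r j (Suc j)" using inv delta_comp[OF r jn] by (simp add: tau_p)
    then have "h (Suc j) < h j" using r_less[OF jn] by (simp add: inverts_def)
    then have lt: "arrange h w j < arrange h w (Suc j)" using final j by blast
    have arr: "arrange h w x = h (pinv f x)" for x
      using arrange_strand_end[of h w "pinv f x"] by (simp add: permutes_inverses[OF f] flip: f_def)
    have "pinv f j \<in> {1..n}" "pinv f (Suc j) \<in> {1..n}" using perm_range[OF perm_inv[OF f]] jn by blast+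
    then have "r (pinv f (Suc j)) < r (pinv f j)" using lt r_less by (simp add: arr)
    then show "inverts (pinv q) j (Suc j)" by (simp add: inverts_def inv_q)
  qed
  have "p \<noteq> id"
  proof
    assume "p = id"
    then have "r (delta n x) = x" for x unfolding p_def by (metis comp_apply id_apply)
    then have "r x = delta n x" for x by (metis delta_delta)
    then have "r d < r c" using down by (simp add: delta_def)
    then show False using r_less[OF down(2,1)] down by simp
  qed
  moreover have "p \<noteq> delta n"
  proof
    assume "p = delta n"
    then have "r (delta n x) = delta n x" for x unfolding p_def by (metis comp_apply)
    then have "r x = x" for x by (metis delta_delta)
    then show False using r_less[OF up(1,2)] up by simp
  qed
  moreover have "q \<noteq> id"
  proof
    assume q_id: "q = id"
    have "tau n p = id" using weightedD[OF qp q perm_tau[OF p] perm_tau[OF p]] by (simp only: q_id additive_id weak_le_refl)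
    then show False using \<open>p \<noteq> id\<close> tau_tau tau_id by metis
  qed
  moreover have "q \<noteq> delta n" using weighted_delta[OF p] pq \<open>p \<noteq> delta n\<close> by metis
  ultimately have rigid: "rigid_pair n p q" using p q pq qp by (simp add: rigid_pair_def)
  have ri: "perm n (pinv r)" using perm_inv r .
  have "pinv r \<circ> p = delta n" by (simp add: p_def fun_eq_iff r_inv)
  then have g: "simple_braid n p \<otimes>\<^bsub>G n\<^esub> simple_braid n (pinv r) = garside n"
    using simple_braid_mult[OF p ri] additive_delta[OF p] by (simp add: garside_eq)
  have c: "simple_braid n p \<in> carrier (G n)" "simple_braid n q \<in> carrier (G n)" "simple_braid n (pinv r) \<in> carrier (G n)"
    "braid_of n w \<in> carrier (G n)" using p q ri w by auto
  have "simple_braid n p \<otimes>\<^bsub>G n\<^esub> simple_braid n q = garside n \<otimes>\<^bsub>G n\<^esub> braid_of n w"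
    using sorted_layered_word[OF w lay r r_less] c unfolding g[symmetric] by (simp add: q_def f_def m_assoc)
  moreover have "garside n [^]\<^bsub>G n\<^esub> (- 1 :: int) = inv\<^bsub>G n\<^esub> (garside n)"
    using int_pow_neg[of "garside n" 1] by simp
  ultimately have "pair_braid n p q = inv\<^bsub>G n\<^esub> (garside n) \<otimes>\<^bsub>G n\<^esub> (garside n \<otimes>\<^bsub>G n\<^esub> braid_of n w)"
    using c by (simp add: pair_braid_def garside_expr_def braid_prod_simps)
  also have "\<dots> = braid_of n w" using c by (simp flip: m_assoc)
  finally show ?thesis using that[OF rigid] by simp
qed

end

section \<open>Products of all generators\<close>

definition letter :: "nat \<Rightarrow> nat \<times> bool" where
  "letter i = (i, odd i)"

text \<open>The set \<open>F\<close> consists of those \<open>i\<close> for which generator \<open>2 i + 1\<close> comes before all smaller ones instead of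
  after them. Both choices for \<open>i = 0\<close> give the same word; with \<open>0 \<in> F\<close>, as below, the strand that
  starts at position \<open>1\<close> is treated like those that start at the other \<open>2 i + 1\<close> with \<open>i \<in> F\<close>.\<close>

fun alternating :: "nat set \<Rightarrow> nat \<Rightarrow> braid_word" where
  "alternating F 0 = []"
| "alternating F (Suc k) =
    (if even k \<and> k div 2 \<in> F then letter (Suc k) # alternating F k else alternating F k @ [letter (Suc k)])"

lemma set_alternating: "set (alternating F k) = letter ` {1..k}"
  by (induction k) (auto simp: atLeastAtMostSuc_conv)

lemma alternating_braid_words: "k < n \<Longrightarrow> alternating F k \<in> braid_words n"
  by (auto simp: braid_words_def set_alternating letter_def)

lemma alternating_0: "alternating {0} k = map letter [1..<Suc k]"
  by (induction k) (auto elim!: evenE simp: letter_def)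

context
  fixes n :: nat
begin

interpretation group "braid_group n"
  by (rule group_braid_group)

lemma word_commute:
  assumes "x \<in> carrier (G n)" "w \<in> braid_words n"
    and "\<And>i e. (i, e) \<in> set w \<Longrightarrow> x \<otimes>\<^bsub>G n\<^esub> braid_of n [(i, True)] = braid_of n [(i, True)] \<otimes>\<^bsub>G n\<^esub> x"
  shows "x \<otimes>\<^bsub>G n\<^esub> braid_of n w = braid_of n w \<otimes>\<^bsub>G n\<^esub> x"
  using assms(2,3)
proof (induction w)
  case Nil
  then show ?case using assms(1) by (simp flip: one_braid)
next
  case (Cons l w)
  obtain i e where l: "l = (i, e)" by (cases l)
  let ?a = "braid_of n [(i, True)]"
  have i: "i \<in> {1..<n}" and w: "w \<in> braid_words n" using Cons.prems by (auto simp: l)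
  have a: "?a \<in> carrier (G n)" and xa: "x \<otimes>\<^bsub>G n\<^esub> ?a = ?a \<otimes>\<^bsub>G n\<^esub> x"
    using i Cons.prems(2)[of i e] by (auto simp: l)
  have "x \<otimes>\<^bsub>G n\<^esub> braid_of n [(i, e)] = braid_of n [(i, e)] \<otimes>\<^bsub>G n\<^esub> x"
  proof (cases e)
    case False
    have "?a \<otimes>\<^bsub>G n\<^esub> (x \<otimes>\<^bsub>G n\<^esub> inv\<^bsub>G n\<^esub> ?a) = x"
      using a assms(1) xa[symmetric] by (simp add: m_assoc flip: m_assoc[of ?a x])
    then have "inv\<^bsub>G n\<^esub> ?a \<otimes>\<^bsub>G n\<^esub> x = x \<otimes>\<^bsub>G n\<^esub> inv\<^bsub>G n\<^esub> ?a"
      using a assms(1) by (metis inv_closed inv_solve_left m_closed)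
    then show ?thesis using False braid_of_letter(2)[OF i] by simp
  qed (use xa in simp)
  moreover have "x \<otimes>\<^bsub>G n\<^esub> braid_of n w = braid_of n w \<otimes>\<^bsub>G n\<^esub> x"
    using Cons.IH[OF w] Cons.prems(2) by auto
  moreover have "braid_of n (l # w) = braid_of n [(i, e)] \<otimes>\<^bsub>G n\<^esub> braid_of n w"
    using i w by (simp add: l mult_braid_of)
  ultimately show ?case
    using i w assms(1) braid_of_closed[of "[(i, e)]" n] braid_of_closed[OF w]
    by (metis braid_words_simps(1,2) m_assoc)
qed

lemma far_words_commute:
  assumes "u \<in> braid_words n" "v \<in> braid_words n"
    and "\<And>i d j e. (i, d) \<in> set u \<Longrightarrow> (j, e) \<in> set v \<Longrightarrow> i + 2 \<le> j"
  shows "braid_of n (u @ v) = braid_of n (v @ u)"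
proof -
  have "braid_of n u \<otimes>\<^bsub>G n\<^esub> braid_of n v = braid_of n v \<otimes>\<^bsub>G n\<^esub> braid_of n u"
  proof (rule word_commute)
    fix j e assume j: "(j, e) \<in> set v"
    have jn: "j \<in> {1..<n}" using j assms(2) by (auto simp: braid_words_def)
    have "braid_of n [(j, True)] \<otimes>\<^bsub>G n\<^esub> braid_of n u = braid_of n u \<otimes>\<^bsub>G n\<^esub> braid_of n [(j, True)]"
    proof (rule word_commute)
      fix i d assume i: "(i, d) \<in> set u"
      have in': "i \<in> {1..<n}" using i assms(1) by (auto simp: braid_words_def)
      have "([(i, True), (j, True)], [(j, True), (i, True)]) \<in> braid_cong n"
        using in' jn assms(3)[OF i j] by (rule braid_cong.far)
      then show "braid_of n [(j, True)] \<otimes>\<^bsub>G n\<^esub> braid_of n [(i, True)] =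
          braid_of n [(i, True)] \<otimes>\<^bsub>G n\<^esub> braid_of n [(j, True)]"
        using in' jn by (simp add: mult_braid_of braid_of_eq_iff braid_cong.sym)
    qed (use assms(1) jn in auto)
    then show "braid_of n u \<otimes>\<^bsub>G n\<^esub> braid_of n [(j, True)] = braid_of n [(j, True)] \<otimes>\<^bsub>G n\<^esub> braid_of n u"
      by simp
  qed (use assms in auto)
  then show ?thesis using assms by (simp add: mult_braid_of)
qed

text \<open>If generator \<open>k + 1\<close> comes first, the generators up to \<open>k\<close> can be moved to the end of the word past those
  from \<open>k + 2\<close> on, and then, by a conjugation, to its front.\<close>

lemma alternating_conjugate_step:
  "k < n \<Longrightarrow> braid_of n (alternating F k @ map letter [Suc k..<n]) \<in> conjugates n (braid_of n (map letter [1..<n]))"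
proof (induction k)
  case 0
  show ?case
  proof -
    have "map letter [1..<n] \<in> braid_words n" by (auto simp: braid_words_def letter_def)
    then show ?thesis using conjugates_refl[OF braid_of_closed] by (simp add: One_nat_def)
  qed
next
  case (Suc k)
  let ?W = "alternating F k" and ?l = "[letter (Suc k)]" and ?T = "map letter [Suc (Suc k)..<n]"
  let ?b = "braid_of n (map letter [1..<n])"
  have bw: "?W \<in> braid_words n" "?l \<in> braid_words n" "?T \<in> braid_words n" "map letter [1..<n] \<in> braid_words n"
    using Suc.prems alternating_braid_words[of k n F] by (auto simp: braid_words_def letter_def)
  have T: "map letter [Suc k..<n] = ?l @ ?T" using Suc.prems by (simp add: upt_conv_Cons)
  have IH: "braid_of n (?W @ ?l @ ?T) \<in> conjugates n ?b" using Suc T by simp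
  show ?case
  proof (cases "even k \<and> k div 2 \<in> F")
    case False
    then show ?thesis using IH by auto
  next
    case True
    have lT: "?l @ ?T \<in> braid_words n" using bw by (simp only: braid_words_simps)
    have comm: "braid_of n (?W @ ?T) = braid_of n (?T @ ?W)"
      by (rule far_words_commute[OF bw(1,3)]) (auto simp: set_alternating letter_def)
    have "braid_of n (?l @ ?W @ ?T) = braid_of n (?l @ ?T) \<otimes>\<^bsub>G n\<^esub> braid_of n ?W"
      using mult_braid_of[of ?l n "?W @ ?T"] mult_braid_of[of ?l n "?T @ ?W"] mult_braid_of[OF lT bw(1)] bw comm
      by simp
    also have "\<dots> \<in> conjugates n (braid_of n ?W \<otimes>\<^bsub>G n\<^esub> braid_of n (?l @ ?T))"
      using bw lT by (intro conjugates_swap braid_of_closed)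
    also have "braid_of n ?W \<otimes>\<^bsub>G n\<^esub> braid_of n (?l @ ?T) = braid_of n (?W @ ?l @ ?T)"
      using mult_braid_of[OF bw(1) lT] by simp
    finally have "braid_of n (?l @ ?W @ ?T) \<in> conjugates n ?b"
      using conjugates_trans[OF braid_of_closed[OF bw(4)] IH] by blast
    then show ?thesis using True by simp
  qed
qed

lemma alternating_conjugate:
  assumes "1 \<le> n"
  shows "braid_of n (alternating F (n - 1)) \<in> conjugates n (braid_of n (alternating {0} (n - 1)))"
  using alternating_conjugate_step[of "n - 1" F] assms alternating_0[of "n - 1"] by simp

lemma alpha_alternating:
  assumes "1 \<le> n" shows "alpha n = braid_of n (alternating {0} (n - 1))"
proof -
  have gen: "artin_gen n i [^]\<^bsub>G n\<^esub> ((- 1) ^ (i + 1) :: int) = braid_of n [letter i]"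
    if "i \<in> {1..<n}" for i
  proof -
    have c: "artin_gen n i \<in> carrier (G n)" using that by (simp add: artin_gen_def)
    have "artin_gen n i [^]\<^bsub>G n\<^esub> (- 1 :: int) = inv\<^bsub>G n\<^esub> (artin_gen n i)"
      using int_pow_neg[OF c, of 1] c by simp
    then show ?thesis using c braid_of_letter(2)[OF that] by (cases "odd i") (auto simp: letter_def artin_gen_def)
  qed
  have prod: "braid_prod n (map (\<lambda>i. artin_gen n i [^]\<^bsub>G n\<^esub> ((- 1) ^ (i + 1) :: int)) js) =
      braid_of n (map letter js) \<and> map letter js \<in> braid_words n" if "set js \<subseteq> {1..<n}" for js
    using that
  proof (induction js)
    case Nil
    show ?case by (simp add: braid_prod_simps one_braid)
  next
    case (Cons i js)
    then have "[letter i] \<in> braid_words n" by (simp add: letter_def)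
    moreover have "map letter js \<in> braid_words n" using Cons by simp
    moreover have "map letter (i # js) \<in> braid_words n"
      using calculation braid_words_simps(3)[of "[letter i]" "map letter js" n] by simp
    ultimately show ?case using Cons gen[of i] mult_braid_of[of "[letter i]" n "map letter js"]
      by (simp add: braid_prod_simps)
  qed
  show ?thesis
    unfolding alpha_def using prod[of "[1..<n]"] assms by (simp add: alternating_0)
qed

end

section \<open>The strands of the products\<close>

text \<open>The strand that \<open>alternating F k\<close> brings to position \<open>k + 1\<close>, for \<open>k \<ge> 1\<close>. The value at \<open>0\<close> is the strand
  that ends at position \<open>1\<close>, so that \<open>source\<close> needs no separate case for this position.\<close>

fun traveller :: "nat set \<Rightarrow> nat \<Rightarrow> nat" where
  "traveller F 0 = 2"
| "traveller F (Suc k) = (if even k \<and> k div 2 \<in> F then Suc k else traveller F k)"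

text \<open>The starting point of the strand of \<open>alternating F k\<close> that ends at \<open>p\<close> (\<open>arrange_alternating\<close>).\<close>

definition source :: "nat set \<Rightarrow> nat \<Rightarrow> nat \<Rightarrow> nat" where
  "source F k p =
    (if Suc k < p then p
     else if p = Suc k then traveller F k
     else if odd p then (if p div 2 \<in> F then traveller F (p - 1) else Suc p)
     else (if p div 2 \<in> F \<and> p < k then p + 2 else Suc p))"

lemma traveller:
  assumes "0 \<in> F" "1 \<le> k"
  shows "odd (traveller F k)" "traveller F k \<le> k" "traveller F k div 2 \<in> F" "1 \<le> traveller F k"
    and traveller_greatest: "\<And>p. odd p \<Longrightarrow> p div 2 \<in> F \<Longrightarrow> p \<le> k \<Longrightarrow> p \<le> traveller F k"
proof -
  have "odd (traveller F k) \<and> traveller F k \<le> k \<and> traveller F k div 2 \<in> F \<and>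
      (\<forall>p. odd p \<longrightarrow> p div 2 \<in> F \<longrightarrow> p \<le> k \<longrightarrow> p \<le> traveller F k)"
    using assms(2)
  proof (induction k rule: dec_induct)
    case base
    show ?case using assms(1) by (auto simp: One_nat_def elim!: oddE)
  next
    case (step k)
    then show ?case by (auto simp: le_Suc_eq)
  qed
  then show "odd (traveller F k)" "traveller F k \<le> k" "traveller F k div 2 \<in> F" "1 \<le> traveller F k"
    "\<And>p. odd p \<Longrightarrow> p div 2 \<in> F \<Longrightarrow> p \<le> k \<Longrightarrow> p \<le> traveller F k"
    by (auto elim!: oddE)
qed

lemma arrange_alternating:
  assumes "0 \<in> F" "1 \<le> k" "1 \<le> p"
  shows "arrange g (alternating F k) p = g (source F k p)"
  using assms(2,3)
proof (induction k arbitrary: g p rule: dec_induct)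
  case base
  then consider "p = 1" | "p = 2" | "2 < p" by linarith
  then show ?case
    using assms(1) by cases (auto simp: One_nat_def numeral_2_eq_2 letter_def source_def transpose_def)
next
  case (step k)
  note t = traveller[OF assms(1) step.hyps(1)]
  show ?case
  proof (cases "even k \<and> k div 2 \<in> F")
    case True
    then have "2 \<le> k" using step.hyps by (auto elim!: evenE)
    have "arrange g (alternating F (Suc k)) p = g (transpose (Suc k) (Suc (Suc k)) (source F k p))"
      using True step by (simp add: letter_def)
    also have "transpose (Suc k) (Suc (Suc k)) (source F k p) = source F (Suc k) p"
    proof -
      consider "p < k" | "p = k" | "p = Suc k" | "p = Suc (Suc k)" | "Suc (Suc k) < p" by linarith
      then show ?thesis
      proof cases
        case 1
        have "source F k p \<le> k"
        proof (cases "p = 1")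
          case True
          then show ?thesis using 1 \<open>2 \<le> k\<close> by (simp add: source_def)
        next
          case False
          then have "1 \<le> p - 1" using step.prems by simp
          then have "traveller F (p - 1) \<le> p - 1" using traveller(2)[OF assms(1)] by blast
          moreover have "p + 2 \<le> k" if "even p" using 1 that True by (auto elim!: evenE)
          ultimately show ?thesis using 1 by (auto simp: source_def)
        qed
        moreover have "source F (Suc k) p = source F k p" using 1 by (simp add: source_def)
        ultimately show ?thesis by (simp add: transpose_def)
      next
        case 2
        then show ?thesis using True by (simp add: source_def transpose_def)
      next
        case 3
        then show ?thesis using True t(2) by (simp add: source_def transpose_def)
      next
        case 4
        then show ?thesis using True by (simp add: source_def transpose_def)
      next
        case 5
        then show ?thesis by (simp add: source_def transpose_def)
      qed
    qed
    finally show ?thesis .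
  next
    case False
    have "arrange g (alternating F (Suc k)) p =
        arrange g (alternating F k) (transpose (Suc k) (Suc (Suc k)) p)"
      using False by (auto simp: letter_def arrange_append)
    also have "\<dots> = g (source F k (transpose (Suc k) (Suc (Suc k)) p))"
      by (rule step.IH) (use step.prems in \<open>auto simp: transpose_def\<close>)
    also have "source F k (transpose (Suc k) (Suc (Suc k)) p) = source F (Suc k) p"
    proof -
      consider "p < k" | "p = k" | "p = Suc k" | "p = Suc (Suc k)" | "Suc (Suc k) < p" by linarith
      then show ?thesis
        using False by cases (auto simp: source_def transpose_def)
    qed
    finally show ?thesis .
  qed
qed

section \<open>Heights of the strands\<close>

text \<open>Generator \<open>2 i + 1\<close> carries the travelling strand over strand \<open>2 i + 2\<close>, and generator \<open>2 i + 2\<close> carries it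
  below the strand at position \<open>2 i + 3\<close>. For \<open>i \<in> F\<close>, a new traveller starts at \<open>2 i + 1\<close>, and the
  previous one runs below strand \<open>2 i + 2\<close>. The travellers are therefore stacked in the order of their
  starting points, each with its strand \<open>2 i + 2\<close> just below it. The other odd strands lie above and the
  other even strands below all of these; within the two groups a strand is above those to its right, as
  strands in neighbouring layers that do not cross must be.\<close>

definition height :: "nat \<Rightarrow> nat set \<Rightarrow> nat \<Rightarrow> int" where
  "height n F p =
    (if (p - 1) div 2 \<in> F then (if odd p then int p + 1 else int p - 1)
     else (if odd p then 3 * int n - int p else - int p))"

text \<open>If the word is read after generator \<open>k + 1\<close>, for even \<open>k\<close>, then position \<open>k + 1\<close> carries strand \<open>k + 2\<close>.
  Therefore the height there is only required to exceed those of all travellers met so far.\<close>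

lemma layered_alternating:
  assumes "0 \<in> F"
  shows "k < n \<Longrightarrow> (\<And>p. 1 \<le> p \<Longrightarrow> p \<le> k \<Longrightarrow> g p = height n F p) \<Longrightarrow>
    (if odd k then g (Suc k) = height n F (Suc k) else int k < g (Suc k)) \<Longrightarrow>
    layered g (alternating F k)"
proof (induction k arbitrary: g)
  case (Suc k)
  have tk: "g (traveller F k) = int (traveller F k) + 1" "traveller F k \<le> k" if "1 \<le> k"
    using traveller[OF assms that] Suc.prems(2)[of "traveller F k"]
    by (auto simp: height_def elim!: oddE)
  show ?case
  proof (cases "even k")
    case True
    then have g1: "g (Suc k) = height n F (Suc k)" and g2: "g (Suc (Suc k)) = height n F (Suc (Suc k))"
      using Suc.prems by auto
    show ?thesis
    proof (cases "k div 2 \<in> F")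
      case F: True
      have "Suc k div 2 \<in> F" using F True by (auto elim!: evenE)
      then have "g (Suc k) = int k + 2" "g (Suc (Suc k)) = int k + 1"
        using g1 g2 True F by (simp_all add: height_def)
      moreover have "layered (g \<circ> transpose (Suc k) (Suc (Suc k))) (alternating F k)"
        using calculation True Suc.prems by (intro Suc.IH) (auto simp: transpose_def)
      ultimately show ?thesis using True F by (simp add: letter_def)
    next
      case F: False
      then have k: "1 \<le> k" using assms by (cases k) auto
      have "Suc k div 2 \<notin> F" using F True by (auto elim!: evenE)
      then have g12: "g (Suc k) = 3 * int n - int (Suc k)" "g (Suc (Suc k)) = - int (Suc (Suc k))"
        using g1 g2 True F by (simp_all add: height_def)
      have "layered g (alternating F k)"
        using True g12 Suc.prems by (intro Suc.IH) auto
      moreover have "arrange g (alternating F k) (Suc k) = g (traveller F k)"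
        "arrange g (alternating F k) (Suc (Suc k)) = g (Suc (Suc k))"
        using arrange_alternating[OF assms k, of "Suc k" g] arrange_alternating[OF assms k, of "Suc (Suc k)" g]
        by (simp_all add: source_def)
      ultimately show ?thesis using True F tk[OF k] g12 by (simp add: letter_def layered_append)
    qed
  next
    case False
    then have k: "1 \<le> k" by (cases k) auto
    have "layered g (alternating F k)"
      using False Suc.prems by (intro Suc.IH) auto
    moreover have "arrange g (alternating F k) (Suc k) = g (traveller F k)"
      "arrange g (alternating F k) (Suc (Suc k)) = g (Suc (Suc k))"
      using arrange_alternating[OF assms k, of "Suc k" g] arrange_alternating[OF assms k, of "Suc (Suc k)" g]
        by (simp_all add: source_def)
    ultimately show ?thesis using False tk[OF k] Suc.prems(3) by (simp add: letter_def layered_append)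
  qed
qed simp

lemma height_odd_in: "odd p \<Longrightarrow> p div 2 \<in> F \<Longrightarrow> height n F p = int p + 1"
  and height_odd_notin: "odd p \<Longrightarrow> p div 2 \<notin> F \<Longrightarrow> height n F p = 3 * int n - int p"
  and height_even_in: "even p \<Longrightarrow> (p - 1) div 2 \<in> F \<Longrightarrow> height n F p = int p - 1"
  and height_even_notin: "even p \<Longrightarrow> (p - 1) div 2 \<notin> F \<Longrightarrow> height n F p = - int p"
  by (auto simp: height_def elim!: oddE)

lemma height_cases:
  assumes "p \<in> {1..n}"
  obtains (over) "odd p" "p div 2 \<notin> F" "height n F p = 3 * int n - int p"
    | (carrier) "odd p" "p div 2 \<in> F" "height n F p = int p + 1"
    | (first) "even p" "2 \<le> p" "odd (p - 1)" "(p - 1) div 2 \<in> F" "height n F p = int p - 1"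
    | (under) "even p" "(p - 1) div 2 \<notin> F" "height n F p = - int p"
proof (cases "odd p")
  case True
  then show ?thesis using over carrier height_odd_in height_odd_notin by blast
next
  case False
  then have "2 \<le> p" "odd (p - 1)" using assms by (auto elim!: evenE)
  then show ?thesis using False first under height_even_in height_even_notin by blast
qed

lemma inj_on_height: "inj_on (height n F) {1..n}"
proof (rule inj_on_inverseI)
  fix p assume p: "p \<in> {1..n}"
  \<comment> \<open>The four groups of strands have heights in disjoint sets, from which the strand can be read off.\<close>
  let ?decode = "\<lambda>v :: int. nat (if v < 0 then - v else if 2 * int n \<le> v then 3 * int n - v
    else if odd v then v + 1 else v - 1)"
  from p show "?decode (height n F p) = p"
  proof (cases rule: height_cases[of p n F])
    case over
    then show ?thesis using p by simp
  next
    case carrier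
    have "n = p" if "2 * int n \<le> int p + 1" using that p by simp
    then show ?thesis using carrier p by auto
  next
    case first
    have "odd (int p - 1)" using first by simp
    then show ?thesis using first p by auto
  next
    case under
    then show ?thesis using p by simp
  qed
qed

context
  fixes n :: nat and F :: "nat set"
  assumes n: "3 \<le> n" and F0: "0 \<in> F" and F: "F \<subseteq> {..(n - 2) div 2}"
begin

abbreviation flipped_word where "flipped_word \<equiv> alternating F (n - 1)"

abbreviation flipped_height where "flipped_height \<equiv> height n F"

lemma flip_bound:
  assumes "i \<in> F" shows "2 * i + 2 \<le> n"
proof -
  have "i \<le> (n - 2) div 2" using F assms by blast
  then show ?thesis using n by linarith
qed

lemma arrange_final:
  assumes "p \<in> {1..n}" shows "arrange g flipped_word p = g (source F (n - 1) p)"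
  using arrange_alternating[OF F0, of "n - 1" p g] assms n by simp

lemma strand_end_source:
  assumes "p \<in> {1..n}" shows "strand_end flipped_word (source F (n - 1) p) = p"
proof -
  have bw: "flipped_word \<in> braid_words n" using n by (intro alternating_braid_words) auto
  have "pinv (strand_end flipped_word) p = source F (n - 1) p"
    using arrange_final[OF assms, of id] arrange_strand_end[of id flipped_word "pinv (strand_end flipped_word) p"]
      permutes_inverses[OF perm_strand_end[OF bw]] by simp
  then show ?thesis using permutes_inverses[OF perm_strand_end[OF bw]] by metis
qed

text \<open>Going down through the layers, the starting points can only decrease in two kinds of places: from the
  last of the upper odd strands to the last traveller, and from the companion \<open>2 i + 2\<close> of a traveller
  \<open>2 i + 1\<close> to the previous traveller. There the two strands cross.\<close>

lemma adjacent_layers_cross: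
  assumes a: "a \<in> {1..n}" and b: "b \<in> {1..n}" and ba: "b < a" and hba: "flipped_height b < flipped_height a"
    and between: "\<And>c. c \<in> {1..n} \<Longrightarrow> flipped_height b < flipped_height c \<Longrightarrow> \<not> flipped_height c < flipped_height a"
  shows "strand_end flipped_word a < strand_end flipped_word b"
proof -
  have bn: "b \<le> n" "1 \<le> b" "a \<le> n" "1 \<le> a" using a b by auto
  have bw: "flipped_word \<in> braid_words n" using n by (intro alternating_braid_words) auto
  note perm = perm_strand_end[OF bw]
  from a show ?thesis
  proof (cases rule: height_cases[of a n F])
    case over
    define t where "t = traveller F (n - 1)"
    have n1: "1 \<le> n - 1" using n by simp
    note t = traveller[OF F0 n1, folded t_def]
    have tn: "t \<in> {1..n}" using t by auto
    have ht: "flipped_height t = int t + 1" using height_odd_in t by blast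
    have "flipped_height t < flipped_height a" using over t(2) bn n by (simp add: ht)
    then have hb: "flipped_height t \<le> flipped_height b" using between[OF tn] by force
    have "b = t"
      using b
    proof (cases rule: height_cases[of b n F])
      case over': over
      then show ?thesis using hba over ba by simp
    next
      case carrier
      then have "b \<le> t" using t(5)[of b] ba bn by simp
      then show ?thesis using carrier hb by (simp add: ht)
    next
      case first
      then have "b - 1 \<le> t" using t(5)[of "b - 1"] bn by simp
      then show ?thesis using first hb by (simp add: ht)
    next
      case under
      then show ?thesis using hb by (simp add: ht)
    qed
    moreover have "source F (n - 1) n = t" using n by (simp add: source_def t_def)
    ultimately have "strand_end flipped_word b = n" using strand_end_source[of n] n by simp
    moreover have "strand_end flipped_word a \<in> {1..n}" using perm_range[OF perm] a by blast
    moreover have "strand_end flipped_word a \<noteq> strand_end flipped_word b"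
      using permutes_inj[OF perm] ba by (metis injD less_irrefl)
    ultimately show ?thesis by auto
  next
    case carrier
    have "2 * (a div 2) + 2 \<le> n" using flip_bound[OF carrier(2)] .
    then have a1: "Suc a \<in> {1..n}" using carrier(1) by (auto elim!: oddE)
    have "flipped_height (Suc a) = int a"
      using carrier height_even_in[of "Suc a" F n] by simp
    then have "int a \<le> flipped_height b" using between[OF a1] carrier(3) by force
    moreover from b have "flipped_height b < int a"
    proof (cases rule: height_cases[of b n F])
      case over
      then show ?thesis using hba carrier bn n by simp
    next
      case carrier': carrier
      have "b + 1 \<noteq> a" using carrier'(1) carrier(1) by auto
      then show ?thesis using carrier' ba by simp
    qed (use ba in auto)
    ultimately show ?thesis by simp
  next
    case first
    define k where "k = a - 2"
    obtain c where c: "a = 2 * c + 2"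
    proof -
      have "a = 2 * ((a - 2) div 2) + 2" using first(1,2) by presburger
      then show ?thesis by (rule that)
    qed
    have "c \<in> F" using first(4) by (simp add: c)
    then have ak: "a = k + 2" "even k" "k div 2 \<in> F" "odd (k + 1)" "(k + 1) div 2 \<in> F"
      by (simp_all add: k_def c)
    show ?thesis
    proof (cases "k = 0")
      case True
      then have "b = 1" using ba bn ak by simp
      then show ?thesis using hba ak True height_odd_in[of 1 F n] first F0 by simp
    next
      case False
      then have k1: "1 \<le> k" by simp
      define t where "t = traveller F k"
      note t = traveller[OF F0 k1, folded t_def]
      have tn: "t \<in> {1..n}" using t ak bn by auto
      have ht: "flipped_height t = int t + 1" using height_odd_in t by blast
      have "t \<noteq> k" using t(1) ak(2) by blast
      then have "flipped_height t < flipped_height a" using first ak t(2) by (simp add: ht)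
      then have hb: "flipped_height t \<le> flipped_height b" using between[OF tn] by force
      have "b = t"
        using b
      proof (cases rule: height_cases[of b n F])
        case over
        then show ?thesis using hba first bn n by simp
      next
        case carrier
        then have "b \<le> t" using t(5)[of b] hba first ak by simp
        then show ?thesis using carrier hb by (simp add: ht)
      next
        case first': first
        have "b \<noteq> k + 1" using first'(1) ak(4) by blast
        then have "b - 1 \<le> t" using t(5)[of "b - 1"] first' ba ak by simp
        then show ?thesis using first' hb by (simp add: ht)
      next
        case under
        then show ?thesis using hb by (simp add: ht)
      qed
      have "source F (n - 1) (k + 1) = t"
        using ak bn n by (simp add: source_def t_def)
      then have "strand_end flipped_word b = k + 1"
        using strand_end_source[of "k + 1"] ak bn \<open>b = t\<close> by simp
      moreover have "source F (n - 1) k = a" using ak bn n by (simp add: source_def)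
      then have "strand_end flipped_word a = k" using strand_end_source[of k] k1 ak bn by simp
      ultimately show ?thesis by simp
    qed
  next
    case under
    from b show ?thesis
      by (cases rule: height_cases[of b n F]) (use under hba ba bn in auto)
  qed
qed

text \<open>A fall of the heights at the starting points \<open>j\<close> and \<open>j + 1\<close> occurs only for odd \<open>j\<close>, when generator \<open>j\<close> is
  positive. For these the heights of the strands ending at \<open>j\<close> and \<open>j + 1\<close> rise.\<close>

lemma final_layers:
  assumes j: "j \<in> {1..<n}" and desc: "flipped_height (Suc j) < flipped_height j"
  shows "arrange flipped_height flipped_word j < arrange flipped_height flipped_word (Suc j)"
proof -
  have jn: "1 \<le> j" "j < n" using j by auto
  have odd: "odd j"
  proof (rule ccontr)
    assume even: "\<not> odd j"
    have "int j + 2 \<le> flipped_height (Suc j)"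
      using even jn height_odd_in[of "Suc j" F n] height_odd_notin[of "Suc j" F n] n
      by (cases "Suc j div 2 \<in> F") auto
    moreover have "flipped_height j < int j"
      using even jn height_even_in[of j F n] height_even_notin[of j F n]
      by (cases "(j - 1) div 2 \<in> F") auto
    ultimately show False using desc by simp
  qed
  have left: "flipped_height (source F (n - 1) j) = (if j = 1 then 1 else if j div 2 \<in> F then int (traveller F (j - 1)) + 1 else - int (Suc j))"
  proof -
    consider "j = 1" | "j \<noteq> 1" "j div 2 \<in> F" | "j \<noteq> 1" "j div 2 \<notin> F" by blast
    then show ?thesis
    proof cases
      case 1
      then show ?thesis using jn n F0 height_even_in[of 2 F n] by (simp add: source_def One_nat_def)
    next
      case 2
      then have "1 \<le> j - 1" using jn by simp
      note t = traveller[OF F0 this]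
      show ?thesis using 2 jn odd height_odd_in[OF t(1,3)] by (simp add: source_def)
    next
      case 3
      then show ?thesis using jn odd height_even_notin[of "Suc j" F n] by (simp add: source_def)
    qed
  qed
  have "flipped_height (source F (n - 1) j) < flipped_height (source F (n - 1) (Suc j))"
  proof -
    have upper: "flipped_height (source F (n - 1) j) \<le> int j"
    proof (cases "j = 1 \<or> j div 2 \<notin> F")
      case True
      then show ?thesis using left by auto
    next
      case False
      then have "j \<noteq> 1" by simp
      then have "1 \<le> j - 1" using jn by linarith
      note t = traveller[OF F0 this]
      then show ?thesis using left False by simp
    qed
    consider "Suc j = n" | "Suc j < n" "Suc j div 2 \<in> F" | "Suc j < n" "Suc j div 2 \<notin> F" using jn by linarith
    then show ?thesis
    proof cases
      case 1
      have "1 \<le> n - 1" using n by simp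
      note t = traveller[OF F0 this]
      have right: "flipped_height (source F (n - 1) (Suc j)) = int (traveller F (n - 1)) + 1"
        using 1 height_odd_in[OF t(1,3)] by (simp add: source_def)
      show ?thesis
      proof (cases "j div 2 \<in> F")
        case True
        then have "j \<le> traveller F (n - 1)" using t(5)[of j] odd 1 by simp
        then show ?thesis using upper right by simp
      next
        case False
        then have "j \<noteq> 1" using F0 by auto
        then show ?thesis using left right False by simp
      qed
    next
      case 2
      have "2 * (Suc j div 2) + 2 \<le> n" using flip_bound 2 by blast
      then have "j + 3 \<le> n" using odd by (auto elim!: oddE)
      then have "Suc j < n - 1" by linarith
      then have "source F (n - 1) (Suc j) = Suc j + 2" using 2 odd by (simp add: source_def)
      moreover have "(Suc j + 2 - 1) div 2 \<in> F" using 2 odd by (auto elim!: oddE)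
      ultimately have "flipped_height (source F (n - 1) (Suc j)) = int j + 2"
        using odd height_even_in[of "Suc j + 2" F n] by simp
      then show ?thesis using upper by simp
    next
      case 3
      have "Suc (Suc j) div 2 \<notin> F" using 3 odd by (auto elim!: oddE)
      then have "flipped_height (source F (n - 1) (Suc j)) = 3 * int n - int (Suc (Suc j))"
        using 3 odd height_odd_notin[of "Suc (Suc j)" F n] by (simp add: source_def)
      then show ?thesis using upper 3 by simp
    qed
  qed
  then show ?thesis using jn by (simp add: arrange_final)
qed

lemma alternating_normal_form:
  obtains p q where "rigid_pair n p q" "braid_of n flipped_word = pair_braid n p q"
proof -
  have bw: "flipped_word \<in> braid_words n" using n by (intro alternating_braid_words) auto
  have lay: "layered flipped_height flipped_word"
  proof (rule layered_alternating[OF F0])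
    show "if odd (n - 1) then flipped_height (Suc (n - 1)) = flipped_height (Suc (n - 1)) else int (n - 1) < flipped_height (Suc (n - 1))"
      using n height_odd_in[of n F n] height_odd_notin[of n F n]
      by (cases "n div 2 \<in> F") auto
  qed (use n in auto)
  have up: "flipped_height 2 < flipped_height 3"
    using F0 n height_even_in[of 2 F n] height_odd_in[of 3 F n] height_odd_notin[of 3 F n]
    by (cases "(3 :: nat) div 2 \<in> F") (auto simp: One_nat_def)
  have down: "flipped_height 2 < flipped_height 1"
    using F0 height_even_in[of 2 F n] height_odd_in[of 1 F n] by (simp add: One_nat_def)
  show thesis
    by (rule layered_normal_form[OF bw lay inj_on_height _ _ _ up _ _ _ down adjacent_layers_cross final_layers that])
      (use n in auto)
qed

lemma flip_iff_strand_end: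
  assumes "1 \<le> i" "i \<le> (n - 2) div 2"
  shows "i \<in> F \<longleftrightarrow> strand_end flipped_word (2 * i + 2) = 2 * i"
proof -
  have "2 * i + 2 \<le> n" using assms n by auto
  then have i: "2 * i \<in> {1..n}" "2 * i < n - 1" using assms by auto
  have bw: "flipped_word \<in> braid_words n" using n by (intro alternating_braid_words) auto
  have "source F (n - 1) (2 * i) = (if i \<in> F then 2 * i + 2 else 2 * i + 1)"
  proof -
    have "2 * i \<noteq> n" "\<not> n < 2 * i" using i by auto
    then show ?thesis using i n by (simp add: source_def)
  qed
  then have s: "strand_end flipped_word (if i \<in> F then 2 * i + 2 else 2 * i + 1) = 2 * i"
    using strand_end_source[OF i(1)] by metis
  have "strand_end flipped_word (2 * i + 2) \<noteq> strand_end flipped_word (2 * i + 1)"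
    unfolding inj_eq[OF permutes_inj[OF perm_strand_end[OF bw]]] by simp
  with s show ?thesis by (cases "i \<in> F") auto
qed

end

lemma exponent_alternating: "word_exponent (alternating F k) = (if odd k then 1 else 0)"
  by (induction k) (auto simp: word_exponent_def letter_def)

lemma no_fixed_point_alternating_0:
  assumes "3 \<le> n" "s \<in> {1..n}" shows "strand_end (alternating {0} (n - 1)) s \<noteq> s"
proof
  assume fix_s: "strand_end (alternating {0} (n - 1)) s = s"
  have "1 \<le> n - 1" "1 \<le> s" using assms by auto
  then have "arrange id (alternating {0} (n - 1)) s = source {0} (n - 1) s"
    using arrange_alternating[of "{0}" "n - 1" s id] by simp
  then have eq: "source {0} (n - 1) s = s"
    using arrange_strand_end[of id "alternating {0} (n - 1)" s] by (simp add: fix_s)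
  have t: "traveller {0} k = 1" if "1 \<le> k" for k
    using that by (induction k rule: dec_induct) (auto simp: One_nat_def)
  have half: "s div 2 = 0 \<Longrightarrow> s = 1" using \<open>1 \<le> s\<close> by auto
  have "traveller {0} (n - 1) = 1" using t \<open>1 \<le> n - 1\<close> by blast
  then show False
    using eq assms half
    by (cases "s = 1") (auto simp: source_def One_nat_def split: if_splits)
qed

section \<open>Elements of the Ultra Summit Set\<close>

theorem theorem1:
  fixes n :: nat
  assumes "n \<ge> 2"
  shows "rigid n (alpha n) \<and>
    (\<exists>S \<subseteq> ultra_summit_set n (alpha n). finite S \<and> card S = 2 ^ ((n - 2) div 2))"
proof -
  have alpha: "alpha n = braid_of n (alternating {0} (n - 1))"
    using alpha_alternating assms by simp
  have bw: "alternating F (n - 1) \<in> braid_words n" for F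
    using assms by (intro alternating_braid_words) auto
  have closed: "alpha n \<in> carrier (G n)" using alpha bw by simp
  have exponent: "exponent (alpha n) = (if odd (n - 1) then 1 else 0)"
    by (simp add: alpha exponent_braid_of[OF bw] exponent_alternating)
  show ?thesis
  proof (cases "n = 2")
    case True
    \<comment> \<open>Here the braid is the Garside element, and its normal form has no factors.\<close>
    have "exponent (alpha n) = 1" using exponent True by simp
    note two = ultra_summit_set_two_strands[OF True closed this]
    have "{alpha n} \<subseteq> ultra_summit_set n (alpha n)" using two(2) by simp
    moreover have "card {alpha n} = 2 ^ ((n - 2) div 2)" using True by simp
    ultimately show ?thesis using two(1) by (auto simp: rigid_def)
  next
    case False
    then have n: "3 \<le> n" using assms by simp
    define m where "m = (n - 2) div 2"
    define B where "B A = braid_of n (alternating (insert 0 A) (n - 1))" for A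
    have F: "insert 0 A \<subseteq> {..(n - 2) div 2}" if "A \<subseteq> {1..m}" for A using that by (auto simp: m_def)
    have alpha_B: "alpha n = B {}" by (simp add: B_def alpha)
    have normal_form: "\<exists>p q. rigid_pair n p q \<and> B A = pair_braid n p q" if "A \<subseteq> {1..m}" for A
      using alternating_normal_form[OF n _ F[OF that]] unfolding B_def by blast
    have "rigid n (alpha n)"
      using normal_form[of "{}"] pair_braid_rigid assms by (auto simp: alpha_B)
    moreover have "B ` Pow {1..m} \<subseteq> ultra_summit_set n (alpha n)"
    proof
      fix x assume "x \<in> B ` Pow {1..m}"
      then obtain A where A: "A \<subseteq> {1..m}" "x = B A" by auto
      then obtain p q where pq: "rigid_pair n p q" "x = pair_braid n p q" using normal_form by blast
      have "x \<in> conjugates n (alpha n)"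
        using alternating_conjugate[of n "insert 0 A"] assms by (simp add: A alpha B_def)
      moreover have "braid_perm (alpha n) s \<noteq> s" if "s \<in> {1..n}" for s
        using no_fixed_point_alternating_0[OF n that] by (simp add: alpha braid_perm_braid_of[OF bw])
      ultimately show "x \<in> ultra_summit_set n (alpha n)"
        using pair_braid_in_ultra_summit_set[OF n pq(1) closed] exponent pq(2) by simp
    qed
    moreover have "inj_on B (Pow {1..m})"
    proof (rule inj_onI)
      fix A A' assume A: "A \<in> Pow {1..m}" "A' \<in> Pow {1..m}" and eq: "B A = B A'"
      have "strand_end (alternating (insert 0 A) (n - 1)) = strand_end (alternating (insert 0 A') (n - 1))"
        using arg_cong[OF eq, of braid_perm] by (simp add: B_def braid_perm_braid_of[OF bw])
      then have "i \<in> insert 0 A \<longleftrightarrow> i \<in> insert 0 A'" if "i \<in> {1..m}" for i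
        using flip_iff_strand_end[OF n _ F] A that by (simp add: m_def)
      then show "A = A'" using A by (force simp: Pow_def)
    qed
    then have "card (B ` Pow {1..m}) = 2 ^ ((n - 2) div 2)"
      by (simp add: card_image card_Pow m_def)
    moreover have "finite (B ` Pow {1..m})" by simp
    ultimately show ?thesis by blast
  qed
qed

end
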